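(* Let $\Omega$ be the unit ball of $\mathbb{C}^{3}$ for the standard Hermitian norm, and for an integer $m\ge1$ and a real number $\mu>0$ let $$\widehat{\Omega}_{m}(\mu)=\{(z,Z)\in\Omega\times\mathbb{C}^{m}:\|Z\|^{2}<(1-\|z\|^{2})^{\mu}\}.$$ For $1\le m\le5$, let $\mu_m$ be the unique positive root of the polynomial $$q_m(\mu)=6+\tfrac{11(m-1)}{2}\mu+\tfrac{3m(m-3)}{2}\mu^{2}+\tfrac{(m-1)(m^{2}-5m-2)}{8}\mu^{3}.$$ If $m\ge6$, the domain $\widehat{\Omega}_{m}(\mu)$ is a Lu Qikeng domain for every $\mu\in\,]0,+\infty[$. If $1\le m\le5$, the domain $\widehat{\Omega}_{m}(\mu)$ is a Lu Qikeng domain if and only if $0<\mu\le\mu_m$.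
   Context: A domain $U\subset\mathbb{C}^n$ is called a Lu Qikeng domain if its Bergman kernel $K_U(z,w)$ has no zero on $U\times U$. $\|\cdot\|$ denotes the standard Hermitian norm. The polynomial $q_m$ is $q_m(\mu)=P_{\mu}^{m}(\frac12)$, where $$P_{\mu}^{m}(\eta)=(1-\mu)(2-\mu)(3-\mu)+(m+1)\mu(1-\mu)(11-7\mu)\eta+6(m+1)(m+2)(1-\mu)\mu^{2}\eta^{2}+(m+1)(m+2)(m+3)\mu^{3}\eta^{3}.$$ For $1\le m\le5$ it has exactly one positive root. *)

theory Defs
  imports "HOL-Analysis.Analysis" "HOL-Computational_Algebra.Polynomial"
begin

text \<open>
  \<open>\<complex>\<^sup>n\<close> is \<^typ>\<open>complex ^ 'n\<close>; its library norm is the standard Hermitian norm and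
  \<^term>\<open>lborel\<close> is Lebesgue measure on the underlying \<open>\<real>\<^bsup>2n\<^esup>\<close>.
\<close>

text \<open>
  The real Frechet derivative is required to be \<open>\<complex>\<close>-linear. Meaningful for open \<open>U\<close>.
\<close>

definition holomorphic_several_on :: "(complex ^ 'n \<Rightarrow> complex) \<Rightarrow> (complex ^ 'n) set \<Rightarrow> bool" where
  "holomorphic_several_on f U \<longleftrightarrow>
     (\<forall>p\<in>U. \<exists>f'. (f has_derivative f') (at p) \<and> (\<forall>c v. f' (c *s v) = c * f' v))"

definition bergman_space :: "(complex ^ 'n) set \<Rightarrow> (complex ^ 'n \<Rightarrow> complex) set" where
  "bergman_space U =
     {f. holomorphic_several_on f U \<and> set_integrable lborel U (\<lambda>z. (norm (f z))\<^sup>2)}"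

definition is_bergman_kernel ::
    "(complex ^ 'n) set \<Rightarrow> (complex ^ 'n \<Rightarrow> complex ^ 'n \<Rightarrow> complex) \<Rightarrow> bool" where
  "is_bergman_kernel U K \<longleftrightarrow>
     (\<forall>w\<in>U. (\<lambda>z. K z w) \<in> bergman_space U \<and>
        (\<forall>f\<in>bergman_space U. f w = (LINT z:U|lborel. f z * cnj (K z w))))"

text \<open>
  The reproducing property determines the kernel only on \<open>U \<times> U\<close>; it is extended by \<open>0\<close>
  so that the description is definite.
\<close>

definition bergman_kernel :: "(complex ^ 'n) set \<Rightarrow> complex ^ 'n \<Rightarrow> complex ^ 'n \<Rightarrow> complex" where
  "bergman_kernel U =
     (THE K. is_bergman_kernel U K \<and> (\<forall>z w. z \<notin> U \<or> w \<notin> U \<longrightarrow> K z w = 0))"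

definition Lu_Qikeng_domain :: "(complex ^ 'n) set \<Rightarrow> bool" where
  "Lu_Qikeng_domain U \<longleftrightarrow>
     open U \<and> connected U \<and> U \<noteq> {} \<and> (\<forall>z\<in>U. \<forall>w\<in>U. bergman_kernel U z w \<noteq> 0)"

text \<open>
  \<open>\<complex>\<^sup>3 \<times> \<complex>\<^sup>m\<close> is identified with \<open>\<complex>\<^bsup>3+m\<^esup>\<close> by means of the sum of the index types:
  a pair \<open>(z, Z)\<close> is the vector with components \<open>z\<close> at \<open>Inl\<close> and \<open>Z\<close> at \<open>Inr\<close>.
\<close>

definition join_vec :: "complex ^ 'a \<Rightarrow> complex ^ 'b \<Rightarrow> complex ^ ('a + 'b)" where
  "join_vec z Z = (\<chi> i. case i of Inl j \<Rightarrow> z $ j | Inr k \<Rightarrow> Z $ k)"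

definition Omega_hat :: "real \<Rightarrow> (complex ^ (3 + 'm::finite)) set" where
  "Omega_hat \<mu> =
     {join_vec z Z | z Z. z \<in> ball 0 1 \<and> (norm Z)\<^sup>2 < (1 - (norm z)\<^sup>2) powr \<mu>}"

definition q_poly :: "nat \<Rightarrow> real poly" where
  "q_poly m =
     [: 6,
        11 * (real m - 1) / 2,
        3 * real m * (real m - 3) / 2,
        (real m - 1) * ((real m)\<^sup>2 - 5 * real m - 2) / 8 :]"

definition mu_root :: "nat \<Rightarrow> real" where
  "mu_root m = (THE r. r > 0 \<and> poly (q_poly m) r = 0)"

end

theory Submission
  imports Defs "HOL-Complex_Analysis.Complex_Analysis"
begin

text \<open>
  Write a point of the domain as \<open>(z, Z)\<close> and let \<open>m\<close> be the dimension of the fibre. For two points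
  \<open>(z, Z)\<close> and \<open>(w, W)\<close> put \<open>s = \<langle>z, w\<rangle>\<close>, \<open>t = \<langle>Z, W\<rangle>\<close> and \<open>X = t / (1 - s)^\<mu>\<close>. Expanding in the fibre
  variable, the Bergman kernel of the Hartogs domain is a sum of weighted Bergman kernels of the ball,
  \<open>\<Sum>k. c k * t^k * (1 - s)^(- \<mu> (m + k) - 4)\<close>, where \<open>c k\<close> is a rising factorial of \<open>k\<close> times a cubic
  polynomial in \<open>\<mu> (m + k)\<close>. So the kernel is \<open>(1 - s)^(- \<mu> m - 4)\<close> times a function of \<open>X\<close> alone, and summing
  the series gives, up to factors without zeros, a cubic polynomial evaluated at \<open>\<eta> = 1 / (1 - X)\<close>
  (\<open>kernel_gen_sums\<close>). On the domain \<open>X\<close> takes exactly the values of the open unit disc, that is, \<open>\<eta>\<close> runs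
  through the half-plane \<open>Re \<eta> > 1/2\<close>. The domain is therefore Lu Qikeng if and only if the cubic has no
  root there (\<open>Lu_Qikeng_Omega_hat_iff\<close>).

  The polynomial \<open>q_poly m\<close> is the value of the cubic at \<open>\<eta> = 1/2\<close>. If it is negative, the intermediate value
  theorem gives a real root to the right of \<open>1/2\<close>. If it is nonnegative, the cubic in \<open>\<eta> - 1/2\<close> satisfies the
  (weak) Routh--Hurwitz inequalities, which exclude roots in the open right half-plane. It remains to see
  where \<open>q_poly m\<close> is nonnegative: everywhere for \<open>m \<ge> 6\<close>, because its coefficients are nonnegative, and
  up to its unique positive root for \<open>m \<le> 5\<close>, because \<open>q_poly m \<mu> / \<mu>\<^sup>2\<close> is then strictly decreasing.

  The analytic work is to prove that the explicit function reproduces the Bergman space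
  (\<open>hartogs_kernel_reproducing\<close>); uniqueness of the kernel is then formal. A blockwise unitary
  change of coordinates, which preserves the domain, Lebesgue measure and the candidate kernel, moves the
  evaluation point to one whose only nonzero coordinates are one real coordinate in each block. For such a
  point the kernel is a power series in two coordinates \<open>x\<close> and \<open>y\<close> of the integration variable.
  Integrals of \<open>f\<close> against \<open>x^j y^k\<close> are computed by averaging over rotations of the
  coordinates: by Cauchy's formula the averages replace \<open>f\<close> by a single term of its Taylor expansion in
  \<open>x\<close> and \<open>y\<close> (\<open>monomial_integral\<close>), and the remaining moments of the domain are Dirichlet
  integrals. Multiplied by the coefficients of the kernel the moments cancel, and the
  Taylor series of \<open>f\<close> at the evaluation point is what is left (\<open>reproducing_on_axes\<close>).
\<close>

unbundle no fps_syntax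

section \<open>Lebesgue measure on complex coordinate space\<close>

text \<open>
  The image \<open>\<nu>\<close> of Lebesgue measure under a linear bijection is again translation invariant. Fubini's theorem
  then gives \<open>\<lambda> A * \<nu> B = \<lambda> B * \<nu> A\<close> for all Borel sets, so \<open>\<nu>\<close> is a multiple of \<open>\<lambda>\<close>, and the factor is \<open>1\<close>
  because an isometry preserves the unit ball.
\<close>

lemma distr_lborel_isometry:
  fixes f :: "'a::euclidean_space \<Rightarrow> 'a"
  assumes lin: "linear f" and iso: "\<And>x. norm (f x) = norm x"
  shows "distr lborel borel f = lborel"
proof (rule measure_eqI)
  have inj: "inj f"
    using iso by (metis lin linear_injective_0 norm_eq_zero)
  have surj: "surj f" using linear_injective_imp_surjective[OF lin inj] by simp
  have [measurable]: "f \<in> borel_measurable borel"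
    by (intro borel_measurable_continuous_onI linear_continuous_on linear_conv_bounded_linear[THEN iffD1] lin)
  define \<nu> where "\<nu> = distr lborel borel f"
  have sets\<nu>[measurable_cong, simp]: "sets \<nu> = sets borel" and [simp]: "space \<nu> = UNIV" by (auto simp: \<nu>_def)
  have ball: "emeasure \<nu> (ball 0 r) = emeasure lborel (ball (0::'a) r)" for r
    by (simp add: \<nu>_def emeasure_distr) (simp add: vimage_def ball_def iso)
  interpret \<nu>: sigma_finite_measure \<nu>
  proof
    show "\<exists>A. countable A \<and> A \<subseteq> sets \<nu> \<and> \<Union> A = space \<nu> \<and> (\<forall>a\<in>A. emeasure \<nu> a \<noteq> \<infinity>)"
    proof (intro exI[of _ "range (\<lambda>n::nat. ball 0 (real n))"] conjI ballI)
      show "\<Union> (range (\<lambda>n::nat. ball 0 (real n))) = space \<nu>"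
        by (auto simp: reals_Archimedean2)
      fix a assume "a \<in> range (\<lambda>n::nat. ball (0::'a) (real n))"
      then show "emeasure \<nu> a \<noteq> \<infinity>" using emeasure_bounded_finite[of a] ball by fastforce
    qed auto
  qed
  interpret P: pair_sigma_finite lborel \<nu> ..
  have shift\<nu>: "emeasure \<nu> ((\<lambda>x. y + x) -` B) = emeasure \<nu> B" if B[measurable]: "B \<in> sets borel" for y B
  proof -
    obtain y' where y': "y = f y'" using surj by (metis surjD)
    have "emeasure \<nu> ((\<lambda>x. y + x) -` B) = emeasure lborel (f -` ((\<lambda>x. y + x) -` B))"
      by (simp add: \<nu>_def emeasure_distr measurable_sets_borel[OF _ B])
    also have "f -` ((\<lambda>x. y + x) -` B) = (\<lambda>x. y' + x) -` (f -` B)"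
      by (auto simp: y' linear_add[OF lin])
    also have "emeasure lborel ((\<lambda>x. y' + x) -` (f -` B)) = emeasure (distr lborel borel ((+) y')) (f -` B)"
      by (subst emeasure_distr) (auto simp: measurable_sets_borel[OF _ B])
    also have "\<dots> = emeasure \<nu> B"
      by (simp add: lborel_distr_plus \<nu>_def emeasure_distr)
    finally show ?thesis .
  qed
  have shiftl: "emeasure lborel ((\<lambda>x. y + x) -` B) = emeasure lborel B" if B[measurable]: "B \<in> sets borel" for y :: 'a and B
  proof -
    have "emeasure (distr lborel borel ((+) y)) B = emeasure lborel ((\<lambda>x. y + x) -` B)"
      by (subst emeasure_distr) auto
    then show ?thesis by (simp add: lborel_distr_plus)
  qed
  have refl: "emeasure lborel (uminus -` B) = emeasure lborel B" if B[measurable]: "B \<in> sets borel" for B :: "'a set"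
  proof -
    have "emeasure (distr lborel borel uminus) B = emeasure lborel (uminus -` B)"
      by (subst emeasure_distr) auto
    then show ?thesis using lborel_affine[of "-1" "0::'a"] by (simp add: density_1 fun_Compl_def)
  qed
  have key: "emeasure lborel A * emeasure \<nu> B = emeasure lborel B * emeasure \<nu> A" 
    if A[measurable]: "A \<in> sets borel" and B[measurable]: "B \<in> sets borel" for A B
  proof -
    have "emeasure \<nu> A * emeasure lborel B = (\<integral>\<^sup>+x. indicator A x * emeasure lborel B \<partial>\<nu>)"
      by (simp add: nn_integral_multc)
    also have "\<dots> = (\<integral>\<^sup>+x. indicator A x * emeasure lborel ((\<lambda>y. x + y) -` B) \<partial>\<nu>)"
      by (simp add: shiftl)
    also have "\<dots> = (\<integral>\<^sup>+x. \<integral>\<^sup>+y. indicator A x * indicator B (x + y) \<partial>lborel \<partial>\<nu>)"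
    proof (rule nn_integral_cong)
      fix x
      have "(\<integral>\<^sup>+y. indicator A x * indicator B (x + y) \<partial>lborel) = indicator A x * (\<integral>\<^sup>+y. indicator ((\<lambda>y. x + y) -` B) y \<partial>lborel)"
        by (subst nn_integral_cmult[symmetric]) (auto simp: indicator_def)
      also have "\<dots> = indicator A x * emeasure lborel ((\<lambda>y. x + y) -` B)"
        by (subst nn_integral_indicator) (auto simp: measurable_sets_borel[OF _ B])
      finally show "indicator A x * emeasure lborel ((\<lambda>y. x + y) -` B) = (\<integral>\<^sup>+y. indicator A x * indicator B (x + y) \<partial>lborel)" ..
    qed
    also have "\<dots> = (\<integral>\<^sup>+y. \<integral>\<^sup>+x. indicator A x * indicator B (x + y) \<partial>\<nu> \<partial>lborel)"
      by (rule P.Fubini') auto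
    also have "\<dots> = (\<integral>\<^sup>+y. \<integral>\<^sup>+x. indicator A (x - y) * indicator B x \<partial>\<nu> \<partial>lborel)"
    proof (rule nn_integral_cong)
      fix y
      have "(\<integral>\<^sup>+x. indicator A x * indicator B (x + y) \<partial>\<nu>) = (\<integral>\<^sup>+x. indicator ((\<lambda>x. y + x) -` ((\<lambda>x. x - y) -` A \<inter> B)) x \<partial>\<nu>)"
        by (intro nn_integral_cong) (auto simp: indicator_def add.commute)
      also have "\<dots> = emeasure \<nu> ((\<lambda>x. y + x) -` ((\<lambda>x. x - y) -` A \<inter> B))"
        by (subst nn_integral_indicator) (auto intro!: measurable_sets_borel[of _ borel])
      also have "\<dots> = emeasure \<nu> ((\<lambda>x. x - y) -` A \<inter> B)"
        by (subst shift\<nu>) (auto intro!: measurable_sets_borel[of _ borel])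
      also have "\<dots> = (\<integral>\<^sup>+x. indicator ((\<lambda>x. x - y) -` A \<inter> B) x \<partial>\<nu>)"
        by (subst nn_integral_indicator) (auto intro!: measurable_sets_borel[of _ borel])
      also have "\<dots> = (\<integral>\<^sup>+x. indicator A (x - y) * indicator B x \<partial>\<nu>)"
        by (intro nn_integral_cong) (auto simp: indicator_def)
      finally show "(\<integral>\<^sup>+x. indicator A x * indicator B (x + y) \<partial>\<nu>) = (\<integral>\<^sup>+x. indicator A (x - y) * indicator B x \<partial>\<nu>)" .
    qed
    also have "\<dots> = (\<integral>\<^sup>+x. \<integral>\<^sup>+y. indicator A (x - y) * indicator B x \<partial>lborel \<partial>\<nu>)"
      by (rule P.Fubini'[symmetric]) auto
    also have "\<dots> = (\<integral>\<^sup>+x. emeasure lborel A * indicator B x \<partial>\<nu>)"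
    proof (rule nn_integral_cong)
      fix x
      have "(\<integral>\<^sup>+y. indicator A (x - y) * indicator B x \<partial>lborel) = (\<integral>\<^sup>+y. indicator (uminus -` ((\<lambda>y. x + y) -` A)) y \<partial>lborel) * indicator B x"
        by (subst nn_integral_multc[symmetric]) (auto simp: indicator_def intro!: measurable_sets_borel[of _ borel])
      also have "\<dots> = emeasure lborel (uminus -` ((\<lambda>y. x + y) -` A)) * indicator B x"
        by (subst nn_integral_indicator) (auto intro!: measurable_sets_borel[of _ borel])
      also have "\<dots> = emeasure lborel A * indicator B x"
        by (subst refl) (auto simp: shiftl intro!: measurable_sets_borel[of _ borel])
      finally show "(\<integral>\<^sup>+y. indicator A (x - y) * indicator B x \<partial>lborel) = emeasure lborel A * indicator B x" .
    qed
    also have "\<dots> = emeasure lborel A * emeasure \<nu> B"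
      by (simp add: nn_integral_cmult)
    finally show ?thesis by (simp add: mult.commute)
  qed
  have em: "emeasure lborel (ball (0::'a) 1) = ennreal (measure lborel (ball (0::'a) 1))"
    using emeasure_lborel_ball_finite[of "0::'a" 1] by (intro emeasure_eq_ennreal_measure) auto
  have pos: "measure lborel (ball (0::'a) 1) > 0" using content_ball_pos[of 1 "0::'a"] by simp
  fix A assume "A \<in> sets (distr lborel borel f)"
  then have A: "A \<in> sets borel" by simp
  have "emeasure lborel A * emeasure lborel (ball (0::'a) 1) = emeasure \<nu> A * emeasure lborel (ball (0::'a) 1)"
    using key[OF A, of "ball 0 1"] ball[of 1] by (simp add: mult.commute)
  then have "emeasure \<nu> A = emeasure lborel A" 
    unfolding em using pos by (subst (asm) mult.commute, subst (asm) (2) mult.commute, subst (asm) ennreal_mult_cancel_left) auto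
  then show "emeasure (distr lborel borel f) A = emeasure lborel A" by (simp add: \<nu>_def)
qed simp

lemma measurable_vec_lambda:
  "(\<lambda>x. \<chi> i. (x i :: complex)) \<in> Pi\<^sub>M (UNIV::'n::finite set) (\<lambda>_. lborel) \<rightarrow>\<^sub>M borel"
proof (subst borel_measurable_euclidean_space, rule ballI)
  fix b :: "complex ^ 'n" assume "b \<in> Basis"
  then obtain i u where b: "b = axis i u" by (auto simp: Basis_vec_def)
  have "(\<lambda>x. (\<chi> i. x i) \<bullet> b) = (\<lambda>x. x i \<bullet> u)"
    by (simp add: b inner_axis)
  then show "(\<lambda>x. (\<chi> i. x i) \<bullet> b) \<in> borel_measurable (Pi\<^sub>M (UNIV::'n set) (\<lambda>_. lborel))"
    by simp
qed

lemma lborel_complex_vec: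
  "(lborel :: (complex ^ 'n::finite) measure) = distr (Pi\<^sub>M UNIV (\<lambda>_. lborel)) borel (\<lambda>x. \<chi> i. x i)"
proof (rule lborel_eqI)
  interpret finite_product_sigma_finite "\<lambda>_::'n. lborel :: complex measure" UNIV by standard auto
  fix l u :: "complex ^ 'n"
  assume le: "\<And>b. b \<in> Basis \<Longrightarrow> l \<bullet> b \<le> u \<bullet> b"
  have le': "(l $ i) \<bullet> b \<le> (u $ i) \<bullet> b" if "b \<in> Basis" for i b
    using le[of "axis i b"] that by (auto simp: Basis_vec_def inner_axis)
  have vim: "(\<lambda>x. \<chi> i. x i) -` box l u \<inter> space (Pi\<^sub>M UNIV (\<lambda>_. lborel)) = Pi\<^sub>E UNIV (\<lambda>i. box (l $ i) (u $ i))"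
    by (auto simp: space_PiM box_def Basis_vec_def inner_axis)
  have Bas: "(Basis :: (complex ^ 'n) set) = (\<lambda>(i,u). axis i u) ` (UNIV \<times> Basis)"
    by (auto simp: Basis_vec_def)
  have inj: "inj_on (\<lambda>(i,u). axis i u :: complex ^ 'n) (UNIV \<times> Basis)"
    by (auto simp: inj_on_def axis_eq_axis)
  have "emeasure (distr (Pi\<^sub>M UNIV (\<lambda>_. lborel)) borel (\<lambda>x. \<chi> i. x i)) (box l u) =
     emeasure (Pi\<^sub>M UNIV (\<lambda>_. lborel)) (Pi\<^sub>E UNIV (\<lambda>i::'n. box (l $ i) (u $ i)))"
    by (subst emeasure_distr[OF measurable_vec_lambda]) (simp_all add: vim)
  also have "\<dots> = (\<Prod>i\<in>UNIV. emeasure lborel (box (l $ i) (u $ i)))"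
    by (subst measure_times) auto
  also have "\<dots> = (\<Prod>i\<in>UNIV. ennreal (\<Prod>b\<in>Basis. (u $ i - l $ i) \<bullet> b))"
    using le' by (intro prod.cong refl, subst emeasure_lborel_box) auto
  also have "\<dots> = ennreal (\<Prod>i\<in>UNIV. \<Prod>b\<in>Basis. (u $ i - l $ i) \<bullet> b)"
    by (subst prod_ennreal) (auto intro!: prod_nonneg simp: le' inner_diff_left)
  also have "(\<Prod>i\<in>UNIV. \<Prod>b\<in>Basis. (u $ i - l $ i) \<bullet> b) = (\<Prod>b\<in>Basis. (u - l) \<bullet> b)"
    unfolding Bas prod.reindex[OF inj] o_def prod.cartesian_product
    by (intro prod.cong) (auto simp: inner_axis)
  finally show "emeasure (distr (Pi\<^sub>M UNIV (\<lambda>_. lborel)) borel (\<lambda>x. \<chi> i. x i)) (box l u) = ennreal (\<Prod>b\<in>Basis. (u - l) \<bullet> b)" .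
qed simp

text \<open>
  Both sides integrate \<open>g\<close> against the distribution of the squared modulus, which is \<open>pi\<close> times Lebesgue measure on
  the half-line because a disc of squared radius \<open>s\<close> has area \<open>pi * s\<close>.
\<close>

lemma nn_integral_complex_radial:
  fixes g :: "real \<Rightarrow> ennreal"
  assumes [measurable]: "g \<in> borel_measurable borel"
  shows "(\<integral>\<^sup>+x. g ((norm (x::complex))\<^sup>2) \<partial>lborel) = (\<integral>\<^sup>+s. ennreal pi * (indicator {0<..} s * g s) \<partial>lborel)"
proof -
  \<comment> \<open>The sign makes the upper rays have finite measure, as the uniqueness criterion for measures requires.\<close>
  have eq: "distr lborel borel (\<lambda>x::complex. - (norm x)\<^sup>2) = density lborel (\<lambda>s. ennreal pi * indicator {..<0} s)" (is "?M = ?N")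
  proof (rule measure_eqI_lessThan)
    fix s :: real
    have N: "emeasure ?N {s<..} = ennreal (pi * max 0 (-s))"
    proof -
      have "emeasure ?N {s<..} = (\<integral>\<^sup>+x. ennreal pi * indicator {s<..<0} x \<partial>lborel)"
        by (subst emeasure_density) (auto intro!: nn_integral_cong simp: indicator_def)
      also have "\<dots> = ennreal pi * emeasure lborel {s<..<0}"
        by (subst nn_integral_cmult_indicator) auto
      also have "\<dots> = ennreal (pi * max 0 (-s))"
        by (cases "s \<le> 0") (auto simp: ennreal_mult'[symmetric] max_def)
      finally show ?thesis .
    qed
    have vim: "(\<lambda>x::complex. - (norm x)\<^sup>2) -` {s<..} = (if s < 0 then ball 0 (sqrt (-s)) else {})"
    proof (cases "s < 0")
      case True
      have "s < - (norm x)\<^sup>2 \<longleftrightarrow> norm x < sqrt (-s)" for x :: complex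
        by (metis abs_norm_cancel minus_less_iff real_sqrt_abs real_sqrt_less_iff neg_less_iff_less minus_minus)
      then show ?thesis using True by auto
    next
      case False then show ?thesis by (auto simp: not_less) (smt (verit) zero_le_power2)
    qed
    have "emeasure ?M {s<..} = emeasure lborel ((\<lambda>x::complex. - (norm x)\<^sup>2) -` {s<..})"
      by (subst emeasure_distr) auto
    also have "\<dots> = ennreal (pi * max 0 (-s))"
      unfolding vim by (auto simp: emeasure_ball unit_ball_vol_2)
    finally show "emeasure ?M {s<..} = emeasure ?N {s<..}" using N by simp
    then show "emeasure ?M {s<..} < \<infinity>" using N by simp
  qed auto
  have "(\<integral>\<^sup>+x. g ((norm (x::complex))\<^sup>2) \<partial>lborel) = (\<integral>\<^sup>+s. g (- s) \<partial>?M)"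
    by (subst nn_integral_distr) auto
  also have "\<dots> = (\<integral>\<^sup>+s. ennreal pi * (indicator {..<0} s * g (-s)) \<partial>lborel)"
    unfolding eq by (subst nn_integral_density) (auto simp: mult.assoc)
  also have "\<dots> = (\<integral>\<^sup>+s. ennreal pi * (indicator {..<0} (-s) * g s) \<partial>lborel)"
    using nn_integral_distr[of uminus lborel borel "\<lambda>s. ennreal pi * (indicator {..<0} s * g (-s))"] by (simp add: lborel_distr_uminus)
  also have "\<dots> = (\<integral>\<^sup>+s. ennreal pi * (indicator {0<..} s * g s) \<partial>lborel)"
    by (intro nn_integral_cong) (auto simp: indicator_def)
  finally show ?thesis .
qed

lemma beta_integral_scaled:
  fixes \<alpha> R :: real and j :: nat
  assumes "\<alpha> \<ge> 0"
  shows "(\<integral>\<^sup>+s. indicator {0<..} s * ennreal (s ^ j * max 0 (R - s) powr \<alpha>) \<partial>lborel)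
     = ennreal (fact j / pochhammer (\<alpha> + 1) (Suc j) * max 0 R powr (\<alpha> + real j + 1))"
proof (cases "R > 0")
  case False
  then have "(\<integral>\<^sup>+s. indicator {0<..} s * ennreal (s ^ j * max 0 (R - s) powr \<alpha>) \<partial>lborel) = (\<integral>\<^sup>+s. 0 \<partial>(lborel::real measure))"
    by (intro nn_integral_cong) (auto simp: indicator_def max_def)
  then show ?thesis using False by (simp add: max_def)
next
  case True
  have B: "Beta (real j + 1) (\<alpha> + 1) = fact j / pochhammer (\<alpha> + 1) (Suc j)"
  proof -
    have "Gamma (\<alpha> + 1) > 0" using assms by (intro Gamma_real_pos) auto
    moreover have "pochhammer (\<alpha> + 1) (Suc j) = Gamma (\<alpha> + 1 + real (Suc j)) / Gamma (\<alpha> + 1)"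
      using assms by (intro pochhammer_Gamma) (auto elim!: nonpos_Ints_cases)
    ultimately show ?thesis
      by (simp add: Beta_def Gamma_fact add_ac)
  qed
  have I: "((\<lambda>t. t ^ j * (1 - t) powr \<alpha>) has_integral Beta (real j + 1) (\<alpha> + 1)) {0<..<1}"
  proof -
    have "((\<lambda>t. t powr (real j + 1 - 1) * (1 - t) powr (\<alpha> + 1 - 1)) has_integral Beta (real j + 1) (\<alpha> + 1)) {0<..<1}"
      using has_integral_Beta_real[of "real j + 1" "\<alpha> + 1"] assms by (simp add: has_integral_Icc_iff_Ioo)
    then show ?thesis
      by (rule has_integral_eq[rotated]) (auto simp: powr_realpow)
  qed
  have Ig: "(\<integral>\<^sup>+t. indicator {0<..<1} t * ennreal (t ^ j * (1 - t) powr \<alpha>) \<partial>lborel) = ennreal (fact j / pochhammer (\<alpha> + 1) (Suc j))"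
    using nn_integral_has_integral_lebesgue[OF _ I] unfolding B
    by (simp add: ennreal_mult' ennreal_indicator)
  have "(\<integral>\<^sup>+s. indicator {0<..} s * ennreal (s ^ j * max 0 (R - s) powr \<alpha>) \<partial>lborel)
     = ennreal \<bar>R\<bar> * (\<integral>\<^sup>+t. indicator {0<..} (0 + R * t) * ennreal ((0 + R * t) ^ j * max 0 (R - (0 + R * t)) powr \<alpha>) \<partial>lborel)"
    using True by (intro nn_integral_real_affine) auto
  also have "\<dots> = ennreal \<bar>R\<bar> * (\<integral>\<^sup>+t. ennreal (R ^ j * R powr \<alpha>) * (indicator {0<..<1} t * ennreal (t ^ j * (1 - t) powr \<alpha>)) \<partial>lborel)"
  proof -
    have "indicator {0<..} (0 + R * t) * ennreal ((0 + R * t) ^ j * max 0 (R - (0 + R * t)) powr \<alpha>) = 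
       ennreal (R ^ j * R powr \<alpha>) * (indicator {0<..<1} t * ennreal (t ^ j * (1 - t) powr \<alpha>))" for t
    proof (cases "0 < t \<and> t < 1")
      case T: True
      have "max 0 (R - R * t) = R * (1 - t)" using T True by (simp add: max_def algebra_simps)
      then show ?thesis using T True
        by (auto simp: power_mult_distrib powr_mult ennreal_mult[symmetric] mult_ac)
    next
      case False
      then have "R * t \<le> 0 \<or> R - R * t \<le> 0" using True by (auto simp: not_less mult_le_0_iff)
      then show ?thesis using False True by (auto simp: indicator_def max_def zero_less_mult_iff)
    qed
    then show ?thesis by simp
  qed
  also have "\<dots> = ennreal (R * (R ^ j * R powr \<alpha>)) * ennreal (fact j / pochhammer (\<alpha> + 1) (Suc j))"
    using True by (subst nn_integral_cmult) (auto simp: Ig ennreal_mult mult.assoc)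
  also have "R * (R ^ j * R powr \<alpha>) = max 0 R powr (\<alpha> + real j + 1)"
    using True by (simp add: powr_add powr_realpow max_def)
  finally show ?thesis 
    using assms by (simp add: ennreal_mult[symmetric] pochhammer_nonneg mult_ac)
qed

lemma complex_beta_integral:
  fixes \<alpha> R :: real and j :: nat
  assumes "\<alpha> \<ge> 0"
  shows "(\<integral>\<^sup>+x. ennreal (norm (x::complex) ^ (2 * j) * max 0 (R - (norm x)\<^sup>2) powr \<alpha>) \<partial>lborel)
     = ennreal (pi * fact j / pochhammer (\<alpha> + 1) (Suc j) * max 0 R powr (\<alpha> + real j + 1))"
proof -
  have "(\<integral>\<^sup>+x. ennreal (norm (x::complex) ^ (2 * j) * max 0 (R - (norm x)\<^sup>2) powr \<alpha>) \<partial>lborel)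
    = (\<integral>\<^sup>+x. ennreal (((norm (x::complex))\<^sup>2) ^ j * max 0 (R - (norm x)\<^sup>2) powr \<alpha>) \<partial>lborel)"
    by (simp add: power_mult)
  also have "\<dots> = (\<integral>\<^sup>+s. ennreal pi * (indicator {0<..} s * ennreal (s ^ j * max 0 (R - s) powr \<alpha>)) \<partial>lborel)"
    using nn_integral_complex_radial[of "\<lambda>s. ennreal (s ^ j * max 0 (R - s) powr \<alpha>)"] by simp
  also have "\<dots> = ennreal pi * ennreal (fact j / pochhammer (\<alpha> + 1) (Suc j) * max 0 R powr (\<alpha> + real j + 1))"
    by (subst nn_integral_cmult) (auto simp: beta_integral_scaled[OF assms])
  finally show ?thesis by (simp add: ennreal_mult'[symmetric] mult.assoc)
qed

text \<open>
  Dirichlet's integral. Integrating out one coordinate turns a power of the truncated \<open>R - |x|\<^sup>2 - ...\<close> into a higher power of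
  the same kind, so that the coordinates can be removed one at a time. As \<open>0 powr 0 = 0\<close>, the exponent \<open>0\<close> gives the
  indicator function of the open ball.
\<close>

lemma dirichlet_integral:
  fixes \<alpha> R :: real and J :: "'i \<Rightarrow> nat"
  assumes "finite I" "\<alpha> \<ge> 0"
  shows "(\<integral>\<^sup>+x. ennreal ((\<Prod>i\<in>I. norm (x i :: complex) ^ (2 * J i)) * max 0 (R - (\<Sum>i\<in>I. (norm (x i))\<^sup>2)) powr \<alpha>) \<partial>Pi\<^sub>M I (\<lambda>_. lborel))
     = ennreal (pi ^ card I * (\<Prod>i\<in>I. fact (J i)) / pochhammer (\<alpha> + 1) (card I + (\<Sum>i\<in>I. J i))
          * max 0 R powr (\<alpha> + real (card I + (\<Sum>i\<in>I. J i))))"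
  using assms(1)
proof (induction I arbitrary: R rule: finite_induct)
  case empty
  interpret product_sigma_finite "\<lambda>_::'i. lborel :: complex measure" ..
  show ?case by (simp add: PiM_empty nn_integral_count_space_finite)
next
  case (insert i I)
  interpret product_sigma_finite "\<lambda>_::'i. lborel :: complex measure" ..
  define M where "M = card I + (\<Sum>i\<in>I. J i)"
  define C where "C = pi ^ card I * (\<Prod>i\<in>I. fact (J i)) / pochhammer (\<alpha> + 1) M"
  have C: "C \<ge> 0" unfolding C_def using assms(2)
    by (auto intro!: divide_nonneg_nonneg mult_nonneg_nonneg prod_nonneg pochhammer_nonneg)
  have "(\<integral>\<^sup>+x. ennreal ((\<Prod>k\<in>insert i I. norm (x k :: complex) ^ (2 * J k)) * max 0 (R - (\<Sum>k\<in>insert i I. (cmod (x k))\<^sup>2)) powr \<alpha>) \<partial>Pi\<^sub>M (insert i I) (\<lambda>_. lborel))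
    = (\<integral>\<^sup>+y. \<integral>\<^sup>+x. ennreal ((\<Prod>k\<in>insert i I. cmod ((x(i := y)) k) ^ (2 * J k)) * max 0 (R - (\<Sum>k\<in>insert i I. (cmod ((x(i := y)) k))\<^sup>2)) powr \<alpha>) \<partial>Pi\<^sub>M I (\<lambda>_. lborel) \<partial>lborel)"
    using insert.hyps by (intro product_nn_integral_insert_rev) measurable
  also have "\<dots> = (\<integral>\<^sup>+y. ennreal C * ennreal (norm (y::complex) ^ (2 * J i) * max 0 (R - (norm y)\<^sup>2) powr (\<alpha> + real M)) \<partial>lborel)"
  proof (intro nn_integral_cong)
    fix y :: complex
    have "(\<integral>\<^sup>+x. ennreal ((\<Prod>k\<in>insert i I. cmod ((x(i := y)) k) ^ (2 * J k)) * max 0 (R - (\<Sum>k\<in>insert i I. (cmod ((x(i := y)) k))\<^sup>2)) powr \<alpha>) \<partial>Pi\<^sub>M I (\<lambda>_. lborel))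
     = (\<integral>\<^sup>+x. ennreal (norm y ^ (2 * J i)) * ennreal ((\<Prod>k\<in>I. cmod (x k) ^ (2 * J k)) * max 0 ((R - (norm y)\<^sup>2) - (\<Sum>k\<in>I. (cmod (x k))\<^sup>2)) powr \<alpha>) \<partial>Pi\<^sub>M I (\<lambda>_. lborel))"
    proof (intro nn_integral_cong)
      fix x :: "'i \<Rightarrow> complex"
      have 1: "(\<Prod>k\<in>I. cmod (if k = i then y else x k) ^ (2 * J k)) = (\<Prod>k\<in>I. cmod (x k) ^ (2 * J k))"
        using insert.hyps by (intro prod.cong) auto
      have 2: "(\<Sum>k\<in>I. (cmod (if k = i then y else x k))\<^sup>2) = (\<Sum>k\<in>I. (cmod (x k))\<^sup>2)"
        using insert.hyps by (intro sum.cong) auto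
      show "ennreal ((\<Prod>k\<in>insert i I. cmod ((x(i := y)) k) ^ (2 * J k)) * max 0 (R - (\<Sum>k\<in>insert i I. (cmod ((x(i := y)) k))\<^sup>2)) powr \<alpha>)
        = ennreal (norm y ^ (2 * J i)) * ennreal ((\<Prod>k\<in>I. cmod (x k) ^ (2 * J k)) * max 0 ((R - (norm y)\<^sup>2) - (\<Sum>k\<in>I. (cmod (x k))\<^sup>2)) powr \<alpha>)"
        using insert.hyps by (simp add: 1 2 ennreal_mult'[symmetric] mult.assoc diff_diff_eq)
    qed
    also have "\<dots> = ennreal (norm y ^ (2 * J i)) * ennreal (C * max 0 (R - (norm y)\<^sup>2) powr (\<alpha> + real M))"
      by (subst nn_integral_cmult) (auto simp: insert.IH C_def M_def)
    also have "\<dots> = ennreal C * ennreal (norm (y::complex) ^ (2 * J i) * max 0 (R - (norm y)\<^sup>2) powr (\<alpha> + real M))"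
      using C by (simp add: ennreal_mult[symmetric] mult_ac)
    finally show "(\<integral>\<^sup>+x. ennreal ((\<Prod>k\<in>insert i I. cmod ((x(i := y)) k) ^ (2 * J k)) * max 0 (R - (\<Sum>k\<in>insert i I. (cmod ((x(i := y)) k))\<^sup>2)) powr \<alpha>) \<partial>Pi\<^sub>M I (\<lambda>_. lborel))
      = ennreal C * ennreal (norm (y::complex) ^ (2 * J i) * max 0 (R - (norm y)\<^sup>2) powr (\<alpha> + real M))" .
  qed
  also have "\<dots> = ennreal C * ennreal (pi * fact (J i) / pochhammer (\<alpha> + real M + 1) (Suc (J i)) * max 0 R powr (\<alpha> + real M + real (J i) + 1))"
    using assms(2) by (subst nn_integral_cmult) (auto simp: complex_beta_integral)
  also have "\<dots> = ennreal (C * (pi * fact (J i) / pochhammer (\<alpha> + real M + 1) (Suc (J i)) * max 0 R powr (\<alpha> + real M + real (J i) + 1)))"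
    using C by (simp add: ennreal_mult'[symmetric])
  also have "C * (pi * fact (J i) / pochhammer (\<alpha> + real M + 1) (Suc (J i)) * max 0 R powr (\<alpha> + real M + real (J i) + 1))
    = pi ^ card (insert i I) * (\<Prod>k\<in>insert i I. fact (J k)) / pochhammer (\<alpha> + 1) (card (insert i I) + (\<Sum>k\<in>insert i I. J k))
          * max 0 R powr (\<alpha> + real (card (insert i I) + (\<Sum>k\<in>insert i I. J k)))"
  proof -
    have e: "card (insert i I) + (\<Sum>k\<in>insert i I. J k) = M + Suc (J i)"
      using insert.hyps by (simp add: M_def)
    have "pochhammer (\<alpha> + 1) (M + Suc (J i)) = pochhammer (\<alpha> + 1) M * pochhammer (\<alpha> + real M + 1) (Suc (J i))"
      using pochhammer_product'[of "\<alpha> + 1" M "Suc (J i)"] by (simp add: add_ac)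
    then show ?thesis unfolding e using insert.hyps by (simp add: C_def add_ac)
  qed
  finally show ?case .
qed


section \<open>The domain and its moments\<close>

lemma Omega_hat_iff:
  "p \<in> Omega_hat \<mu> \<longleftrightarrow> (\<Sum>l\<in>UNIV. (norm (p $ Inl l))\<^sup>2) < 1 \<and>
     (\<Sum>r\<in>UNIV. (norm (p $ Inr r))\<^sup>2) < (1 - (\<Sum>l\<in>UNIV. (norm (p $ Inl l))\<^sup>2)) powr \<mu>"
proof -
  have sq: "(norm x)\<^sup>2 = (\<Sum>i\<in>UNIV. (norm (x $ i))\<^sup>2)" for x :: "complex ^ 'k::finite"
    by (simp add: norm_vec_def L2_set_def sum_nonneg)
  have "p \<in> Omega_hat \<mu> \<longleftrightarrow> (\<exists>z Z. p = join_vec z Z \<and> (norm z)\<^sup>2 < 1 \<and> (norm Z)\<^sup>2 < (1 - (norm z)\<^sup>2) powr \<mu>)"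
    by (simp add: Omega_hat_def abs_square_less_1)
  also have "\<dots> \<longleftrightarrow> (\<Sum>l\<in>UNIV. (norm (p $ Inl l))\<^sup>2) < 1 \<and>
     (\<Sum>r\<in>UNIV. (norm (p $ Inr r))\<^sup>2) < (1 - (\<Sum>l\<in>UNIV. (norm (p $ Inl l))\<^sup>2)) powr \<mu>" (is "_ = ?R")
  proof
    assume ?R
    moreover have "p = join_vec (\<chi> l. p $ Inl l) (\<chi> r. p $ Inr r)"
      by (auto simp: vec_eq_iff join_vec_def split: sum.split)
    ultimately show "\<exists>z Z. p = join_vec z Z \<and> (norm z)\<^sup>2 < 1 \<and> (norm Z)\<^sup>2 < (1 - (norm z)\<^sup>2) powr \<mu>"
      by (intro exI[of _ "\<chi> l. p $ Inl l"] exI[of _ "\<chi> r. p $ Inr r"]) (simp add: sq)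
  qed (auto simp: sq join_vec_def)
  finally show ?thesis .
qed

lemma open_Omega_hat: "open (Omega_hat \<mu> :: (complex ^ (3 + 'm::finite)) set)"
proof -
  let ?a = "\<lambda>p :: complex ^ (3 + 'm). (\<Sum>l\<in>UNIV. (norm (p $ Inl l))\<^sup>2)"
  let ?b = "\<lambda>p :: complex ^ (3 + 'm). (\<Sum>r\<in>UNIV. (norm (p $ Inr r))\<^sup>2)"
  have o: "open {p. ?a p < 1}"
    by (intro open_Collect_less continuous_intros)
  have "continuous_on {p. ?a p < 1} (\<lambda>p. (1 - ?a p) powr \<mu> - ?b p)"
    by (intro continuous_intros) auto
  then have "open ((\<lambda>p. (1 - ?a p) powr \<mu> - ?b p) -` {0<..} \<inter> {p. ?a p < 1})"
    by (rule continuous_on_open_vimage[OF o, THEN iffD1, rule_format]) simp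
  also have "(\<lambda>p. (1 - ?a p) powr \<mu> - ?b p) -` {0<..} \<inter> {p. ?a p < 1} = (Omega_hat \<mu> :: (complex ^ (3 + 'm)) set)"
    by (auto simp: Omega_hat_iff)
  finally show ?thesis .
qed

text \<open>
  Two applications of Dirichlet's integral: over the fibre with exponent \<open>0\<close>, and then over the base with the exponent
  \<open>\<mu> * (m + k)\<close> that the radius of the fibre leaves behind.
\<close>

lemma nn_integral_monomial_Omega_hat:
  fixes a :: 3 and b :: "'m::finite" and \<mu> :: real
  assumes \<mu>: "\<mu> > 0"
  shows "(\<integral>\<^sup>+p. indicator (Omega_hat \<mu>) p * ennreal (norm (p $ Inl a) ^ (2 * j) * norm (p $ Inr b) ^ (2 * k)) \<partial>lborel)
    = ennreal (pi ^ CARD('m) * fact k / fact (CARD('m) + k) *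
        (pi ^ 3 * fact j / pochhammer (\<mu> * real (CARD('m) + k) + 1) (3 + j)))"
proof -
  define J where "J = (\<lambda>i::3 + 'm. if i = Inl a then j else if i = Inr b then k else 0)"
  define L where "L = range (Inl :: 3 \<Rightarrow> 3 + 'm)"
  define R where "R = range (Inr :: 'm \<Rightarrow> 3 + 'm)"
  have LR: "L \<inter> R = {}" "finite L" "finite R" "L \<union> R = UNIV"
    by (auto simp: L_def R_def UNIV_sum)
  have cL: "card L = 3" by (simp add: L_def card_image)
  have cR: "card R = CARD('m)" by (simp add: R_def card_image)
  have sums: "(\<Sum>l\<in>UNIV. g (Inl l)) = (\<Sum>i\<in>L. g i)" "(\<Sum>r\<in>UNIV. g (Inr r)) = (\<Sum>i\<in>R. g i)" for g :: "3 + 'm \<Rightarrow> real"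
    by (simp_all add: L_def R_def sum.reindex)
  have sJ: "(\<Sum>i\<in>L. J i) = j" "(\<Sum>i\<in>R. J i) = k"
    by (simp_all add: L_def R_def sum.reindex J_def sum.delta cong: if_cong)
  have pJ: "(\<Prod>i\<in>L. fact (J i)) = (fact j :: real)" "(\<Prod>i\<in>R. fact (J i)) = (fact k :: real)"
    by (simp_all add: L_def R_def prod.reindex J_def if_distrib[of fact] prod.delta cong: if_cong)
  have pL: "(\<Prod>i\<in>L. cmod (x i) ^ (2 * J i)) = cmod (x (Inl a)) ^ (2 * j)" for x
    by (simp add: L_def prod.reindex J_def if_distrib[of "\<lambda>n. _ ^ n"] if_distrib[of "\<lambda>n. 2 * n"] prod.delta cong: if_cong)
  have pR: "(\<Prod>i\<in>R. cmod (x i) ^ (2 * J i)) = cmod (x (Inr b)) ^ (2 * k)" for x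
    by (simp add: R_def prod.reindex J_def if_distrib[of "\<lambda>n. _ ^ n"] if_distrib[of "\<lambda>n. 2 * n"] prod.delta cong: if_cong)
  define f where "f = (\<lambda>x :: 3 + 'm \<Rightarrow> complex. ennreal ((\<Prod>i\<in>L. cmod (x i) ^ (2 * J i)) * ((\<Prod>i\<in>R. cmod (x i) ^ (2 * J i)) *
     max 0 (max 0 (1 - (\<Sum>i\<in>L. (cmod (x i))\<^sup>2)) powr \<mu> - (\<Sum>i\<in>R. (cmod (x i))\<^sup>2)) powr 0)))"
  interpret product_sigma_finite "\<lambda>_::3 + 'm. lborel :: complex measure" ..
  have [measurable]: "Omega_hat \<mu> \<in> sets (borel :: (complex ^ (3 + 'm)) measure)"
    by (rule borel_open[OF open_Omega_hat])
  note measurable_vec_lambda[measurable]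
  have [measurable]: "(\<lambda>p :: complex ^ (3 + 'm). p $ i) \<in> borel_measurable borel" for i :: "3 + 'm"
    by (intro borel_measurable_continuous_onI continuous_intros)
  have "(\<integral>\<^sup>+p. indicator (Omega_hat \<mu>) p * ennreal (norm (p $ Inl a) ^ (2 * j) * norm (p $ Inr b) ^ (2 * k)) \<partial>lborel)
     = (\<integral>\<^sup>+x. indicator (Omega_hat \<mu>) (\<chi> i. x i) * ennreal (norm (x (Inl a)) ^ (2 * j) * norm (x (Inr b)) ^ (2 * k)) \<partial>Pi\<^sub>M UNIV (\<lambda>_. lborel))"
    by (subst lborel_complex_vec, subst nn_integral_distr) auto
  also have "\<dots> = (\<integral>\<^sup>+x. f x \<partial>Pi\<^sub>M (L \<union> R) (\<lambda>_. lborel))"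
    unfolding LR(4)
  proof (rule nn_integral_cong)
    fix x :: "3 + 'm \<Rightarrow> complex"
    have "max 0 (max 0 (1 - (\<Sum>i\<in>L. (cmod (x i))\<^sup>2)) powr \<mu> - (\<Sum>i\<in>R. (cmod (x i))\<^sup>2)) powr 0
      = (if (\<Sum>i\<in>L. (cmod (x i))\<^sup>2) < 1 \<and> (\<Sum>i\<in>R. (cmod (x i))\<^sup>2) < (1 - (\<Sum>i\<in>L. (cmod (x i))\<^sup>2)) powr \<mu> then 1 else 0)"
    proof -
      have "max 0 (max 0 (1 - A) powr \<mu> - B) powr 0 = (if A < 1 \<and> B < (1 - A) powr \<mu> then 1 else 0)"
        if "B \<ge> 0" for A B :: real
        using that by (cases "A < 1") (auto simp: max_def)
      then show ?thesis by (simp add: sum_nonneg)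
    qed
    then show "indicator (Omega_hat \<mu>) (\<chi> i. x i) * ennreal (norm (x (Inl a)) ^ (2 * j) * norm (x (Inr b)) ^ (2 * k)) = f x"
      unfolding f_def pL pR
      by (auto simp: Omega_hat_iff sums[of "\<lambda>i. (cmod (x i))\<^sup>2"] indicator_def)
  qed
  also have "\<dots> = (\<integral>\<^sup>+x. \<integral>\<^sup>+y. f (merge L R (x, y)) \<partial>Pi\<^sub>M R (\<lambda>_. lborel) \<partial>Pi\<^sub>M L (\<lambda>_. lborel))"
    unfolding f_def by (rule product_nn_integral_fold[OF LR(1-3)]) measurable
  also have "\<dots> = (\<integral>\<^sup>+x. ennreal (pi ^ CARD('m) * fact k / fact (CARD('m) + k)) * ennreal ((\<Prod>i\<in>L. cmod (x i) ^ (2 * J i)) *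
      max 0 (1 - (\<Sum>i\<in>L. (cmod (x i))\<^sup>2)) powr (\<mu> * real (CARD('m) + k))) \<partial>Pi\<^sub>M L (\<lambda>_. lborel))"
  proof (rule nn_integral_cong)
    fix x :: "3 + 'm \<Rightarrow> complex"
    define \<rho> where "\<rho> = max 0 (1 - (\<Sum>i\<in>L. (cmod (x i))\<^sup>2)) powr \<mu>"
    define c where "c = (\<Prod>i\<in>L. cmod (x i) ^ (2 * J i))"
    have c: "c \<ge> 0" by (auto simp: c_def intro!: prod_nonneg)
    have "f (merge L R (x, y)) = ennreal c * ennreal ((\<Prod>i\<in>R. cmod (y i) ^ (2 * J i)) * max 0 (\<rho> - (\<Sum>i\<in>R. (cmod (y i))\<^sup>2)) powr 0)" for y
    proof -
      have m: "merge L R (x, y) i = x i" if "i \<in> L" for i using that by (simp add: merge_def)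
      have m': "merge L R (x, y) i = y i" if "i \<in> R" for i using that LR(1) by (auto simp: merge_def)
      show ?thesis unfolding f_def using c
        by (simp add: m m' \<rho>_def c_def ennreal_mult'[symmetric] cong: prod.cong sum.cong)
    qed
    then have "(\<integral>\<^sup>+y. f (merge L R (x, y)) \<partial>Pi\<^sub>M R (\<lambda>_. lborel)) =
      ennreal c * (\<integral>\<^sup>+y. ennreal ((\<Prod>i\<in>R. cmod (y i) ^ (2 * J i)) * max 0 (\<rho> - (\<Sum>i\<in>R. (cmod (y i))\<^sup>2)) powr 0) \<partial>Pi\<^sub>M R (\<lambda>_. lborel))"
      by (simp add: nn_integral_cmult)
    also have "\<dots> = ennreal c * ennreal (pi ^ CARD('m) * fact k / fact (CARD('m) + k) * \<rho> powr real (CARD('m) + k))"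
      by (subst dirichlet_integral) (auto simp: LR pJ sJ cR pochhammer_fact[symmetric] \<rho>_def max_def)
    also have "\<dots> = ennreal (pi ^ CARD('m) * fact k / fact (CARD('m) + k)) * ennreal (c * max 0 (1 - (\<Sum>i\<in>L. (cmod (x i))\<^sup>2)) powr (\<mu> * real (CARD('m) + k)))"
      using c by (simp add: ennreal_mult'[symmetric] \<rho>_def powr_powr mult_ac)
    finally show "(\<integral>\<^sup>+y. f (merge L R (x, y)) \<partial>Pi\<^sub>M R (\<lambda>_. lborel)) = ennreal (pi ^ CARD('m) * fact k / fact (CARD('m) + k)) * ennreal ((\<Prod>i\<in>L. cmod (x i) ^ (2 * J i)) *
      max 0 (1 - (\<Sum>i\<in>L. (cmod (x i))\<^sup>2)) powr (\<mu> * real (CARD('m) + k)))"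
      unfolding c_def .
  qed
  also have "\<dots> = ennreal (pi ^ CARD('m) * fact k / fact (CARD('m) + k)) * ennreal (pi ^ 3 * fact j / pochhammer (\<mu> * real (CARD('m) + k) + 1) (3 + j))"
    using \<mu> LR(2) by (subst nn_integral_cmult, simp, subst dirichlet_integral) (auto simp: pJ sJ cL)
  also have "\<dots> = ennreal (pi ^ CARD('m) * fact k / fact (CARD('m) + k) * (pi ^ 3 * fact j / pochhammer (\<mu> * real (CARD('m) + k) + 1) (3 + j)))"
    by (subst ennreal_mult') auto
  finally show ?thesis .
qed

section \<open>Averaging over coordinate rotations\<close>

definition rot :: "'n set \<Rightarrow> real \<Rightarrow> complex ^ 'n \<Rightarrow> complex ^ 'n" where
  "rot A t p = (\<chi> i. if i \<in> A then cis (2 * pi * t) * p $ i else p $ i)"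

lemma rot_nth [simp]: "rot A t p $ i = (if i \<in> A then cis (2 * pi * t) * p $ i else p $ i)"
  by (simp add: rot_def)

lemma linear_rot: "linear (rot A t)"
  by (rule linearI) (auto simp: vec_eq_iff algebra_simps)

lemma norm_rot: "norm (rot A t p) = norm (p :: complex ^ 'n::finite)"
  by (simp add: norm_vec_def norm_mult if_distrib[of norm] cong: if_cong)

lemma continuous_rot: "continuous_on UNIV (\<lambda>(t, p :: complex ^ 'n::finite). rot A t p)"
  unfolding rot_def split_def
proof (rule continuous_on_vec_lambda)
  fix i
  show "continuous_on UNIV (\<lambda>x :: real \<times> (complex ^ 'n). if i \<in> A then cis (2 * pi * fst x) * snd x $ i else snd x $ i)"
    by (cases "i \<in> A") (auto intro!: continuous_intros)
qed

text \<open>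
  Each rotation preserves \<open>U\<close> and Lebesgue measure, so \<open>g\<close> and \<open>g \<circ> rot A t\<close> have the same integral; averaging over
  \<open>t\<close> and exchanging the integrals replaces \<open>g\<close> by its rotation average.
\<close>

lemma rot_average:
  fixes g G :: "complex ^ 'n::finite \<Rightarrow> complex"
  assumes U: "U \<in> sets borel" and inv: "\<And>t p. rot A t p \<in> U \<longleftrightarrow> p \<in> U"
    and g: "set_integrable lborel U g" and cont: "continuous_on U g"
    and avg: "\<And>p. p \<in> U \<Longrightarrow> ((\<lambda>t. g (rot A t p)) has_integral G p) {0..1}"
  shows "set_integrable lborel U G" "(LINT p:U|lborel. G p) = (LINT p:U|lborel. g p)"
proof -
  define \<phi> where "\<phi> = (\<lambda>p. indicator U p *\<^sub>R g p)"
  have int\<phi>: "integrable lborel \<phi>" using g by (simp add: \<phi>_def set_integrable_def)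
  then have [measurable]: "\<phi> \<in> borel_measurable borel" by (auto dest: borel_measurable_integrable)
  define \<psi> where "\<psi> = (\<lambda>(t, p). indicator {0..1::real} t *\<^sub>R \<phi> (rot A t p))"
  have [measurable]: "(\<lambda>(t, p :: complex ^ 'n). rot A t p) \<in> borel_measurable (borel \<Otimes>\<^sub>M borel)"
    unfolding borel_prod by (rule borel_measurable_continuous_onI[OF continuous_rot])
  have [measurable]: "rot A t \<in> borel_measurable (borel :: (complex ^ 'n) measure)" for t
    by (intro borel_measurable_continuous_onI linear_continuous_on linear_conv_bounded_linear[THEN iffD1] linear_rot)
  have [measurable]: "\<psi> \<in> borel_measurable (lborel \<Otimes>\<^sub>M lborel)"
    unfolding \<psi>_def by measurable
  have inv_lborel: "distr lborel borel (rot A t) = (lborel :: (complex ^ 'n) measure)" for t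
    by (intro distr_lborel_isometry linear_rot norm_rot)
  have rot_int: "integrable lborel (\<lambda>p. \<phi> (rot A t p))" for t
    using int\<phi> integrable_distr_eq[of "rot A t" lborel borel \<phi>] by (simp add: inv_lborel)
  have rot_eq: "(\<integral>p. \<phi> (rot A t p) \<partial>lborel) = (\<integral>p. \<phi> p \<partial>lborel)" for t
    using integral_distr[of "rot A t" lborel borel \<phi>] by (simp add: inv_lborel)
  have rot_eq_norm: "(\<integral>p. norm (\<phi> (rot A t p)) \<partial>lborel) = (\<integral>p. norm (\<phi> p) \<partial>lborel)" for t
    using integral_distr[of "rot A t" lborel borel "\<lambda>p. norm (\<phi> p)"] by (simp add: inv_lborel)
  have int\<psi>: "integrable (lborel \<Otimes>\<^sub>M lborel) \<psi>"
  proof (rule lborel_pair.Fubini_integrable)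
    show "integrable lborel (\<lambda>t. \<integral>p. norm (\<psi> (t, p)) \<partial>lborel)"
      by (simp add: \<psi>_def rot_eq_norm)
    show "AE t in lborel. integrable lborel (\<lambda>p. \<psi> (t, p))"
      by (simp add: \<psi>_def rot_int)
  qed measurable
  have inner: "(\<integral>t. \<psi> (t, p) \<partial>lborel) = indicator U p *\<^sub>R G p" for p
  proof (cases "p \<in> U")
    case True
    have "continuous_on {0..1} (\<lambda>t. g (rot A t p))"
    proof (rule continuous_on_compose2[OF cont])
      have "continuous_on {0..1} ((\<lambda>(t, p). rot A t p) \<circ> (\<lambda>t. (t, p)))"
        by (intro continuous_on_compose continuous_intros continuous_on_subset[OF continuous_rot]) auto
      then show "continuous_on {0..1} (\<lambda>t. rot A t p)" by (simp add: o_def)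
    qed (use True inv in auto)
    then have si: "set_integrable lborel {0..1} (\<lambda>t. g (rot A t p))"
      by (rule borel_integrable_atLeastAtMost')
    have "(\<integral>t. \<psi> (t, p) \<partial>lborel) = (LINT t:{0..1}|lborel. g (rot A t p))"
      using True by (simp add: \<psi>_def \<phi>_def inv set_lebesgue_integral_def)
    also have "\<dots> = integral {0..1} (\<lambda>t. g (rot A t p))"
      using si by (rule set_borel_integral_eq_integral)
    also have "\<dots> = G p" using avg[OF True] by (rule integral_unique)
    finally show ?thesis using True by simp
  next
    case False
    then show ?thesis by (simp add: \<psi>_def \<phi>_def inv)
  qed
  have "integrable lborel (\<lambda>p. \<integral>t. \<psi> (t, p) \<partial>lborel)"
    using lborel_pair.integrable_snd[of "\<lambda>t p. \<psi> (t, p)"] int\<psi> by simp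
  then show "set_integrable lborel U G" by (simp add: inner set_integrable_def)
  have "(\<integral>p. \<integral>t. \<psi> (t, p) \<partial>lborel \<partial>lborel) = (\<integral>t. \<integral>p. \<psi> (t, p) \<partial>lborel \<partial>lborel)"
    using lborel_pair.Fubini_integral[of "\<lambda>t p. \<psi> (t, p)"] int\<psi> by simp
  also have "\<dots> = (\<integral>t. indicator {0..1::real} t *\<^sub>R (\<integral>p. \<phi> p \<partial>lborel) \<partial>lborel)"
    by (simp add: \<psi>_def rot_eq)
  also have "\<dots> = (\<integral>p. \<phi> p \<partial>lborel)" by simp
  finally show "(LINT p:U|lborel. G p) = (LINT p:U|lborel. g p)"
    by (simp add: inner set_lebesgue_integral_def \<phi>_def)
qed

section \<open>Cauchy coefficients and their dependence on a parameter\<close>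

lemma has_integral_circle_coefficient:
  assumes "open S" "g holomorphic_on S" "cball 0 1 \<subseteq> S"
  shows "((\<lambda>t. g (cis (2 * pi * t)) * cnj (cis (2 * pi * t)) ^ k) has_integral (deriv ^^ k) g 0 / fact k) {0..1}"
proof -
  have "((\<lambda>u. g u / (u - 0) ^ Suc k) has_contour_integral (of_real (2 * pi) * \<i> / fact k * (deriv ^^ k) g 0)) (circlepath 0 1)"
  proof (rule Cauchy_has_contour_integral_higher_derivative_circlepath)
    show "g holomorphic_on ball 0 1"
      using assms(2,3) by (meson ball_subset_cball holomorphic_on_subset order_trans)
  qed (use assms in \<open>auto intro: holomorphic_on_imp_continuous_on holomorphic_on_subset\<close>)
  then have "((\<lambda>t. g (circlepath 0 1 t) / circlepath 0 1 t ^ Suc k * vector_derivative (circlepath 0 1) (at t within {0..1}))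
     has_integral (of_real (2 * pi) * \<i> / fact k * (deriv ^^ k) g 0)) {0..1}"
    by (simp add: has_contour_integral_def)
  then have "((\<lambda>t. 2 * of_real pi * \<i> * (g (cis (2 * pi * t)) * cnj (cis (2 * pi * t)) ^ k))
     has_integral (of_real (2 * pi) * \<i> / fact k * (deriv ^^ k) g 0)) {0..1}"
  proof (rule has_integral_eq[rotated])
    fix t :: real assume t: "t \<in> {0..1}"
    have c: "circlepath 0 1 t = cis (2 * pi * t)"
      by (simp add: circlepath cis_conv_exp mult_ac)
    have v: "vector_derivative (circlepath 0 1) (at t within {0..1}) = 2 * of_real pi * \<i> * cis (2 * pi * t)"
      using t by (simp add: vector_derivative_circlepath01 cis_conv_exp mult_ac)
    have "cnj (cis (2 * pi * t)) = inverse (cis (2 * pi * t))"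
      by (simp add: cis_cnj cis_inverse)
    then show "g (circlepath 0 1 t) / circlepath 0 1 t ^ Suc k * vector_derivative (circlepath 0 1) (at t within {0..1}) =
        2 * of_real pi * \<i> * (g (cis (2 * pi * t)) * cnj (cis (2 * pi * t)) ^ k)"
      unfolding c v by (simp only:) (simp add: divide_simps power_inverse)
  qed
  from has_integral_mult_right[OF this, of "inverse (2 * of_real pi * \<i>)"] show ?thesis
    by (simp add: field_simps)
qed

lemma continuous_on_contour_integral_param:
  fixes f :: "'x::metric_space \<Rightarrow> complex \<Rightarrow> complex"
  assumes f: "continuous_on (X \<times> path_image \<gamma>) (\<lambda>(x,y). f x y)"
    and \<gamma>: "path \<gamma>" and v: "continuous_on {0..1} (\<lambda>t. vector_derivative \<gamma> (at t))"
  shows "continuous_on X (\<lambda>x. contour_integral \<gamma> (f x))"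
proof -
  have "continuous_on (X \<times> {0..1}) ((\<lambda>(x,y). f x y) \<circ> (\<lambda>(x,t). (x, \<gamma> t)))"
    using \<gamma> unfolding path_def
    by (intro continuous_on_compose continuous_on_subset[OF f])
      (auto simp: path_image_def split_def intro!: continuous_intros continuous_on_compose2[of "{0..1}" \<gamma>])
  then have "continuous_on (X \<times> {0..1}) (\<lambda>(x,t). f x (\<gamma> t) * vector_derivative \<gamma> (at t))"
    by (auto simp: o_def split_def intro!: continuous_intros continuous_on_compose2[OF v])
  then have "continuous_on X (\<lambda>x. integral (cbox 0 1) (\<lambda>t. f x (\<gamma> t) * vector_derivative \<gamma> (at t)))"
    by (intro integral_continuous_on_param) simp
  then show ?thesis by (simp add: contour_integral_integral)
qed

text \<open>
  Morera's theorem: the integral over a triangle can be moved inside the contour integral, where it vanishes. Only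
  separate holomorphy and joint continuity enter, so nothing need be known about continuity of the partial
  derivative in \<open>x\<close>.
\<close>

lemma holomorphic_on_contour_integral_param:
  assumes V: "open V" and f: "continuous_on (V \<times> path_image \<gamma>) (\<lambda>(x,y). f x y)"
    and hol: "\<And>y. y \<in> path_image \<gamma> \<Longrightarrow> (\<lambda>x. f x y) holomorphic_on V"
    and \<gamma>: "valid_path \<gamma>" and v: "continuous_on {0..1} (\<lambda>t. vector_derivative \<gamma> (at t))"
  shows "(\<lambda>x. contour_integral \<gamma> (f x)) holomorphic_on V"
proof (rule analytic_imp_holomorphic, rule Morera_triangle[OF _ V])
  show "continuous_on V (\<lambda>x. contour_integral \<gamma> (f x))"
    using valid_path_imp_path[OF \<gamma>] by (intro continuous_on_contour_integral_param f v)
  fix a b c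
  show "convex hull {a, b, c} \<subseteq> V \<longrightarrow>
     contour_integral (linepath a b) (\<lambda>x. contour_integral \<gamma> (f x)) +
     contour_integral (linepath b c) (\<lambda>x. contour_integral \<gamma> (f x)) +
     contour_integral (linepath c a) (\<lambda>x. contour_integral \<gamma> (f x)) = 0"
  proof
    assume T: "convex hull {a, b, c} \<subseteq> V"
    have seg: "closed_segment a b \<subseteq> V" "closed_segment b c \<subseteq> V" "closed_segment c a \<subseteq> V"
      using T hull_mono[of "{a,b}" "{a,b,c}" convex] hull_mono[of "{b,c}" "{a,b,c}" convex] hull_mono[of "{c,a}" "{a,b,c}" convex]
      unfolding segment_convex_hull by blast+
    have swap: "contour_integral (linepath p q) (\<lambda>x. contour_integral \<gamma> (f x)) =
        contour_integral \<gamma> (\<lambda>y. contour_integral (linepath p q) (\<lambda>x. f x y))"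
      if "closed_segment p q \<subseteq> V" for p q
      using that \<gamma> v by (intro contour_integral_swap continuous_on_subset[OF f]) auto
    have ci: "(\<lambda>y. contour_integral (linepath p q) (\<lambda>x. f x y)) contour_integrable_on \<gamma>"
      if "closed_segment p q \<subseteq> V" for p q
    proof -
      have "continuous_on (path_image \<gamma>) (\<lambda>y. contour_integral (linepath p q) (\<lambda>x. f x y))"
      proof (rule continuous_on_contour_integral_param)
        have "continuous_on (path_image \<gamma> \<times> path_image (linepath p q)) ((\<lambda>(x,y). f x y) \<circ> prod.swap)"
          using that by (intro continuous_on_compose continuous_on_swap continuous_on_subset[OF f]) auto
        then show "continuous_on (path_image \<gamma> \<times> path_image (linepath p q)) (\<lambda>(y,x). f x y)"
          by (simp add: o_def split_def)
      qed auto
      then show ?thesis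
        unfolding contour_integrable_on
        by (auto simp: o_def path_image_def intro!: integrable_continuous_real continuous_intros v
            continuous_on_compose2[of "path_image \<gamma>" _ "{0..1}" \<gamma>] valid_path_imp_path[OF \<gamma>, unfolded path_def])
    qed
    have "contour_integral (linepath a b) (\<lambda>x. contour_integral \<gamma> (f x)) +
     contour_integral (linepath b c) (\<lambda>x. contour_integral \<gamma> (f x)) +
     contour_integral (linepath c a) (\<lambda>x. contour_integral \<gamma> (f x)) =
     contour_integral \<gamma> (\<lambda>y. contour_integral (linepath a b) (\<lambda>x. f x y) + contour_integral (linepath b c) (\<lambda>x. f x y)
       + contour_integral (linepath c a) (\<lambda>x. f x y))"
      using seg by (simp add: swap contour_integral_add contour_integrable_add ci)
    also have "\<dots> = contour_integral \<gamma> (\<lambda>y. 0)"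
    proof (rule contour_integral_cong)
      fix y assume y: "y \<in> path_image \<gamma>"
      have "((\<lambda>x. f x y) has_contour_integral 0) (linepath a b +++ linepath b c +++ linepath c a)"
        using holomorphic_on_subset[OF hol[OF y] T] by (rule Cauchy_theorem_triangle)
      then show "contour_integral (linepath a b) (\<lambda>x. f x y) + contour_integral (linepath b c) (\<lambda>x. f x y)
       + contour_integral (linepath c a) (\<lambda>x. f x y) = 0"
        by (metis has_chain_integral_chain_integral3)
    qed simp
    finally show "contour_integral (linepath a b) (\<lambda>x. contour_integral \<gamma> (f x)) +
     contour_integral (linepath b c) (\<lambda>x. contour_integral \<gamma> (f x)) +
     contour_integral (linepath c a) (\<lambda>x. contour_integral \<gamma> (f x)) = 0" by simp
  qed
qed

lemma holomorphic_on_higher_deriv_param: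
  assumes V: "open V" and r: "r > 0"
    and cont: "continuous_on (V \<times> cball 0 r) (\<lambda>(x,y). h x y)"
    and hol1: "\<And>y. y \<in> sphere 0 r \<Longrightarrow> (\<lambda>x. h x y) holomorphic_on V"
    and hol2: "\<And>x. x \<in> V \<Longrightarrow> h x holomorphic_on ball 0 r"
  shows "(\<lambda>x. (deriv ^^ k) (h x) 0) holomorphic_on V"
proof -
  have pi: "path_image (circlepath 0 r) = sphere 0 r" using r by simp
  have "(\<lambda>x. contour_integral (circlepath 0 r) (\<lambda>y. h x y / y ^ Suc k)) holomorphic_on V"
  proof (rule holomorphic_on_contour_integral_param[OF V])
    have "continuous_on (V \<times> sphere 0 r) (\<lambda>(x,y). h x y)"
      by (rule continuous_on_subset[OF cont]) auto
    then show "continuous_on (V \<times> path_image (circlepath 0 r)) (\<lambda>(x, y). h x y / y ^ Suc k)"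
      using r unfolding pi split_def by (intro continuous_intros) auto
    show "continuous_on {0..1} (\<lambda>t. vector_derivative (circlepath 0 r) (at t))"
      by (auto simp: vector_derivative_circlepath intro!: continuous_intros)
  qed (use hol1 r in \<open>auto simp: pi intro!: holomorphic_intros\<close>)
  then have "(\<lambda>x. fact k / (2 * of_real pi * \<i>) * contour_integral (circlepath 0 r) (\<lambda>y. h x y / y ^ Suc k)) holomorphic_on V"
    by (intro holomorphic_intros)
  then show ?thesis
  proof (rule holomorphic_transform)
    fix x assume x: "x \<in> V"
    have "continuous_on (cball 0 r) ((\<lambda>(x,y). h x y) \<circ> (\<lambda>y. (x, y)))"
      using x by (intro continuous_on_compose continuous_on_subset[OF cont] continuous_intros) auto
    then have "((\<lambda>u. h x u / (u - 0) ^ Suc k) has_contour_integral (of_real (2 * pi) * \<i> / fact k * (deriv ^^ k) (h x) 0)) (circlepath 0 r)"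
      using r x by (intro Cauchy_has_contour_integral_higher_derivative_circlepath) (auto simp: o_def hol2)
    from contour_integral_unique[OF this]
    show "fact k / (2 * of_real pi * \<i>) * contour_integral (circlepath 0 r) (\<lambda>y. h x y / y ^ Suc k) = (deriv ^^ k) (h x) 0"
      by simp
  qed
qed

section \<open>Taylor coefficients along two coordinate axes\<close>

lemma holomorphic_several_on_imp_continuous_on:
  "holomorphic_several_on f U \<Longrightarrow> continuous_on U f"
  unfolding holomorphic_several_on_def
  by (meson continuous_at_imp_continuous_on has_derivative_continuous)

lemma holomorphic_on_complex_line:
  fixes f :: "complex ^ 'n::finite \<Rightarrow> complex"
  assumes f: "holomorphic_several_on f U" and S: "\<And>\<zeta>. \<zeta> \<in> S \<Longrightarrow> p + \<zeta> *s v \<in> U"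
  shows "(\<lambda>\<zeta>. f (p + \<zeta> *s v)) holomorphic_on S"
  unfolding holomorphic_on_def
proof
  fix \<zeta> assume "\<zeta> \<in> S"
  then obtain f' where f': "(f has_derivative f') (at (p + \<zeta> *s v))" and lin: "\<And>c u. f' (c *s u) = c * f' u"
    using f S unfolding holomorphic_several_on_def by metis
  have "linear (\<lambda>\<zeta>. \<zeta> *s v)"
    by (rule linearI) (auto simp: vec_eq_iff algebra_simps)
  then have "((\<lambda>\<zeta>. p + \<zeta> *s v) has_derivative (\<lambda>h. h *s v)) (at \<zeta>)"
    by (auto intro!: derivative_eq_intros linear_imp_has_derivative)
  from diff_chain_at[OF this f'] have "((\<lambda>\<zeta>. f (p + \<zeta> *s v)) has_derivative (\<lambda>h. f' v * h)) (at \<zeta>)"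
    by (simp add: o_def lin mult.commute)
  then have "((\<lambda>\<zeta>. f (p + \<zeta> *s v)) has_field_derivative f' v) (at \<zeta>)"
    by (simp add: has_field_derivative_def)
  then show "(\<lambda>\<zeta>. f (p + \<zeta> *s v)) field_differentiable at \<zeta> within S"
    using field_differentiable_at_within field_differentiable_def by blast
qed

text \<open>
  The point whose only possibly nonzero coordinates are \<open>x\<close> in the base (at \<open>a\<close>) and \<open>y\<close> in the fibre (at \<open>b\<close>).
\<close>

definition axes_vec :: "3 \<Rightarrow> 'm::finite \<Rightarrow> complex \<Rightarrow> complex \<Rightarrow> complex ^ (3 + 'm)" where
  "axes_vec a b x y = (\<chi> i. if i = Inl a then x else if i = Inr b then y else 0)"

lemma axes_vec_nth [simp]: "axes_vec a b x y $ i = (if i = Inl a then x else if i = Inr b then y else 0)"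
  by (simp add: axes_vec_def)

lemma continuous_on_axes_vec [continuous_intros]:
  fixes b :: "'m::finite"
  assumes "continuous_on S f" "continuous_on S g"
  shows "continuous_on S (\<lambda>x. axes_vec a b (f x) (g x))"
  unfolding axes_vec_def
proof (rule continuous_on_vec_lambda)
  fix i :: "3 + 'm"
  show "continuous_on S (\<lambda>x. if i = Inl a then f x else if i = Inr b then g x else 0)"
    using assms by (cases "i = Inl a"; cases "i = Inr b") (auto intro!: continuous_intros)
qed

lemma axes_vec_in_Omega_hat [simp]:
  fixes b :: "'m::finite"
  shows "axes_vec a b x y \<in> Omega_hat \<mu> \<longleftrightarrow> (norm x)\<^sup>2 < 1 \<and> (norm y)\<^sup>2 < (1 - (norm x)\<^sup>2) powr \<mu>"
  by (simp add: Omega_hat_iff if_distrib[of norm] if_distrib[of "\<lambda>x. x\<^sup>2"] sum.delta cong: if_cong)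

text \<open>
  The domain is a complete Reinhardt domain. This keeps all discs and rotations used below inside it.
\<close>

lemma Omega_hat_shrink:
  fixes p q :: "complex ^ (3 + 'm::finite)"
  assumes p: "p \<in> Omega_hat \<mu>" and le: "\<And>i. norm (q $ i) \<le> norm (p $ i)" and \<mu>: "\<mu> > 0"
  shows "q \<in> Omega_hat \<mu>"
proof -
  have 1: "(\<Sum>l\<in>UNIV. (norm (q $ Inl l))\<^sup>2) \<le> (\<Sum>l\<in>UNIV. (norm (p $ Inl l))\<^sup>2)"
    by (intro sum_mono power_mono le) auto
  have 2: "(\<Sum>r\<in>UNIV. (norm (q $ Inr r))\<^sup>2) \<le> (\<Sum>r\<in>UNIV. (norm (p $ Inr r))\<^sup>2)"
    by (intro sum_mono power_mono le) auto
  have "(1 - (\<Sum>l\<in>UNIV. (norm (p $ Inl l))\<^sup>2)) powr \<mu> \<le> (1 - (\<Sum>l\<in>UNIV. (norm (q $ Inl l))\<^sup>2)) powr \<mu>"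
    using p 1 \<mu> by (intro powr_mono2) (auto simp: Omega_hat_iff)
  then show ?thesis using p 1 2 by (auto simp: Omega_hat_iff)
qed

lemma rot_in_Omega_hat [simp]:
  fixes p :: "complex ^ (3 + 'm::finite)"
  shows "rot A t p \<in> Omega_hat \<mu> \<longleftrightarrow> p \<in> Omega_hat \<mu>"
proof -
  have n: "norm (rot A t p $ i) = norm (p $ i)" for i by (simp add: norm_mult)
  show ?thesis unfolding Omega_hat_iff n ..
qed

lemma Omega_hat_borel [measurable, simp]: "(Omega_hat \<mu> :: (complex ^ (3 + 'm::finite)) set) \<in> sets borel"
  by (rule borel_open[OF open_Omega_hat])

lemma set_integrable_mult_bounded:
  fixes f g :: "complex ^ 'n::finite \<Rightarrow> complex"
  assumes U: "U \<in> sets borel" and f: "set_integrable lborel U f" and g: "continuous_on U g"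
    and B: "\<And>p. p \<in> U \<Longrightarrow> norm (g p) \<le> B"
  shows "set_integrable lborel U (\<lambda>p. f p * g p)"
proof -
  have gm[measurable]: "(\<lambda>p. indicator U p *\<^sub>R g p) \<in> borel_measurable borel"
    using borel_measurable_continuous_on_indicator[OF U g] .
  have fm[measurable]: "(\<lambda>p. indicator U p *\<^sub>R f p) \<in> borel_measurable borel"
    using f unfolding set_integrable_def by (auto dest: borel_measurable_integrable)
  have "integrable lborel (\<lambda>p. (indicator U p *\<^sub>R f p) * (indicator U p *\<^sub>R g p))"
  proof (rule Bochner_Integration.integrable_bound)
    show "integrable lborel (\<lambda>p. B * norm (indicator U p *\<^sub>R f p))"
      using f unfolding set_integrable_def by (intro integrable_mult_right integrable_norm) auto
    show "AE p in lborel. norm (indicator U p *\<^sub>R f p * (indicator U p *\<^sub>R g p)) \<le> norm (B * norm (indicator U p *\<^sub>R f p))"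
    proof (rule AE_I2)
      fix p
      have "norm (f p) * norm (g p) \<le> \<bar>B\<bar> * norm (f p)" if "p \<in> U"
        using mult_right_mono[OF order_trans[OF B[OF that] abs_ge_self], of "norm (f p)"] by (simp add: mult.commute)
      then show "norm (indicator U p *\<^sub>R f p * (indicator U p *\<^sub>R g p)) \<le> norm (B * norm (indicator U p *\<^sub>R f p))"
        by (auto simp: indicator_def norm_mult abs_mult)
    qed
  qed measurable
  then show ?thesis
    unfolding set_integrable_def by (rule Bochner_Integration.integrable_cong[THEN iffD1, rotated 2]) (auto simp: indicator_def)
qed

lemma Omega_hat_nth_le:
  fixes p :: "complex ^ (3 + 'm::finite)"
  assumes p: "p \<in> Omega_hat \<mu>" and \<mu>: "\<mu> > 0"
  shows "norm (p $ Inl a) < 1" "norm (p $ Inr b) < 1" "axes_vec a b (p $ Inl a) (p $ Inr b) \<in> Omega_hat \<mu>"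
proof -
  show e: "axes_vec a b (p $ Inl a) (p $ Inr b) \<in> Omega_hat \<mu>"
    by (rule Omega_hat_shrink[OF p _ \<mu>]) simp
  then show "norm (p $ Inl a) < 1" by (simp add: abs_square_less_1)
  have "(norm (p $ Inr b))\<^sup>2 < (1 - (norm (p $ Inl a))\<^sup>2) powr \<mu>" using e by simp
  also have "\<dots> \<le> 1" using e \<mu> by (intro powr_le1) auto
  finally show "norm (p $ Inr b) < 1" by (simp add: abs_square_less_1)
qed

text \<open>
  The coefficient of \<open>y ^ k\<close> in the restriction of \<open>f\<close> to the plane of two axes, as a function of the other coordinate.
\<close>

definition slice_coeff :: "(complex ^ (3 + 'm::finite) \<Rightarrow> complex) \<Rightarrow> 3 \<Rightarrow> 'm \<Rightarrow> nat \<Rightarrow> complex \<Rightarrow> complex" where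
  "slice_coeff f a b k x = (deriv ^^ k) (\<lambda>y. f (axes_vec a b x y)) 0 / fact k"

definition taylor_coeff :: "(complex ^ (3 + 'm::finite) \<Rightarrow> complex) \<Rightarrow> 3 \<Rightarrow> 'm \<Rightarrow> nat \<Rightarrow> nat \<Rightarrow> complex" where
  "taylor_coeff f a b j k = (deriv ^^ j) (slice_coeff f a b k) 0 / fact j"

lemma slice_holomorphic:
  assumes f: "holomorphic_several_on f (Omega_hat \<mu> :: (complex ^ (3 + 'm::finite)) set)"
  shows "(\<lambda>y. f (axes_vec a b x y)) holomorphic_on {y. axes_vec a b x y \<in> Omega_hat \<mu>}"
    and "(\<lambda>x. f (axes_vec a b x y)) holomorphic_on {x. axes_vec a b x y \<in> Omega_hat \<mu>}"
proof -
  have e1: "axes_vec a b x y = axes_vec a b x 0 + y *s axes_vec a b 0 1" and e2: "axes_vec a b x y = axes_vec a b 0 y + x *s axes_vec a b 1 0" for x y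
    by (auto simp: vec_eq_iff)
  show "(\<lambda>y. f (axes_vec a b x y)) holomorphic_on {y. axes_vec a b x y \<in> Omega_hat \<mu>}"
    by (subst e1, rule holomorphic_on_complex_line[OF f]) (simp flip: e1)
  show "(\<lambda>x. f (axes_vec a b x y)) holomorphic_on {x. axes_vec a b x y \<in> Omega_hat \<mu>}"
    by (subst e2, rule holomorphic_on_complex_line[OF f]) (simp flip: e2)
qed

text \<open>
  The fibre radius \<open>(1 - (norm x)\<^sup>2) powr (\<mu> / 2)\<close> tends to \<open>0\<close> at the boundary, so no single Cauchy circle serves the whole
  disc; on each smaller disc of radius \<open>\<rho>\<close> a common circle exists.
\<close>

lemma slice_coeff_holomorphic:
  assumes f: "holomorphic_several_on f (Omega_hat \<mu> :: (complex ^ (3 + 'm::finite)) set)" and \<mu>: "\<mu> > 0"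
  shows "slice_coeff f a b k holomorphic_on ball 0 1"
proof -
  have "(\<lambda>x. (deriv ^^ k) (\<lambda>y. f (axes_vec a b x y)) 0) holomorphic_on (\<Union>\<rho>\<in>{0<..<1}. ball 0 \<rho>)"
  proof (rule holomorphic_on_UN_open)
    fix \<rho> :: real assume \<rho>: "\<rho> \<in> {0<..<1}"
    then have \<rho>1: "\<rho>\<^sup>2 < 1" by (simp add: abs_square_less_1)
    \<comment> \<open>Half the fibre radius over the boundary circle of the disc of radius \<open>\<rho>\<close>.\<close>
    define r where "r = (1 - \<rho>\<^sup>2) powr (\<mu> / 2) / 2"
    have r: "r > 0" using \<rho>1 by (simp add: r_def)
    have "r\<^sup>2 = (1 - \<rho>\<^sup>2) powr \<mu> / 4"
      by (simp add: r_def power2_eq_square powr_add[symmetric])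
    moreover have "(1 - \<rho>\<^sup>2) powr \<mu> > 0" using \<rho>1 by simp
    ultimately have r2: "r\<^sup>2 < (1 - \<rho>\<^sup>2) powr \<mu>" by linarith
    have inU: "axes_vec a b x y \<in> Omega_hat \<mu>" if "x \<in> ball 0 \<rho>" "y \<in> cball 0 r" for x y
    proof -
      have x: "(norm x)\<^sup>2 \<le> \<rho>\<^sup>2" and y: "(norm y)\<^sup>2 \<le> r\<^sup>2" using that by (auto intro!: power_mono)
      have "(1 - \<rho>\<^sup>2) powr \<mu> \<le> (1 - (norm x)\<^sup>2) powr \<mu>"
        using x \<rho>1 \<mu> by (intro powr_mono2) auto
      then show ?thesis using x y \<rho>1 r2 by simp
    qed
    show "(\<lambda>x. (deriv ^^ k) (\<lambda>y. f (axes_vec a b x y)) 0) holomorphic_on ball 0 \<rho>"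
    proof (rule holomorphic_on_higher_deriv_param[OF _ r])
      show "continuous_on (ball 0 \<rho> \<times> cball 0 r) (\<lambda>(x, y). f (axes_vec a b x y))"
        unfolding split_def
        by (rule continuous_on_compose2[OF holomorphic_several_on_imp_continuous_on[OF f]])
          (auto intro!: continuous_intros inU simp del: axes_vec_in_Omega_hat)
      show "(\<lambda>x. f (axes_vec a b x y)) holomorphic_on ball 0 \<rho>" if "y \<in> sphere 0 r" for y
        by (rule holomorphic_on_subset[OF slice_holomorphic(2)[OF f]]) (use that in \<open>auto intro!: inU simp del: axes_vec_in_Omega_hat\<close>)
      show "(\<lambda>y. f (axes_vec a b x y)) holomorphic_on ball 0 r" if "x \<in> ball 0 \<rho>" for x
        by (rule holomorphic_on_subset[OF slice_holomorphic(1)[OF f]]) (use that in \<open>auto intro!: inU simp del: axes_vec_in_Omega_hat\<close>)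
    qed simp
  qed simp
  also have "(\<Union>\<rho>\<in>{0<..<1}. ball 0 \<rho>) = (ball 0 1 :: complex set)"
  proof (intro equalityI subsetI)
    fix x :: complex assume "x \<in> ball 0 1"
    then have "(norm x + 1) / 2 \<in> {0<..<1}" "x \<in> ball 0 ((norm x + 1) / 2)"
      using norm_ge_zero[of x] by (auto simp del: norm_ge_zero)
    then show "x \<in> (\<Union>\<rho>\<in>{0<..<1}. ball 0 \<rho>)" by blast
  qed auto
  finally show ?thesis unfolding slice_coeff_def[abs_def] by (intro holomorphic_intros) auto
qed

lemma taylor_sums:
  assumes f: "holomorphic_several_on f (Omega_hat \<mu> :: (complex ^ (3 + 'm::finite)) set)" and \<mu>: "\<mu> > 0"
    and in_U: "axes_vec a b x y \<in> Omega_hat \<mu>"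
  shows "(\<lambda>k. slice_coeff f a b k x * y ^ k) sums f (axes_vec a b x y)"
    and "(\<lambda>j. taylor_coeff f a b j k * x ^ j) sums slice_coeff f a b k x"
proof -
  have x: "norm x < 1" using in_U by (simp add: abs_square_less_1)
  define r where "r = (1 - (norm x)\<^sup>2) powr (\<mu> / 2)"
  have r2: "r\<^sup>2 = (1 - (norm x)\<^sup>2) powr \<mu>" and r0: "r \<ge> 0"
    using in_U by (simp_all add: r_def power2_eq_square powr_add[symmetric])
  have in_ball: "axes_vec a b x y' \<in> Omega_hat \<mu> \<longleftrightarrow> y' \<in> ball 0 r" for y'
    using in_U r0 by (simp add: r2[symmetric] abs_square_less_1) (metis abs_norm_cancel abs_of_nonneg abs_le_square_iff not_le)
  have "(\<lambda>y. f (axes_vec a b x y)) holomorphic_on ball 0 r"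
    using slice_holomorphic(1)[OF f, of a b x] unfolding in_ball by (simp add: ball_def)
  from holomorphic_power_series[OF this, of y] in_ball in_U
  show "(\<lambda>k. slice_coeff f a b k x * y ^ k) sums f (axes_vec a b x y)"
    by (simp add: slice_coeff_def)
  from holomorphic_power_series[OF slice_coeff_holomorphic[OF f \<mu>], of x] x
  show "(\<lambda>j. taylor_coeff f a b j k * x ^ j) sums slice_coeff f a b k x"
    by (simp add: taylor_coeff_def)
qed

text \<open>
  The squared norm of the monomial \<open>x ^ j * y ^ k\<close> in the Bergman space.
\<close>

definition moment :: "'m::finite itself \<Rightarrow> real \<Rightarrow> nat \<Rightarrow> nat \<Rightarrow> real" where
  "moment _ \<mu> j k = pi ^ CARD('m) * fact k / fact (CARD('m) + k) *
        (pi ^ 3 * fact j / pochhammer (\<mu> * real (CARD('m) + k) + 1) (3 + j))"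

text \<open>
  Three rotation averages. Rotating all coordinates other than \<open>x\<close> and \<open>y\<close> replaces \<open>f\<close> by its value on the plane of the
  two axes (mean value property); rotating \<open>y\<close> extracts the coefficient of \<open>y ^ k\<close>, since the monomial contributes the
  conjugate phase; rotating \<open>x\<close> then extracts the coefficient of \<open>x ^ j\<close>.
\<close>

lemma monomial_integral:
  fixes f :: "complex ^ (3 + 'm::finite) \<Rightarrow> complex"
  assumes f: "holomorphic_several_on f (Omega_hat \<mu>)" and \<mu>: "\<mu> > 0"
    and int: "set_integrable lborel (Omega_hat \<mu>) f"
  shows "(LINT p:Omega_hat \<mu>|lborel. f p * cnj (p $ Inl a ^ j * p $ Inr b ^ k))
    = taylor_coeff f a b j k * of_real (moment TYPE('m) \<mu> j k)"
proof -
  define U where "U = (Omega_hat \<mu> :: (complex ^ (3 + 'm)) set)"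
  define M where "M = (\<lambda>p :: complex ^ (3 + 'm). p $ Inl a ^ j * p $ Inr b ^ k)"
  have U[simp]: "U \<in> sets borel" by (simp add: U_def)
  have inv: "rot A t p \<in> U \<longleftrightarrow> p \<in> U" for A t and p :: "complex ^ (3 + 'm)" by (simp add: U_def)
  have fU: "holomorphic_several_on f U" and intU: "set_integrable lborel U f" using f int by (simp_all add: U_def)
  have nth: "norm (p $ Inl a) < 1" "norm (p $ Inr b) < 1" "axes_vec a b (p $ Inl a) (p $ Inr b) \<in> U" if "p \<in> U" for p
    using Omega_hat_nth_le[OF that[unfolded U_def] \<mu>] by (auto simp: U_def)
  have M1: "norm (M p) \<le> 1" if "p \<in> U" for p
    using nth[OF that] by (simp add: M_def norm_mult norm_power mult_le_one power_le_one)
  have contM: "continuous_on U (\<lambda>p. cnj (M p))" unfolding M_def by (intro continuous_intros)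
  have contf: "continuous_on U f" by (rule holomorphic_several_on_imp_continuous_on[OF fU])
  have conte: "continuous_on U (\<lambda>p. f (axes_vec a b (p $ Inl a) (p $ Inr b)))"
    by (rule continuous_on_compose2[OF contf]) (auto intro!: continuous_intros nth)
  have contS: "continuous_on U (\<lambda>p. slice_coeff f a b k (p $ Inl a))"
    by (rule continuous_on_compose2[OF holomorphic_on_imp_continuous_on[OF slice_coeff_holomorphic[OF f \<mu>]]])
      (auto intro!: continuous_intros nth)
  define g0 where "g0 = (\<lambda>p. f p * cnj (M p))"
  define g1 where "g1 = (\<lambda>p. f (axes_vec a b (p $ Inl a) (p $ Inr b)) * cnj (M p))"
  define g2 where "g2 = (\<lambda>p. slice_coeff f a b k (p $ Inl a) * p $ Inr b ^ k * cnj (M p))"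
  define g3 where "g3 = (\<lambda>p. taylor_coeff f a b j k * (p $ Inl a ^ j * p $ Inr b ^ k * cnj (M p)))"
  have int0: "set_integrable lborel U g0" unfolding g0_def
    by (rule set_integrable_mult_bounded[OF U intU contM, of 1]) (simp add: M1)
  have cont0: "continuous_on U g0" unfolding g0_def by (intro continuous_intros contf contM)
  have avg0: "((\<lambda>t. g0 (rot (- {Inl a, Inr b}) t p)) has_integral g1 p) {0..1}" if p: "p \<in> U" for p
  proof -
    define q where "q = axes_vec a b (p $ Inl a) (p $ Inr b)"
    define S where "S = (\<lambda>\<zeta>. q + \<zeta> *s (p - q)) -` U"
    have "continuous_on UNIV (\<lambda>\<zeta>. q + \<zeta> *s (p - q))"
      unfolding vector_scalar_mult_def by (intro continuous_intros continuous_on_vec_lambda)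
    then have "open S"
      unfolding S_def U_def by (rule open_vimage[OF open_Omega_hat])
    moreover have "(\<lambda>\<zeta>. f (q + \<zeta> *s (p - q))) holomorphic_on S"
      by (rule holomorphic_on_complex_line[OF fU]) (simp add: S_def)
    moreover have "cball 0 1 \<subseteq> S"
    proof
      fix \<zeta> :: complex assume "\<zeta> \<in> cball 0 1"
      then have "norm \<zeta> \<le> 1" by simp
      then have "norm ((q + \<zeta> *s (p - q)) $ i) \<le> norm (p $ i)" for i
        by (auto simp: q_def norm_mult intro: mult_left_le_one_le)
      then have "q + \<zeta> *s (p - q) \<in> U" unfolding U_def by (rule Omega_hat_shrink[OF p[unfolded U_def] _ \<mu>])
      then show "\<zeta> \<in> S" by (simp add: S_def)
    qed
    ultimately have "((\<lambda>t. f (q + cis (2 * pi * t) *s (p - q)) * cnj (cis (2 * pi * t)) ^ 0) has_integral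
        (deriv ^^ 0) (\<lambda>\<zeta>. f (q + \<zeta> *s (p - q))) 0 / fact 0) {0..1}"
      by (rule has_integral_circle_coefficient)
    from has_integral_mult_left[OF this, of "cnj (M p)"]
    have "((\<lambda>t. f (q + cis (2 * pi * t) *s (p - q)) * cnj (M p)) has_integral f q * cnj (M p)) {0..1}"
      by simp
    moreover have "q + cis (2 * pi * t) *s (p - q) = rot (- {Inl a, Inr b}) t p" for t
      by (auto simp: vec_eq_iff q_def)
    moreover have "M (rot (- {Inl a, Inr b}) t p) = M p" for t
      by (simp add: M_def)
    ultimately show ?thesis by (simp add: g0_def g1_def q_def)
  qed
  note step0 = rot_average[OF U inv int0 cont0 avg0]
  have cont1: "continuous_on U g1" unfolding g1_def by (intro continuous_intros conte contM)
  have avg1: "((\<lambda>t. g1 (rot {Inr b} t p)) has_integral g2 p) {0..1}" if p: "p \<in> U" for p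
  proof -
    define x y where "x = p $ Inl a" and "y = p $ Inr b"
    define T where "T = {y. axes_vec a b x y \<in> U}"
    define S where "S = (\<lambda>\<zeta>. y * \<zeta>) -` T"
    have "continuous_on UNIV (\<lambda>y. axes_vec a b x y)" by (intro continuous_intros)
    then have "open ((\<lambda>y. axes_vec a b x y) -` U)"
      unfolding U_def by (rule open_vimage[OF open_Omega_hat])
    then have oT: "open T" by (simp add: T_def vimage_def)
    have hT: "(\<lambda>y. f (axes_vec a b x y)) holomorphic_on T"
      using slice_holomorphic(1)[OF f, of a b x] by (simp add: T_def U_def)
    have oS: "open S" unfolding S_def by (rule open_vimage[OF oT]) (intro continuous_intros)
    have hS: "(\<lambda>\<zeta>. f (axes_vec a b x (y * \<zeta>))) holomorphic_on S"
      using holomorphic_on_compose_gen[OF _ hT, of "\<lambda>\<zeta>. y * \<zeta>" S] by (auto simp: S_def o_def intro!: holomorphic_intros)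
    have cS: "cball 0 1 \<subseteq> S"
    proof
      fix \<zeta> :: complex assume "\<zeta> \<in> cball 0 1"
      then have "norm \<zeta> \<le> 1" by simp
      then have "norm (axes_vec a b x (y * \<zeta>) $ i) \<le> norm (p $ i)" for i
        by (auto simp: x_def y_def norm_mult intro: mult_right_le_one_le)
      then have "axes_vec a b x (y * \<zeta>) \<in> U" unfolding U_def by (rule Omega_hat_shrink[OF p[unfolded U_def] _ \<mu>])
      then show "\<zeta> \<in> S" by (simp add: S_def T_def)
    qed
    have "(deriv ^^ k) (\<lambda>\<zeta>. f (axes_vec a b x (y * \<zeta>))) 0 = y ^ k * (deriv ^^ k) (\<lambda>y. f (axes_vec a b x y)) (y * 0)"
      using cS[THEN subsetD, of 0] by (intro higher_deriv_compose_linear[OF hT oS oT]) (auto simp: S_def)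
    then have d: "(deriv ^^ k) (\<lambda>\<zeta>. f (axes_vec a b x (y * \<zeta>))) 0 / fact k = slice_coeff f a b k x * y ^ k"
      by (simp add: slice_coeff_def)
    from has_integral_mult_left[OF has_integral_circle_coefficient[OF oS hS cS, of k, unfolded d], of "cnj (M p)"]
    have "((\<lambda>t. f (axes_vec a b x (y * cis (2 * pi * t))) * cnj (cis (2 * pi * t)) ^ k * cnj (M p)) has_integral slice_coeff f a b k x * y ^ k * cnj (M p)) {0..1}" .
    moreover have "g1 (rot {Inr b} t p) = f (axes_vec a b x (y * cis (2 * pi * t))) * cnj (cis (2 * pi * t)) ^ k * cnj (M p)" for t
      by (simp add: g1_def M_def x_def y_def power_mult_distrib mult_ac)
    ultimately show ?thesis by (simp add: g2_def x_def y_def)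
  qed
  note step1 = rot_average[OF U inv step0(1) cont1 avg1]
  have cont2: "continuous_on U g2" unfolding g2_def by (intro continuous_intros contS contM)
  have avg2: "((\<lambda>t. g2 (rot {Inl a} t p)) has_integral g3 p) {0..1}" if p: "p \<in> U" for p
  proof -
    define x y where "x = p $ Inl a" and "y = p $ Inr b"
    have hT: "slice_coeff f a b k holomorphic_on ball 0 1" by (rule slice_coeff_holomorphic[OF f \<mu>])
    define S where "S = (\<lambda>\<zeta>. x * \<zeta>) -` ball 0 1"
    have oS: "open S" unfolding S_def by (intro open_vimage continuous_intros) auto
    have hS: "(\<lambda>\<zeta>. slice_coeff f a b k (x * \<zeta>)) holomorphic_on S"
      using holomorphic_on_compose_gen[OF _ hT, of "\<lambda>\<zeta>. x * \<zeta>" S] by (auto simp: S_def o_def intro!: holomorphic_intros)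
    have cS: "cball 0 1 \<subseteq> S"
    proof
      fix \<zeta> :: complex assume "\<zeta> \<in> cball 0 1"
      then have "norm \<zeta> \<le> 1" by simp
      then have "norm (x * \<zeta>) \<le> norm x" by (simp add: norm_mult mult_right_le_one_le)
      then show "\<zeta> \<in> S" using nth(1)[OF p] by (simp add: S_def x_def)
    qed
    have "(deriv ^^ j) (\<lambda>\<zeta>. slice_coeff f a b k (x * \<zeta>)) 0 = x ^ j * (deriv ^^ j) (slice_coeff f a b k) (x * 0)"
      using cS by (intro higher_deriv_compose_linear[OF hT oS]) (auto simp: S_def)
    then have d: "(deriv ^^ j) (\<lambda>\<zeta>. slice_coeff f a b k (x * \<zeta>)) 0 / fact j = taylor_coeff f a b j k * x ^ j"
      by (simp add: taylor_coeff_def)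
    from has_integral_mult_left[OF has_integral_circle_coefficient[OF oS hS cS, of j, unfolded d], of "y ^ k * cnj (M p)"]
    have "((\<lambda>t. slice_coeff f a b k (x * cis (2 * pi * t)) * cnj (cis (2 * pi * t)) ^ j * (y ^ k * cnj (M p))) has_integral taylor_coeff f a b j k * x ^ j * (y ^ k * cnj (M p))) {0..1}" .
    moreover have "g2 (rot {Inl a} t p) = slice_coeff f a b k (x * cis (2 * pi * t)) * cnj (cis (2 * pi * t)) ^ j * (y ^ k * cnj (M p))" for t
      by (simp add: g2_def M_def x_def y_def power_mult_distrib mult_ac)
    ultimately show ?thesis by (simp add: g3_def x_def y_def mult_ac)
  qed
  note step2 = rot_average[OF U inv step1(1) cont2 avg2]
  define N where "N = (\<lambda>p :: complex ^ (3 + 'm). norm (p $ Inl a) ^ (2 * j) * norm (p $ Inr b) ^ (2 * k))"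
  have MM: "p $ Inl a ^ j * p $ Inr b ^ k * cnj (M p) = of_real (N p)" for p
  proof -
    have "p $ Inl a ^ j * p $ Inr b ^ k * cnj (M p) = (p $ Inl a * cnj (p $ Inl a)) ^ j * (p $ Inr b * cnj (p $ Inr b)) ^ k"
      by (simp add: M_def power_mult_distrib mult_ac)
    then show ?thesis by (simp add: N_def complex_norm_square[symmetric] power_mult)
  qed
  have "moment TYPE('m) \<mu> j k \<ge> 0"
    using \<mu> by (auto simp: moment_def intro!: mult_nonneg_nonneg divide_nonneg_nonneg pochhammer_nonneg add_nonneg_pos)
  moreover have "(\<integral>\<^sup>+p. ennreal (indicator U p * N p) \<partial>lborel) = ennreal (moment TYPE('m) \<mu> j k)"
    using nn_integral_monomial_Omega_hat[OF \<mu>, of a j b k]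
    by (simp add: U_def N_def moment_def ennreal_mult' ennreal_indicator)
  moreover have "(\<lambda>p. indicator U p * N p) \<in> borel_measurable lborel"
    using borel_measurable_continuous_on_indicator[OF U, of N] by (simp add: N_def continuous_intros)
  ultimately have hb: "has_bochner_integral lborel (\<lambda>p. indicator U p * N p) (moment TYPE('m) \<mu> j k)"
    by (intro has_bochner_integral_nn_integral) (auto simp: N_def)
  have N: "(LINT p:U|lborel. (of_real (N p) :: complex)) = of_real (moment TYPE('m) \<mu> j k)"
  proof -
    have "(LINT p:U|lborel. (of_real (N p) :: complex)) = (\<integral>p. of_real (indicator U p * N p) \<partial>lborel)"
      unfolding set_lebesgue_integral_def by (intro Bochner_Integration.integral_cong) (auto simp: indicator_def)
    also have "\<dots> = of_real (moment TYPE('m) \<mu> j k)"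
      using has_bochner_integral_integral_eq[OF hb] by (simp only: integral_complex_of_real)
    finally show ?thesis .
  qed
  have "(LINT p:U|lborel. g0 p) = (LINT p:U|lborel. g3 p)"
    using step0(2) step1(2) step2(2) by simp
  also have "\<dots> = taylor_coeff f a b j k * of_real (moment TYPE('m) \<mu> j k)"
    by (simp add: g3_def MM N)
  finally show ?thesis unfolding g0_def M_def U_def .
qed

section \<open>The generating series of the kernel\<close>

lemma pochhammer_sums_powr:
  fixes s :: complex and c :: real
  assumes "norm s < 1"
  shows "(\<lambda>j. of_real (pochhammer c j / fact j) * s ^ j) sums (1 - s) powr (- of_real c)"
proof -
  have "(\<lambda>j. ((- of_real c) gchoose j) * (- s) ^ j) sums (1 + (- s)) powr (- of_real c)"
    by (rule gen_binomial_complex) (use assms in simp)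
  moreover have "((- of_real c :: complex) gchoose j) * (- s) ^ j = of_real (pochhammer c j / fact j) * s ^ j" for j
  proof -
    have "(- s) ^ j = (- 1) ^ j * s ^ j" by (metis mult_minus1 power_mult_distrib)
    moreover have "(- 1) ^ j * (- 1) ^ j = (1 :: complex)" by (simp flip: power_mult_distrib)
    ultimately show ?thesis
      by (simp add: gbinomial_pochhammer pochhammer_of_real)
  qed
  ultimately show ?thesis by simp
qed

text \<open>
  The value is \<open>1 / pi ^ (m + 3)\<close> times the Taylor coefficient \<open>(m + k)! / k!\<close> of the Bergman kernel of the unit ball of
  \<open>\<complex>\<^sup>m\<close> times the normalising factor \<open>(\<alpha> + 1) * (\<alpha> + 2) * (\<alpha> + 3)\<close> of the weight \<open>(1 - |z|\<^sup>2) ^ \<alpha>\<close> on the ball of \<open>\<complex>\<^sup>3\<close>,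
  where \<open>\<alpha> = \<mu> * (m + k)\<close>.
\<close>

definition kernel_coeff :: "real \<Rightarrow> nat \<Rightarrow> nat \<Rightarrow> real" where
  "kernel_coeff \<mu> m k = fact (m + k) / fact k * pochhammer (\<mu> * real (m + k) + 1) 3 / pi ^ (m + 3)"

definition kernel_cubic :: "real \<Rightarrow> nat \<Rightarrow> complex \<Rightarrow> complex" where
  "kernel_cubic \<mu> m \<eta> = of_real ((1 - \<mu>) * (2 - \<mu>) * (3 - \<mu>))
     + of_real ((real m + 1) * \<mu> * (1 - \<mu>) * (11 - 7 * \<mu>)) * \<eta>
     + of_real (6 * (real m + 1) * (real m + 2) * (1 - \<mu>) * \<mu>\<^sup>2) * \<eta>\<^sup>2
     + of_real ((real m + 1) * (real m + 2) * (real m + 3) * \<mu> ^ 3) * \<eta> ^ 3"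

definition kernel_gen :: "real \<Rightarrow> nat \<Rightarrow> complex \<Rightarrow> complex" where
  "kernel_gen \<mu> m X = of_real (fact m / pi ^ (m + 3)) * kernel_cubic \<mu> m (1 / (1 - X)) / (1 - X) ^ (m + 1)"

definition kernel_fun :: "real \<Rightarrow> nat \<Rightarrow> complex \<Rightarrow> complex \<Rightarrow> complex" where
  "kernel_fun \<mu> m s t = (1 - s) powr (- of_real (4 + \<mu> * real m)) * kernel_gen \<mu> m (t * (1 - s) powr (- of_real \<mu>))"

lemma rising_factorial_sums:
  fixes X :: complex
  assumes "norm X < 1"
  shows "(\<lambda>k. of_real (fact (n + k) / fact k) * X ^ k) sums (fact n / (1 - X) ^ (n + 1))"
proof -
  have X1: "1 - X \<noteq> 0" using assms by auto
  have "pochhammer (real (n + 1)) k = fact (n + k) / fact n" for k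
    using pochhammer_product'[of "1::real" n k] by (simp add: pochhammer_fact[symmetric] add.commute)
  moreover have "(1 - X) powr (- of_real (real (n + 1))) = 1 / (1 - X) ^ (n + 1)"
    using X1 powr_complexpow[of "1 - X" "n + 1"] by (simp only: of_real_of_nat_eq powr_minus divide_inverse) simp
  ultimately have "(\<lambda>k. of_real (fact (n + k) / fact n / fact k) * X ^ k) sums (1 / (1 - X) ^ (n + 1))"
    using pochhammer_sums_powr[OF assms, of "real (n + 1)"] by simp
  from sums_mult[OF this, of "fact n"] show ?thesis
    by (simp add: field_simps)
qed

text \<open>
  The cubic factor of \<open>kernel_coeff\<close> is expanded in rising factorials of \<open>m + k + 1\<close>; each of them is absorbed by the
  factor \<open>(m + k)! / k!\<close> and sums to a power of \<open>1 / (1 - X)\<close>.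
\<close>

lemma kernel_gen_sums:
  assumes X: "norm X < 1"
  shows "(\<lambda>k. of_real (kernel_coeff \<mu> m k) * X ^ k) sums kernel_gen \<mu> m X"
proof -
  have X1: "1 - X \<noteq> 0" using X by auto
  define A0 A1 A2 A3 where "A0 = (1 - \<mu>) * (2 - \<mu>) * (3 - \<mu>)" and "A1 = \<mu> * (1 - \<mu>) * (11 - 7 * \<mu>)"
    and "A2 = 6 * (1 - \<mu>) * \<mu>\<^sup>2" and "A3 = \<mu> ^ 3"
  define C where "C = (\<lambda>i k. fact (m + i + k) / fact k :: real)"
  have coeff: "kernel_coeff \<mu> m k = (A0 * C 0 k + A1 * C 1 k + A2 * C 2 k + A3 * C 3 k) / pi ^ (m + 3)" for k
  proof -
    define x where "x = real (m + k)"
    have C: "C 1 k = C 0 k * (x + 1)" "C 2 k = C 0 k * (x + 1) * (x + 2)" "C 3 k = C 0 k * (x + 1) * (x + 2) * (x + 3)"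
      by (simp_all add: C_def x_def numeral_2_eq_2 numeral_3_eq_3 algebra_simps)
    have "pochhammer (\<mu> * x + 1) 3 = A0 + A1 * (x + 1) + A2 * ((x + 1) * (x + 2)) + A3 * ((x + 1) * (x + 2) * (x + 3))"
      by (simp add: A0_def A1_def A2_def A3_def numeral_3_eq_3 pochhammer_rec power2_eq_square power3_eq_cube algebra_simps)
    moreover have "kernel_coeff \<mu> m k = C 0 k * pochhammer (\<mu> * x + 1) 3 / pi ^ (m + 3)"
      by (simp add: kernel_coeff_def C_def x_def)
    ultimately show ?thesis unfolding C by (simp add: algebra_simps)
  qed
  have "(\<lambda>k. of_real (1 / pi ^ (m + 3)) * (of_real A0 * (of_real (C 0 k) * X ^ k) + of_real A1 * (of_real (C 1 k) * X ^ k)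
      + of_real A2 * (of_real (C 2 k) * X ^ k) + of_real A3 * (of_real (C 3 k) * X ^ k))) sums
     (of_real (1 / pi ^ (m + 3)) * (of_real A0 * (fact (m + 0) / (1 - X) ^ (m + 0 + 1)) + of_real A1 * (fact (m + 1) / (1 - X) ^ (m + 1 + 1))
      + of_real A2 * (fact (m + 2) / (1 - X) ^ (m + 2 + 1)) + of_real A3 * (fact (m + 3) / (1 - X) ^ (m + 3 + 1))))"
    unfolding C_def by (intro sums_mult sums_add rising_factorial_sums X)
  also have "(of_real (1 / pi ^ (m + 3)) * (of_real A0 * (fact (m + 0) / (1 - X) ^ (m + 0 + 1)) + of_real A1 * (fact (m + 1) / (1 - X) ^ (m + 1 + 1))
      + of_real A2 * (fact (m + 2) / (1 - X) ^ (m + 2 + 1)) + of_real A3 * (fact (m + 3) / (1 - X) ^ (m + 3 + 1))) :: complex) = kernel_gen \<mu> m X"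
  proof -
    define Y where "Y = 1 - X"
    define F where "F = (fact m :: complex)"
    define e1 e2 e3 where "e1 = (of_nat m + 1 :: complex)" and "e2 = (of_nat m + 2 :: complex)" and "e3 = (of_nat m + 3 :: complex)"
    note e = e1_def[symmetric] e2_def[symmetric] e3_def[symmetric]
    have Y: "Y \<noteq> 0" using X1 by (simp add: Y_def)
    have F: "fact (m + 0) = F" "fact (m + 1) = F * (of_nat m + 1)" "fact (m + 2) = F * (of_nat m + 1) * (of_nat m + 2)"
      "fact (m + 3) = F * (of_nat m + 1) * (of_nat m + 2) * (of_nat m + 3)"
      by (simp_all add: F_def numeral_2_eq_2 numeral_3_eq_3 algebra_simps)
    have P: "Y ^ (m + 0 + 1) = Y ^ (m + 1)" "Y ^ (m + 1 + 1) = Y ^ (m + 1) * Y" "Y ^ (m + 2 + 1) = Y ^ (m + 1) * Y\<^sup>2" "Y ^ (m + 3 + 1) = Y ^ (m + 1) * Y ^ 3"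
      by (simp_all only: power_add power_0 power_one_right mult_ac mult_1_left)
    have G: "kernel_gen \<mu> m X = of_real (1 / pi ^ (m + 3)) * F / Y ^ (m + 1) * (of_real A0 + of_real A1 * (of_nat m + 1) * (1 / Y)
       + of_real A2 * (of_nat m + 1) * (of_nat m + 2) * (1 / Y\<^sup>2) + of_real A3 * (of_nat m + 1) * (of_nat m + 2) * (of_nat m + 3) * (1 / Y ^ 3))"
    proof -
      have "kernel_cubic \<mu> m \<eta> = of_real A0 + of_real A1 * (of_nat m + 1) * \<eta>
       + of_real A2 * (of_nat m + 1) * (of_nat m + 2) * \<eta>\<^sup>2 + of_real A3 * (of_nat m + 1) * (of_nat m + 2) * (of_nat m + 3) * \<eta> ^ 3" for \<eta>
        unfolding kernel_cubic_def A0_def A1_def A2_def A3_def of_real_mult of_real_add of_real_of_nat_eq of_real_1 of_real_numeral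
        by (simp only: mult_ac)
      then show ?thesis
        unfolding kernel_gen_def Y_def[symmetric] F_def by (simp add: power_divide)
    qed
    show ?thesis unfolding G F Y_def[symmetric] P e
      by (simp only: distrib_left divide_inverse inverse_mult_distrib mult_1_left mult.assoc) (simp only: mult_ac)
  qed
  also have "(\<lambda>k. of_real (1 / pi ^ (m + 3)) * (of_real A0 * (of_real (C 0 k) * X ^ k) + of_real A1 * (of_real (C 1 k) * X ^ k)
      + of_real A2 * (of_real (C 2 k) * X ^ k) + of_real A3 * (of_real (C 3 k) * X ^ k))) = (\<lambda>k. of_real (kernel_coeff \<mu> m k) * X ^ k)"
    by (simp add: coeff fun_eq_iff add_divide_distrib algebra_simps)
  finally show ?thesis .
qed

lemma one_minus_powr_power:
  fixes s t :: complex
  assumes "norm s < 1"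
  shows "(1 - s) powr (- of_real (4 + \<mu> * real m)) * (t * (1 - s) powr (- of_real \<mu>)) ^ k
    = t ^ k * (1 - s) powr (- of_real (\<mu> * real (m + k) + 4))"
proof -
  have 1: "1 - s \<noteq> 0" using assms by auto
  have "((1 - s) powr (- of_real \<mu>)) ^ k = (1 - s) powr (- of_real (\<mu> * real k))"
    using 1 by (simp add: powr_def exp_of_nat_mult[symmetric] algebra_simps)
  then show ?thesis using 1 by (simp add: power_mult_distrib powr_add[symmetric] algebra_simps) 
qed

lemma kernel_fun_sums:
  assumes s: "norm s < 1" and X: "norm (t * (1 - s) powr (- of_real \<mu>)) < 1"
  shows "(\<lambda>k. of_real (kernel_coeff \<mu> m k) * (t ^ k * (1 - s) powr (- of_real (\<mu> * real (m + k) + 4)))) sums kernel_fun \<mu> m s t"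
  using sums_mult[OF kernel_gen_sums[OF X, of \<mu> m], of "(1 - s) powr (- of_real (4 + \<mu> * real m))"]
  unfolding kernel_fun_def one_minus_powr_power[OF s, symmetric] by (simp only: mult_ac)

text \<open>
  The inequality \<open>(1 - a\<^sup>2) * (1 - b\<^sup>2) \<le> (1 - a * b)\<^sup>2\<close> bounds \<open>X = t / (1 - s)^\<mu>\<close> independently of \<open>a\<close>. The bound is less
  than \<open>1\<close> when \<open>b\<close> and \<open>B\<close> are the norms of the two blocks of a point of the domain.
\<close>

lemma kernel_argument_bound:
  fixes s t :: complex
  assumes a: "0 \<le> a" "a < 1" and b: "0 \<le> b" "b < 1" and \<mu>: "\<mu> > 0"
    and s: "norm s \<le> a * b" and t: "norm t \<le> A * B" and A: "A\<^sup>2 \<le> (1 - a\<^sup>2) powr \<mu>" and B: "B \<ge> 0"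
  shows "norm (t * (1 - s) powr (- of_real \<mu>)) \<le> B * (1 - b\<^sup>2) powr (- (\<mu> / 2))"
proof -
  have ab: "a * b < 1" using mult_left_le[of b a] a b by linarith
  have a2: "a\<^sup>2 < 1" and b2: "b\<^sup>2 < 1" using a b by (auto simp: abs_square_less_1)
  have n: "1 - a * b \<le> norm (1 - s)" using norm_triangle_ineq2[of 1 s] s by simp
  have pos: "norm (1 - s) > 0" using n ab by linarith
  have "(1 - a\<^sup>2) * (1 - b\<^sup>2) = (1 - a * b)\<^sup>2 - (a - b)\<^sup>2" by (simp add: power2_eq_square algebra_simps)
  also have "\<dots> \<le> (1 - a * b)\<^sup>2" by simp
  also have "\<dots> \<le> (norm (1 - s))\<^sup>2" using n ab by (intro power_mono) auto
  finally have "((1 - a\<^sup>2) * (1 - b\<^sup>2)) powr (\<mu> / 2) \<le> ((norm (1 - s))\<^sup>2) powr (\<mu> / 2)"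
    using a2 b2 \<mu> by (intro powr_mono2) auto
  also have "\<dots> = norm (1 - s) powr \<mu>"
    using pos by (simp add: powr_numeral[symmetric] powr_powr del: powr_numeral)
  finally have 1: "(1 - a\<^sup>2) powr (\<mu> / 2) * (1 - b\<^sup>2) powr (\<mu> / 2) \<le> norm (1 - s) powr \<mu>"
    using a2 b2 by (simp add: powr_mult)
  have "A \<le> (1 - a\<^sup>2) powr (\<mu> / 2)"
  proof (rule power2_le_imp_le)
    show "A\<^sup>2 \<le> ((1 - a\<^sup>2) powr (\<mu> / 2))\<^sup>2" using A by (simp add: power2_eq_square powr_add[symmetric])
  qed simp
  then have "norm t \<le> (1 - a\<^sup>2) powr (\<mu> / 2) * B" using t B by (meson mult_right_mono order_trans)
  also have "\<dots> = B * (1 - b\<^sup>2) powr (- (\<mu> / 2)) * ((1 - a\<^sup>2) powr (\<mu> / 2) * (1 - b\<^sup>2) powr (\<mu> / 2))"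
    using b2 by (simp add: powr_minus field_simps)
  also have "\<dots> \<le> B * (1 - b\<^sup>2) powr (- (\<mu> / 2)) * norm (1 - s) powr \<mu>"
    using 1 B by (intro mult_left_mono) auto
  finally have "norm t \<le> B * (1 - b\<^sup>2) powr (- (\<mu> / 2)) * norm (1 - s) powr \<mu>" .
  then have "norm t * norm (1 - s) powr (- \<mu>) \<le> B * (1 - b\<^sup>2) powr (- (\<mu> / 2)) * norm (1 - s) powr \<mu> * norm (1 - s) powr (- \<mu>)"
    by (intro mult_right_mono) auto
  also have "\<dots> = B * (1 - b\<^sup>2) powr (- (\<mu> / 2))"
    using pos by (simp add: powr_minus)
  finally show ?thesis by (simp add: norm_mult norm_powr_real_powr')
qed

section \<open>The reproducing property at points on two axes\<close>

lemma set_integral_mult_cnj_sums: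
  fixes f G :: "complex ^ 'n::finite \<Rightarrow> complex"
  assumes U: "U \<in> sets borel" and f: "set_integrable lborel U f"
    and cont: "\<And>n. continuous_on U (g n)"
    and bound: "\<And>n p. p \<in> U \<Longrightarrow> norm (g n p) \<le> M n" and M: "summable M"
    and G: "\<And>p. p \<in> U \<Longrightarrow> (\<lambda>n. g n p) sums G p"
  shows "(\<lambda>n. LINT p:U|lborel. f p * cnj (g n p)) sums (LINT p:U|lborel. f p * cnj (G p))"
proof (cases "U = {}")
  case True
  then show ?thesis by (simp add: set_lebesgue_integral_def)
next
  case False
  then obtain p0 where "p0 \<in> U" by blast
  then have M0: "M n \<ge> 0" for n using bound[of p0 n] norm_ge_zero order_trans by blast
  define F where "F = (\<lambda>n p. indicator U p *\<^sub>R (f p * cnj (g n p)))"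
  have intF: "integrable lborel (F n)" for n
    using set_integrable_mult_bounded[OF U f, of "\<lambda>p. cnj (g n p)" "M n"] cont[of n] bound
    by (simp add: F_def set_integrable_def continuous_intros)
  have intf: "integrable lborel (\<lambda>p. norm (indicator U p *\<^sub>R f p))"
    using f unfolding set_integrable_def by (rule integrable_norm)
  have Fle: "norm (F n p) \<le> M n * norm (indicator U p *\<^sub>R f p)" for n p
    using mult_left_mono[OF bound[of p n], of "norm (f p)"] by (auto simp: F_def indicator_def norm_mult mult.commute)
  have sumF: "summable (\<lambda>n. norm (F n p))" for p
    by (rule summable_comparison_test'[of "\<lambda>n. M n * norm (indicator U p *\<^sub>R f p)" 0])
      (use summable_mult2[OF M] Fle[of _ p] in auto)
  have sumI: "summable (\<lambda>n. \<integral>p. norm (F n p) \<partial>lborel)"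
  proof (rule summable_comparison_test')
    show "summable (\<lambda>n. M n * (\<integral>p. norm (indicator U p *\<^sub>R f p) \<partial>lborel))"
      by (intro summable_mult2 M)
    fix n :: nat
    have "(\<integral>p. norm (F n p) \<partial>lborel) \<le> (\<integral>p. M n * norm (indicator U p *\<^sub>R f p) \<partial>lborel)"
      by (intro integral_mono integrable_norm intF integrable_mult_right intf Fle)
    then show "norm (\<integral>p. norm (F n p) \<partial>lborel) \<le> M n * (\<integral>p. norm (indicator U p *\<^sub>R f p) \<partial>lborel)"
      by simp
  qed
  have "(\<lambda>n. \<integral>p. F n p \<partial>lborel) sums (\<integral>p. (\<Sum>n. F n p) \<partial>lborel)"
    by (rule sums_integral) (use intF sumF sumI in auto)
  moreover have "(\<Sum>n. F n p) = indicator U p *\<^sub>R (f p * cnj (G p))" for p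
  proof (cases "p \<in> U")
    case True
    then have "(\<lambda>n. f p * cnj (g n p)) sums (f p * cnj (G p))"
      using G by (intro sums_mult) (simp add: sums_cnj)
    then show ?thesis using True by (simp add: F_def sums_iff)
  qed (simp add: F_def)
  ultimately show ?thesis by (simp add: F_def set_lebesgue_integral_def)
qed

lemma norm_powr_minus_of_real: "norm ((z::complex) powr (- of_real r)) = norm z powr (- r)"
  by (simp add: norm_powr_real_powr')

lemma kernel_coeff_nonneg: "\<mu> > 0 \<Longrightarrow> kernel_coeff \<mu> m k \<ge> 0"
  by (auto simp: kernel_coeff_def intro!: mult_nonneg_nonneg divide_nonneg_nonneg pochhammer_nonneg add_nonneg_pos)

text \<open>
  The Taylor coefficients of the kernel in \<open>x\<close> and \<open>y\<close> are the reciprocals of the squared norms of the monomials.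
\<close>

lemma kernel_coeff_moment:
  assumes "\<mu> > 0"
  shows "kernel_coeff \<mu> CARD('m) k * (pochhammer (\<mu> * real (CARD('m) + k) + 4) j / fact j * moment TYPE('m::finite) \<mu> j k) = 1"
proof -
  define \<alpha> where "\<alpha> = \<mu> * real (CARD('m) + k)"
  have "\<alpha> \<ge> 0" using assms by (simp add: \<alpha>_def)
  then have pos: "pochhammer (\<alpha> + 1) (3 + j) > 0" by (intro pochhammer_pos) auto
  have "pochhammer (\<alpha> + 1) (3 + j) = pochhammer (\<alpha> + 1) 3 * pochhammer (\<alpha> + 4) j"
    using pochhammer_product'[of "\<alpha> + 1" 3 j] by (simp add: add_ac)
  moreover from this pos have "pochhammer (\<alpha> + 1) 3 \<noteq> 0" "pochhammer (\<alpha> + 4) j \<noteq> 0" by auto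
  ultimately show ?thesis
    unfolding kernel_coeff_def moment_def \<alpha>_def[symmetric] by (simp add: power_add field_simps)
qed

text \<open>
  The kernel is expanded first in \<open>y\<close> (index \<open>k\<close>) and then in \<open>x\<close> (index \<open>j\<close>). Both expansions are dominated
  on the domain by convergent numerical series, so they may be integrated termwise; by \<open>kernel_coeff_moment\<close> the result
  is the Taylor series of \<open>f\<close> at the given point.
\<close>

lemma reproducing_on_axes:
  fixes f :: "complex ^ (3 + 'm::finite) \<Rightarrow> complex" and u v :: real
  assumes f: "holomorphic_several_on f (Omega_hat \<mu>)" and \<mu>: "\<mu> > 0"
    and int: "set_integrable lborel (Omega_hat \<mu>) f"
    and w: "axes_vec a b (of_real u) (of_real v) \<in> Omega_hat \<mu>" and u: "u \<ge> 0" and v: "v \<ge> 0"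
  shows "f (axes_vec a b (of_real u) (of_real v)) =
    (LINT p:Omega_hat \<mu>|lborel. f p * cnj (kernel_fun \<mu> CARD('m) (p $ Inl a * of_real u) (p $ Inr b * of_real v)))"
proof -
  define U where "U = (Omega_hat \<mu> :: (complex ^ (3 + 'm)) set)"
  define m where "m = CARD('m)"
  define c where "c = (\<lambda>k. \<mu> * real (m + k) + 4)"
  define B where "B = (\<lambda>k. kernel_coeff \<mu> m k)"
  have U[simp]: "U \<in> sets borel" by (simp add: U_def)
  have intU: "set_integrable lborel U f" using int by (simp add: U_def)
  have nth: "norm (p $ Inl a) < 1" "norm (p $ Inr b) < 1" "axes_vec a b (p $ Inl a) (p $ Inr b) \<in> Omega_hat \<mu>" if "p \<in> U" for p
    using Omega_hat_nth_le[OF that[unfolded U_def] \<mu>] by auto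
  have u1: "u < 1" using w u by (simp add: abs_square_less_1)
  have v2: "v\<^sup>2 < (1 - u\<^sup>2) powr \<mu>" using w by simp
  have s1: "norm (p $ Inl a * of_real u) \<le> u" "norm (p $ Inl a * of_real u) < 1" if "p \<in> U" for p
    using nth(1)[OF that] u u1 by (auto simp: norm_mult mult_left_le_one_le intro: order.strict_trans1[OF mult_left_le_one_le])
  define x0 where "x0 = v * (1 - u\<^sup>2) powr (- (\<mu> / 2))"
  have u2: "u\<^sup>2 < 1" using u u1 by (simp add: abs_square_less_1)
  have x0: "0 \<le> x0" "x0 < 1"
  proof -
    show "0 \<le> x0" using v by (simp add: x0_def)
    have "v < (1 - u\<^sup>2) powr (\<mu> / 2)"
    proof (rule power2_less_imp_less)
      show "v\<^sup>2 < ((1 - u\<^sup>2) powr (\<mu> / 2))\<^sup>2" using v2 by (simp add: power2_eq_square powr_add[symmetric])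
    qed simp
    then show "x0 < 1" using u2 by (simp add: x0_def powr_minus field_simps)
  qed
  have X: "norm (p $ Inr b * of_real v * (1 - p $ Inl a * of_real u) powr (- of_real \<mu>)) \<le> x0" if p: "p \<in> U" for p
    unfolding x0_def
    by (rule kernel_argument_bound[where a = "norm (p $ Inl a)" and A = "norm (p $ Inr b)"])
      (use nth[OF p] u v u1 \<mu> in \<open>auto simp: norm_mult\<close>)
  define I where "I = (\<lambda>k. LINT p:U|lborel. f p * cnj (p $ Inr b ^ k * (1 - p $ Inl a * of_real u) powr (- of_real (c k))))"
  have contp: "continuous_on U (\<lambda>p. (1 - p $ Inl a * of_real u) powr z)" for z
  proof (rule continuous_on_powr_complex)
    have "Re (1 - p $ Inl a * of_real u) > 0" if "p \<in> U" for p
      using complex_Re_le_cmod[of "p $ Inl a * of_real u"] s1(2)[OF that] by simp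
    note R = this
    show "U \<subseteq> {p. 0 \<le> Re (1 - p $ Inl a * of_real u) \<or> Im (1 - p $ Inl a * of_real u) \<noteq> 0}"
      using less_imp_le[OF R] by blast
    fix p assume "p \<in> U" "1 - p $ Inl a * of_real u = 0"
    then show "Re z > 0" using R[of p] by (metis less_irrefl zero_complex.sel(1))
  qed (intro continuous_intros)+
  have level1: "of_real (B k) * I k = slice_coeff f a b k (of_real u)" for k
  proof -
    have "(\<lambda>j. LINT p:U|lborel. f p * cnj (of_real (pochhammer (c k) j / fact j) * (p $ Inl a * of_real u) ^ j * p $ Inr b ^ k)) sums
      (LINT p:U|lborel. f p * cnj ((1 - p $ Inl a * of_real u) powr (- of_real (c k)) * p $ Inr b ^ k))"
    proof (rule set_integral_mult_cnj_sums[OF U intU])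
      have ck: "c k \<ge> 0" using \<mu> by (simp add: c_def)
      have pn: "pochhammer (c k) j \<ge> 0" for j
        using \<mu> by (intro pochhammer_nonneg) (auto simp: c_def intro!: add_nonneg_pos)
      have "(\<lambda>j. of_real (pochhammer (c k) j / fact j) * (of_real u :: complex) ^ j) sums (1 - of_real u) powr (- of_real (c k))"
        using u u1 by (intro pochhammer_sums_powr) simp
      then have "summable (\<lambda>j. of_real (pochhammer (c k) j / fact j * u ^ j) :: complex)"
        by (simp add: sums_iff)
      then show "summable (\<lambda>j. pochhammer (c k) j / fact j * u ^ j)"
        by (simp only: summable_of_real_iff)
      fix j p assume p: "p \<in> U"
      have "norm (of_real (pochhammer (c k) j / fact j) * (p $ Inl a * of_real u) ^ j * p $ Inr b ^ k)
        = pochhammer (c k) j / fact j * norm (p $ Inl a * of_real u) ^ j * norm (p $ Inr b) ^ k"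
        using pn[of j] by (simp only: norm_mult norm_power norm_of_real abs_of_nonneg divide_nonneg_nonneg fact_ge_zero)
      also have "\<dots> \<le> pochhammer (c k) j / fact j * u ^ j * 1"
        using pn[of j] s1[OF p] nth[OF p] u
        by (intro mult_mono power_mono mult_nonneg_nonneg order_refl divide_nonneg_nonneg) (auto intro: power_le_one)
      finally show "norm (of_real (pochhammer (c k) j / fact j) * (p $ Inl a * of_real u) ^ j * p $ Inr b ^ k) \<le> pochhammer (c k) j / fact j * u ^ j"
        by simp
    next
      fix p assume p: "p \<in> U"
      show "(\<lambda>j. of_real (pochhammer (c k) j / fact j) * (p $ Inl a * of_real u) ^ j * p $ Inr b ^ k) sums ((1 - p $ Inl a * of_real u) powr (- of_real (c k)) * p $ Inr b ^ k)"
        by (intro sums_mult2 pochhammer_sums_powr s1 p)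
    qed (intro continuous_intros)
    moreover have "(LINT p:U|lborel. f p * cnj (of_real (pochhammer (c k) j / fact j) * (p $ Inl a * of_real u) ^ j * p $ Inr b ^ k))
       = of_real (pochhammer (c k) j / fact j) * of_real u ^ j * (taylor_coeff f a b j k * of_real (moment TYPE('m) \<mu> j k))" for j
    proof -
      have "(LINT p:U|lborel. f p * cnj (of_real (pochhammer (c k) j / fact j) * (p $ Inl a * of_real u) ^ j * p $ Inr b ^ k))
        = (LINT p:U|lborel. (of_real (pochhammer (c k) j / fact j) * of_real u ^ j) * (f p * cnj (p $ Inl a ^ j * p $ Inr b ^ k)))"
        by (simp add: power_mult_distrib mult_ac)
      also have "\<dots> = of_real (pochhammer (c k) j / fact j) * of_real u ^ j * (LINT p:U|lborel. f p * cnj (p $ Inl a ^ j * p $ Inr b ^ k))"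
        by (rule set_integral_mult_right)
      finally show ?thesis unfolding U_def monomial_integral[OF f \<mu> int] .
    qed
    ultimately have "(\<lambda>j. of_real (pochhammer (c k) j / fact j) * of_real u ^ j * (taylor_coeff f a b j k * of_real (moment TYPE('m) \<mu> j k))) sums I k"
      by (simp add: I_def mult_ac)
    from sums_mult[OF this, of "of_real (B k)"]
    have "(\<lambda>j. of_real (B k * (pochhammer (c k) j / fact j * moment TYPE('m) \<mu> j k)) * (taylor_coeff f a b j k * of_real u ^ j)) sums (of_real (B k) * I k)"
      by (simp add: mult_ac)
    then have "(\<lambda>j. taylor_coeff f a b j k * of_real u ^ j) sums (of_real (B k) * I k)"
      unfolding B_def c_def m_def kernel_coeff_moment[OF \<mu>] by simp
    then show ?thesis using taylor_sums(2)[OF f \<mu> w] sums_unique2 by blast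
  qed
  have "(\<lambda>k. LINT p:U|lborel. f p * cnj (of_real (B k) * ((p $ Inr b * of_real v) ^ k * (1 - p $ Inl a * of_real u) powr (- of_real (c k))))) sums
     (LINT p:U|lborel. f p * cnj (kernel_fun \<mu> m (p $ Inl a * of_real u) (p $ Inr b * of_real v)))"
  proof (rule set_integral_mult_cnj_sums[OF U intU])
    show "continuous_on U (\<lambda>p. of_real (B k) * ((p $ Inr b * of_real v) ^ k * (1 - p $ Inl a * of_real u) powr (- of_real (c k))))" for k
      by (intro continuous_on_mult contp continuous_intros)
    have "(\<lambda>k. of_real (B k) * (of_real x0 :: complex) ^ k) sums kernel_gen \<mu> m (of_real x0)"
      unfolding B_def using x0 by (intro kernel_gen_sums) simp
    then have "summable (\<lambda>k. of_real (B k * x0 ^ k) :: complex)"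
      by (simp add: sums_iff)
    then have "summable (\<lambda>k. B k * x0 ^ k)"
      by (simp only: summable_of_real_iff)
    then show "summable (\<lambda>k. (1 - u) powr (- (4 + \<mu> * real m)) * (B k * x0 ^ k))"
      by (rule summable_mult)
    fix k p assume p: "p \<in> U"
    define s where "s = p $ Inl a * of_real u"
    define t where "t = p $ Inr b * of_real v"
    have B0: "B k \<ge> 0" unfolding B_def by (rule kernel_coeff_nonneg[OF \<mu>])
    have n: "1 - u \<le> norm (1 - s)" using norm_triangle_ineq2[of 1 s] s1(1)[OF p] by (simp add: s_def)
    have "norm (of_real (B k) * (t ^ k * (1 - s) powr (- of_real (c k)))) = B k * norm ((1 - s) powr (- of_real (4 + \<mu> * real m)) * (t * (1 - s) powr (- of_real \<mu>)) ^ k)"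
      using B0 s1(2)[OF p] by (simp only: one_minus_powr_power s_def c_def norm_mult norm_of_real abs_of_nonneg)
    also have "\<dots> = B k * (norm (1 - s) powr (- (4 + \<mu> * real m)) * norm (t * (1 - s) powr (- of_real \<mu>)) ^ k)"
      by (simp only: norm_mult norm_power norm_powr_minus_of_real)
    also have "\<dots> \<le> B k * ((1 - u) powr (- (4 + \<mu> * real m)) * x0 ^ k)"
    proof (intro mult_left_mono mult_mono power_mono B0)
      show "norm (1 - s) powr (- (4 + \<mu> * real m)) \<le> (1 - u) powr (- (4 + \<mu> * real m))"
      proof (rule powr_mono2'[OF _ _ n])
        have "\<mu> * real m \<ge> 0" using \<mu> by simp
        then show "- (4 + \<mu> * real m) \<le> 0" by linarith
      qed (use u1 in simp)
      show "norm (t * (1 - s) powr (- of_real \<mu>)) \<le> x0" using X[OF p] by (simp add: s_def t_def)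
    qed (use x0 in auto)
    finally show "norm (of_real (B k) * ((p $ Inr b * of_real v) ^ k * (1 - p $ Inl a * of_real u) powr (- of_real (c k)))) \<le> (1 - u) powr (- (4 + \<mu> * real m)) * (B k * x0 ^ k)"
      by (simp add: s_def t_def mult_ac)
  next
    fix p assume p: "p \<in> U"
    show "(\<lambda>k. of_real (B k) * ((p $ Inr b * of_real v) ^ k * (1 - p $ Inl a * of_real u) powr (- of_real (c k)))) sums
       kernel_fun \<mu> m (p $ Inl a * of_real u) (p $ Inr b * of_real v)"
      unfolding B_def c_def by (rule kernel_fun_sums) (use s1[OF p] X[OF p] x0 in auto)
  qed
  moreover have "(LINT p:U|lborel. f p * cnj (of_real (B k) * ((p $ Inr b * of_real v) ^ k * (1 - p $ Inl a * of_real u) powr (- of_real (c k)))))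
     = slice_coeff f a b k (of_real u) * of_real v ^ k" for k
  proof -
    have "(LINT p:U|lborel. f p * cnj (of_real (B k) * ((p $ Inr b * of_real v) ^ k * (1 - p $ Inl a * of_real u) powr (- of_real (c k)))))
       = (LINT p:U|lborel. (of_real (B k) * of_real v ^ k) * (f p * cnj (p $ Inr b ^ k * (1 - p $ Inl a * of_real u) powr (- of_real (c k)))))"
      by (simp add: power_mult_distrib mult_ac)
    also have "\<dots> = of_real (B k) * of_real v ^ k * I k"
      unfolding I_def by (rule set_integral_mult_right)
    finally show ?thesis by (simp add: level1[symmetric] mult_ac)
  qed
  ultimately have "(\<lambda>k. slice_coeff f a b k (of_real u) * of_real v ^ k) sums
     (LINT p:U|lborel. f p * cnj (kernel_fun \<mu> m (p $ Inl a * of_real u) (p $ Inr b * of_real v)))"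
    by simp
  with taylor_sums(1)[OF f \<mu> w] show ?thesis unfolding U_def m_def by (rule sums_unique2)
qed

section \<open>Unitary maps\<close>

definition herm :: "complex ^ 'k::finite \<Rightarrow> complex ^ 'k \<Rightarrow> complex" where
  "herm x y = (\<Sum>i\<in>UNIV. x $ i * cnj (y $ i))"

lemma herm_simps:
  "herm (x + y) z = herm x z + herm y z" "herm (x - y) z = herm x z - herm y z" "herm (c *s x) z = c * herm x z"
  "herm z (x + y) = herm z x + herm z y" "herm z (x - y) = herm z x - herm z y" "herm z (c *s x) = cnj c * herm z x"
  by (simp_all add: herm_def sum.distrib sum_subtractf sum_distrib_left algebra_simps)

lemma cnj_herm: "cnj (herm x y) = herm y x"
  by (simp add: herm_def mult.commute)

lemma herm_self: "herm x x = of_real ((norm x)\<^sup>2)"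
  by (simp add: herm_def norm_vec_def L2_set_def sum_nonneg complex_norm_square[symmetric])

lemma norm_herm_le: "norm (herm x y) \<le> norm x * norm y"
proof -
  have "norm (herm x y) \<le> (\<Sum>i\<in>UNIV. \<bar>norm (x $ i)\<bar> * \<bar>norm (y $ i)\<bar>)"
    unfolding herm_def by (rule order_trans[OF norm_sum]) (simp add: norm_mult)
  also have "\<dots> \<le> norm x * norm y" unfolding norm_vec_def by (rule L2_set_mult_ineq)
  finally show ?thesis .
qed

lemma herm_axis: "herm x (axis a c) = x $ a * cnj c" "herm (axis a c) x = c * cnj (x $ a)"
  by (simp_all add: herm_def axis_def if_distrib[of cnj] if_distrib[of "\<lambda>z. _ * z"] if_distrib[of "\<lambda>z. z * _"] sum.delta cong: if_cong)

text \<open>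
  Up to a phase \<open>\<omega>\<close> and the length of \<open>v\<close>, the component of \<open>v\<close> along the axis is real and nonnegative; then the
  reflection in the hyperplane orthogonal to \<open>e - u\<close>, where \<open>e\<close> and \<open>u\<close> are the two unit vectors, exchanges them.
\<close>

lemma unitary_from_axis:
  fixes v :: "complex ^ 'k::finite"
  obtains H :: "complex ^ 'k \<Rightarrow> complex ^ 'k" where "\<And>x y. H (x + y) = H x + H y" "\<And>c x. H (c *s x) = c *s H x"
    "\<And>x y. herm (H x) (H y) = herm x y" "H (axis a (of_real (norm v))) = v"
proof (cases "v = 0")
  case True
  then show ?thesis by (intro that[of id]) (auto simp: axis_def vec_eq_iff)
next
  case False
  define n where "n = norm v"
  have n: "n > 0" using False by (simp add: n_def)
  define \<omega> where "\<omega> = (if v $ a = 0 then 1 else sgn (v $ a))"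
  have \<omega>: "\<omega> * cnj \<omega> = 1"
    by (simp add: \<omega>_def complex_norm_square[symmetric] norm_sgn)
  define u where "u = (cnj \<omega> / of_real n) *s v"
  have ua: "u $ a = of_real (norm (v $ a) / n)"
    by (auto simp: u_def \<omega>_def sgn_eq complex_norm_square[symmetric] power2_eq_square)
       (simp add: field_simps complex_norm_square[symmetric] power2_eq_square)
  have vu: "v = (\<omega> * of_real n) *s u"
    using n \<omega> by (simp add: u_def vec_eq_iff field_simps)
  have uu: "herm u u = 1"
  proof -
    have "herm u u = (cnj \<omega> * \<omega>) * (of_real (n\<^sup>2) / (of_real n * of_real n))"
      unfolding u_def herm_simps(3,6) herm_self[of v] n_def[symmetric] by simp
    then show ?thesis using n \<omega> by (simp add: power2_eq_square mult.commute)
  qed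
  define e where "e = (axis a 1 :: complex ^ 'k)"
  define d where "d = e - u"
  define r where "r = norm (v $ a) / n"
  have ee: "herm e e = 1" and eu: "herm e u = of_real r" and ue: "herm u e = of_real r"
    by (simp_all add: e_def herm_axis ua r_def)
  have dd: "herm d d = of_real (2 - 2 * r)"
    unfolding d_def herm_simps ee uu eu ue by simp
  have ed: "herm e d = of_real (1 - r)"
    unfolding d_def herm_simps ee uu eu ue by simp
  \<comment> \<open>If \<open>d = 0\<close> the division by zero yields \<open>0\<close>, and \<open>H\<close> is multiplication by \<open>\<omega>\<close>, as it should be.\<close>
  define H where "H = (\<lambda>x. \<omega> *s (x - (2 * herm x d / herm d d) *s d))"
  show ?thesis
  proof (rule that[of H])
    show "H (x + y) = H x + H y" for x y
      by (simp add: H_def herm_simps vec_eq_iff add_divide_distrib algebra_simps)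
    show "H (c *s x) = c *s H x" for c x
      by (simp add: H_def herm_simps vec_eq_iff algebra_simps)
    show "herm (H x) (H y) = herm x y" for x y
    proof -
      define c where "c = herm d d"
      have cc: "cnj c = c" by (simp add: c_def cnj_herm)
      have "herm (H x) (H y) = (\<omega> * cnj \<omega>) * (herm x y - cnj (2 * herm y d / c) * herm x d - 2 * herm x d / c * (herm d y - cnj (2 * herm y d / c) * c))"
        unfolding H_def herm_simps c_def[symmetric] by (simp add: algebra_simps)
      also have "\<dots> = herm x y"
      proof (cases "c = 0")
        case False
        then show ?thesis unfolding \<omega> by (simp add: cc cnj_herm field_simps)
      qed (simp add: \<omega>)
      finally show ?thesis .
    qed
    have He: "H e = \<omega> *s u"
    proof (cases "r = 1")
      case True
      then have "(norm d)\<^sup>2 = 0" using dd herm_self[of d] by simp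
      then have "d = 0" by simp
      then show ?thesis by (simp add: H_def d_def)
    next
      case False
      then have nz: "(of_real (2 - 2 * r) :: complex) \<noteq> 0" unfolding of_real_eq_0_iff by simp
      have "2 * herm e d / herm d d = of_real (2 * (1 - r)) / of_real (2 - 2 * r)"
        unfolding dd ed by simp
      also have "\<dots> = 1" using nz by (simp add: right_diff_distrib)
      finally show ?thesis by (simp add: H_def d_def)
    qed
    have "H (axis a (of_real n)) = H (of_real n *s e)"
      by (rule arg_cong[where f = H]) (simp add: e_def vec_eq_iff axis_def)
    also have "\<dots> = of_real n *s H e"
      by (simp add: H_def herm_simps vec_eq_iff algebra_simps)
    also have "\<dots> = v" unfolding He using vu by (simp add: mult.commute)
    finally show "H (axis a (of_real (norm v))) = v" by (simp add: n_def)
  qed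
qed

section \<open>Uniqueness of the Bergman kernel\<close>

text \<open>
  Evaluating each of two kernels by the reproducing property of the other shows that they are conjugate transposes of each
  other; in particular each is Hermitian, so they agree.
\<close>

lemma is_bergman_kernel_unique:
  assumes K: "is_bergman_kernel U K" and K': "is_bergman_kernel U K'" and a: "a \<in> U" and b: "b \<in> U"
  shows "K a b = K' a b"
proof -
  have sym: "L b a = cnj (M a b)" if L: "is_bergman_kernel U L" and M: "is_bergman_kernel U M" for L M
  proof -
    have La: "(\<lambda>z. L z a) \<in> bergman_space U" and Mb: "(\<lambda>z. M z b) \<in> bergman_space U"
      using L M a b by (simp_all add: is_bergman_kernel_def)
    have "M a b = (LINT z:U|lborel. M z b * cnj (L z a))"
      using L[unfolded is_bergman_kernel_def, THEN bspec, OF a, THEN conjunct2, THEN bspec, OF Mb] .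
    moreover have "L b a = (LINT z:U|lborel. L z a * cnj (M z b))"
      using M[unfolded is_bergman_kernel_def, THEN bspec, OF b, THEN conjunct2, THEN bspec, OF La] .
    moreover have "(LINT z:U|lborel. L z a * cnj (M z b)) = cnj (LINT z:U|lborel. M z b * cnj (L z a))"
      unfolding set_lebesgue_integral_def Bochner_Integration.integral_cnj[symmetric]
      by (intro Bochner_Integration.integral_cong) (auto simp: indicator_def mult.commute)
    ultimately show ?thesis by simp
  qed
  have "cnj (K a b) = cnj (K' a b)" using sym[OF K K] sym[OF K K'] by simp
  then show ?thesis by simp
qed

text \<open>
  Setting a kernel to \<open>0\<close> off \<open>U \<times> U\<close> keeps it a Bergman kernel, because \<open>U\<close> is open and derivatives at points of \<open>U\<close> are
  local. The modified kernel is the one picked by the definite description.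
\<close>

lemma bergman_kernel_eqI:
  assumes U: "open U" and K: "is_bergman_kernel U K" and z: "z \<in> U" and w: "w \<in> U"
  shows "bergman_kernel U z w = K z w"
proof -
  define K0 where "K0 = (\<lambda>z w. if z \<in> U \<and> w \<in> U then K z w else 0)"
  have "is_bergman_kernel U K0"
    unfolding is_bergman_kernel_def
  proof (intro ballI conjI)
    fix w assume w: "w \<in> U"
    have Kw: "(\<lambda>z. K z w) \<in> bergman_space U" using K w by (simp add: is_bergman_kernel_def)
    have "holomorphic_several_on (\<lambda>z. K0 z w) U"
      unfolding holomorphic_several_on_def
    proof
      fix p assume p: "p \<in> U"
      then obtain f' where f': "((\<lambda>z. K z w) has_derivative f') (at p)" "\<forall>c v. f' (c *s v) = c * f' v"
        using Kw unfolding bergman_space_def holomorphic_several_on_def by blast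
      have "((\<lambda>z. K0 z w) has_derivative f') (at p)"
        by (rule has_derivative_transform_within_open[OF f'(1) U p]) (simp add: K0_def w)
      then show "\<exists>f'. ((\<lambda>z. K0 z w) has_derivative f') (at p) \<and> (\<forall>c v. f' (c *s v) = c * f' v)"
        using f'(2) by blast
    qed
    moreover have "set_integrable lborel U (\<lambda>z. (norm (K0 z w))\<^sup>2)"
      using Kw unfolding bergman_space_def set_integrable_def
      by (auto elim!: Bochner_Integration.integrable_cong[THEN iffD1, rotated 2] simp: K0_def w indicator_def)
    ultimately show "(\<lambda>z. K0 z w) \<in> bergman_space U" by (simp add: bergman_space_def)
    fix f assume "f \<in> bergman_space U"
    then have "f w = (LINT z:U|lborel. f z * cnj (K z w))" using K w by (simp add: is_bergman_kernel_def)
    also have "\<dots> = (LINT z:U|lborel. f z * cnj (K0 z w))"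
      unfolding set_lebesgue_integral_def
      by (intro Bochner_Integration.integral_cong) (auto simp: K0_def w indicator_def)
    finally show "f w = (LINT z:U|lborel. f z * cnj (K0 z w))" .
  qed
  then have "bergman_kernel U = K0"
    unfolding bergman_kernel_def
  proof (intro the_equality)
    fix L assume L: "is_bergman_kernel U L \<and> (\<forall>z w. z \<notin> U \<or> w \<notin> U \<longrightarrow> L z w = 0)"
    show "L = K0"
    proof (intro ext)
      fix z w show "L z w = K0 z w"
        using L is_bergman_kernel_unique[of U L K z w] K by (auto simp: K0_def)
    qed
  qed (auto simp: K0_def)
  then show ?thesis using z w by (simp add: K0_def)
qed

section \<open>The Bergman kernel of the Hartogs domain\<close>

definition vec_left :: "complex ^ ('a::finite + 'b::finite) \<Rightarrow> complex ^ 'a" where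
  "vec_left p = (\<chi> l. p $ Inl l)"

definition vec_right :: "complex ^ ('a::finite + 'b::finite) \<Rightarrow> complex ^ 'b" where
  "vec_right p = (\<chi> r. p $ Inr r)"

lemma Omega_hat_iff_norm:
  "p \<in> Omega_hat \<mu> \<longleftrightarrow> norm (vec_left p) < 1 \<and> (norm (vec_right p))\<^sup>2 < (1 - (norm (vec_left p))\<^sup>2) powr \<mu>"
  by (simp add: Omega_hat_iff vec_left_def vec_right_def norm_vec_def L2_set_def sum_nonneg)

definition hartogs_kernel :: "real \<Rightarrow> complex ^ (3 + 'm::finite) \<Rightarrow> complex ^ (3 + 'm) \<Rightarrow> complex" where
  "hartogs_kernel \<mu> p w = kernel_fun \<mu> CARD('m) (herm (vec_left p) (vec_left w)) (herm (vec_right p) (vec_right w))"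

text \<open>
  For a fixed second point, \<open>1 - s\<close> stays away from \<open>0\<close> and \<open>X\<close> stays in a compact part of the unit disc. This gives
  convergence of the series, holomorphy, and boundedness of the kernel in the first point.
\<close>

lemma hartogs_kernel_arguments:
  fixes w :: "complex ^ (3 + 'm::finite)"
  assumes w: "w \<in> Omega_hat \<mu>" and \<mu>: "\<mu> > 0"
  obtains x0 \<delta> where "0 \<le> x0" "x0 < 1" "\<delta> > 0"
    "\<And>p :: complex ^ (3 + 'm). p \<in> Omega_hat \<mu> \<Longrightarrow> norm (herm (vec_left p) (vec_left w)) < 1"
    "\<And>p :: complex ^ (3 + 'm). p \<in> Omega_hat \<mu> \<Longrightarrow> \<delta> \<le> norm (1 - herm (vec_left p) (vec_left w))"
    "\<And>p :: complex ^ (3 + 'm). p \<in> Omega_hat \<mu> \<Longrightarrow> norm (herm (vec_right p) (vec_right w) * (1 - herm (vec_left p) (vec_left w)) powr (- of_real \<mu>)) \<le> x0"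
proof -
  define b where "b = norm (vec_left w)"
  have b: "0 \<le> b" "b < 1" using w by (simp_all add: b_def Omega_hat_iff_norm)
  have b2: "b\<^sup>2 < 1" using b by (simp add: abs_square_less_1)
  define x0 where "x0 = norm (vec_right w) * (1 - b\<^sup>2) powr (- (\<mu> / 2))"
  have s: "norm (herm (vec_left p) (vec_left w)) \<le> norm (vec_left p) * b" for p :: "complex ^ (3 + 'm)"
    using norm_herm_le by (simp add: b_def)
  have s': "norm (herm (vec_left p) (vec_left w)) \<le> b" if "p \<in> Omega_hat \<mu>" for p :: "complex ^ (3 + 'm)"
    using order_trans[OF s mult_left_le_one_le[of b "norm (vec_left p)"]] that b by (simp add: Omega_hat_iff_norm)
  show ?thesis
  proof (rule that[of x0 "1 - b"])
    show "0 \<le> x0" by (simp add: x0_def)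
    have "norm (vec_right w) < (1 - b\<^sup>2) powr (\<mu> / 2)"
    proof (rule power2_less_imp_less)
      show "(norm (vec_right w))\<^sup>2 < ((1 - b\<^sup>2) powr (\<mu> / 2))\<^sup>2"
        using w by (simp add: Omega_hat_iff_norm b_def power2_eq_square powr_add[symmetric])
    qed simp
    then show "x0 < 1" using b2 by (simp add: x0_def powr_minus field_simps)
    show "1 - b > 0" using b by simp
    fix p :: "complex ^ (3 + 'm)" assume p: "p \<in> Omega_hat \<mu>"
    show "norm (herm (vec_left p) (vec_left w)) < 1" using s'[OF p] b by linarith
    show "1 - b \<le> norm (1 - herm (vec_left p) (vec_left w))"
      using norm_triangle_ineq2[of 1 "herm (vec_left p) (vec_left w)"] s'[OF p] by simp
    show "norm (herm (vec_right p) (vec_right w) * (1 - herm (vec_left p) (vec_left w)) powr (- of_real \<mu>)) \<le> x0"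
      unfolding x0_def
      by (rule kernel_argument_bound[where a = "norm (vec_left p)" and A = "norm (vec_right p)"])
        (use p b \<mu> s norm_herm_le in \<open>auto simp: Omega_hat_iff_norm\<close>)
  qed
qed

text \<open>
  The condition that \<open>holomorphic_several_on\<close> imposes at each point, isolated so that it can be propagated through products and
  compositions.
\<close>

definition complex_differentiable_at :: "(complex ^ 'n::finite \<Rightarrow> complex) \<Rightarrow> complex ^ 'n \<Rightarrow> bool" where
  "complex_differentiable_at f p \<longleftrightarrow> (\<exists>f'. (f has_derivative f') (at p) \<and> (\<forall>c v. f' (c *s v) = c * f' v))"

lemma complex_differentiable_at_linear:
  fixes L :: "complex ^ 'n::finite \<Rightarrow> complex"
  assumes "\<And>x y. L (x + y) = L x + L y" "\<And>c x. L (c *s x) = c * L x"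
  shows "complex_differentiable_at L p"
proof -
  have "linear L"
  proof (rule linearI)
    fix r x
    have "L (r *\<^sub>R x) = L (of_real r *s x)"
      by (rule arg_cong[where f = L]) (simp add: vec_eq_iff, simp add: scaleR_conv_of_real)
    then show "L (r *\<^sub>R x) = r *\<^sub>R L x" by (simp add: assms(2) scaleR_conv_of_real)
  qed (rule assms(1))
  then have "(L has_derivative L) (at p)" by (rule linear_imp_has_derivative)
  then show ?thesis using assms(2) unfolding complex_differentiable_at_def by blast
qed

lemma complex_differentiable_at_mult:
  assumes "complex_differentiable_at f p" "complex_differentiable_at g p"
  shows "complex_differentiable_at (\<lambda>x. f x * g x) p"
proof -
  obtain f' g' where "(f has_derivative f') (at p)" "\<forall>c v. f' (c *s v) = c * f' v"
    "(g has_derivative g') (at p)" "\<forall>c v. g' (c *s v) = c * g' v"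
    using assms unfolding complex_differentiable_at_def by blast
  then show ?thesis unfolding complex_differentiable_at_def
    by (intro exI[of _ "\<lambda>h. f p * g' h + f' h * g p"] conjI has_derivative_mult) (auto simp: algebra_simps)
qed

lemma complex_differentiable_at_compose:
  assumes f: "complex_differentiable_at f p" and g: "g field_differentiable at (f p)"
  shows "complex_differentiable_at (\<lambda>x. g (f x)) p"
proof -
  obtain f' where f': "(f has_derivative f') (at p)" "\<forall>c v. f' (c *s v) = c * f' v"
    using f unfolding complex_differentiable_at_def by blast
  obtain d where "(g has_derivative (\<lambda>h. d * h)) (at (f p))"
    using g unfolding field_differentiable_def has_field_derivative_def by blast
  from diff_chain_at[OF f'(1) this] f'(2) show ?thesis
    unfolding complex_differentiable_at_def o_def by (intro exI[of _ "\<lambda>h. d * f' h"]) auto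
qed

lemma kernel_gen_holomorphic: "kernel_gen \<mu> m holomorphic_on ball 0 1"
  unfolding kernel_gen_def[abs_def] kernel_cubic_def by (intro holomorphic_intros) auto

lemma hartogs_kernel_holomorphic:
  fixes w :: "complex ^ (3 + 'm::finite)"
  assumes w: "w \<in> Omega_hat \<mu>" and \<mu>: "\<mu> > 0"
  shows "holomorphic_several_on (\<lambda>p. hartogs_kernel \<mu> p w) (Omega_hat \<mu>)"
  unfolding holomorphic_several_on_def complex_differentiable_at_def[symmetric]
proof
  fix p :: "complex ^ (3 + 'm)" assume p: "p \<in> Omega_hat \<mu>"
  obtain x0 \<delta> where x0: "x0 < 1" and s: "norm (herm (vec_left p) (vec_left w)) < 1"
    and X: "norm (herm (vec_right p) (vec_right w) * (1 - herm (vec_left p) (vec_left w)) powr (- of_real \<mu>)) \<le> x0"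
    using hartogs_kernel_arguments[OF w \<mu>] p by metis
  have dl: "complex_differentiable_at (\<lambda>p :: complex ^ (3 + 'm). herm (vec_left p) (vec_left w)) p"
    by (rule complex_differentiable_at_linear) (simp_all add: herm_def vec_left_def sum.distrib sum_distrib_left algebra_simps)
  have dr: "complex_differentiable_at (\<lambda>p :: complex ^ (3 + 'm). herm (vec_right p) (vec_right w)) p"
    by (rule complex_differentiable_at_linear) (simp_all add: herm_def vec_right_def sum.distrib sum_distrib_left algebra_simps)
  have powr_d: "complex_differentiable_at (\<lambda>p. (1 - herm (vec_left p) (vec_left w)) powr c) p" for c
  proof (rule complex_differentiable_at_compose[OF dl])
    have "Re (herm (vec_left p) (vec_left w)) < 1" using s complex_Re_le_cmod order.strict_trans1 by blast
    then have "(\<lambda>u. (1 - u) powr c) holomorphic_on {u. Re u < 1}" "herm (vec_left p) (vec_left w) \<in> {u. Re u < 1}"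
      by (auto intro!: holomorphic_intros simp: complex_nonpos_Reals_iff)
    then show "(\<lambda>u. (1 - u) powr c) field_differentiable at (herm (vec_left p) (vec_left w))"
      by (rule holomorphic_on_imp_differentiable_at[OF _ open_halfspace_Re_lt])
  qed
  have "kernel_gen \<mu> CARD('m) field_differentiable at (herm (vec_right p) (vec_right w) * (1 - herm (vec_left p) (vec_left w)) powr (- of_real \<mu>))"
    using X x0 by (intro holomorphic_on_imp_differentiable_at[OF kernel_gen_holomorphic]) auto
  then show "complex_differentiable_at (\<lambda>p. hartogs_kernel \<mu> p w) p"
    unfolding hartogs_kernel_def kernel_fun_def
    by (intro complex_differentiable_at_mult powr_d
        complex_differentiable_at_compose[where g = "kernel_gen \<mu> CARD('m)"] dr)
qed

lemma hartogs_kernel_bounded: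
  fixes w :: "complex ^ (3 + 'm::finite)"
  assumes w: "w \<in> Omega_hat \<mu>" and \<mu>: "\<mu> > 0"
  obtains B where "\<And>p. p \<in> Omega_hat \<mu> \<Longrightarrow> norm (hartogs_kernel \<mu> p w) \<le> B"
proof -
  obtain x0 \<delta> where x0: "0 \<le> x0" "x0 < 1" and \<delta>: "\<delta> > 0"
    and d: "\<And>p :: complex ^ (3 + 'm). p \<in> Omega_hat \<mu> \<Longrightarrow> \<delta> \<le> norm (1 - herm (vec_left p) (vec_left w))"
    and X: "\<And>p :: complex ^ (3 + 'm). p \<in> Omega_hat \<mu> \<Longrightarrow> norm (herm (vec_right p) (vec_right w) * (1 - herm (vec_left p) (vec_left w)) powr (- of_real \<mu>)) \<le> x0"
    using hartogs_kernel_arguments[OF w \<mu>] by metis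
  have "continuous_on (cball 0 x0) (kernel_gen \<mu> CARD('m))"
    using x0 by (intro holomorphic_on_imp_continuous_on holomorphic_on_subset[OF kernel_gen_holomorphic]) auto
  then have "bounded (kernel_gen \<mu> CARD('m) ` cball 0 x0)"
    using compact_continuous_image compact_imp_bounded compact_cball by blast
  then obtain B where "\<forall>y\<in>kernel_gen \<mu> CARD('m) ` cball 0 x0. norm y \<le> B"
    unfolding bounded_iff by blast
  then have B: "norm (kernel_gen \<mu> CARD('m) x) \<le> B" if "norm x \<le> x0" for x
    using that by auto
  show ?thesis
  proof (rule that)
    fix p :: "complex ^ (3 + 'm)" assume p: "p \<in> Omega_hat \<mu>"
    show "norm (hartogs_kernel \<mu> p w) \<le> \<delta> powr (- (4 + \<mu> * real CARD('m))) * B"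
      unfolding hartogs_kernel_def kernel_fun_def norm_mult norm_powr_minus_of_real
    proof (rule mult_mono)
      have "\<mu> * real CARD('m) \<ge> 0" using \<mu> by simp
      then have "- (4 + \<mu> * real CARD('m)) \<le> 0" by linarith
      then show "norm (1 - herm (vec_left p) (vec_left w)) powr (- (4 + \<mu> * real CARD('m))) \<le> \<delta> powr (- (4 + \<mu> * real CARD('m)))"
        using \<delta> d[OF p] by (rule powr_mono2')
    qed (use B[OF X[OF p]] in auto)
  qed
qed

lemma Omega_hat_finite_measure:
  assumes \<mu>: "\<mu> > 0"
  shows "emeasure lborel (Omega_hat \<mu> :: (complex ^ (3 + 'm::finite)) set) < \<infinity>"
proof -
  have "emeasure lborel (Omega_hat \<mu> :: (complex ^ (3 + 'm)) set) =
     (\<integral>\<^sup>+p. indicator (Omega_hat \<mu>) p * ennreal (norm ((p :: complex ^ (3 + 'm)) $ Inl undefined) ^ (2 * 0) * norm (p $ Inr undefined) ^ (2 * 0)) \<partial>lborel)"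
    by simp
  also have "\<dots> < \<infinity>" unfolding nn_integral_monomial_Omega_hat[OF \<mu>] by simp
  finally show ?thesis .
qed

lemma bergman_space_integrable:
  fixes f :: "complex ^ (3 + 'm::finite) \<Rightarrow> complex"
  assumes f: "f \<in> bergman_space (Omega_hat \<mu>)" and \<mu>: "\<mu> > 0"
  shows "set_integrable lborel (Omega_hat \<mu>) f"
proof -
  have hol: "holomorphic_several_on f (Omega_hat \<mu>)" and sq: "set_integrable lborel (Omega_hat \<mu>) (\<lambda>z. (norm (f z))\<^sup>2)"
    using f by (auto simp: bergman_space_def)
  have m: "(\<lambda>p. indicator (Omega_hat \<mu>) p *\<^sub>R f p) \<in> borel_measurable borel"
    using borel_measurable_continuous_on_indicator[OF Omega_hat_borel holomorphic_several_on_imp_continuous_on[OF hol]] .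
  have "integrable lborel (\<lambda>p. indicator (Omega_hat \<mu>) p *\<^sub>R (1 :: real) + indicator (Omega_hat \<mu>) p *\<^sub>R (norm (f p))\<^sup>2)"
    using sq Omega_hat_finite_measure[OF \<mu>] unfolding set_integrable_def
    by (intro Bochner_Integration.integrable_add) auto
  then show ?thesis unfolding set_integrable_def
  proof (rule Bochner_Integration.integrable_bound)
    have "norm z \<le> 1 + (norm z)\<^sup>2" for z :: complex
      using zero_le_power2[of "norm z - 1 / 2"] by (simp add: power2_eq_square algebra_simps)
    then show "AE p in lborel. norm (indicator (Omega_hat \<mu>) p *\<^sub>R f p) \<le>
        norm (indicator (Omega_hat \<mu>) p *\<^sub>R (1 :: real) + indicator (Omega_hat \<mu>) p *\<^sub>R (norm (f p))\<^sup>2)"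
      by (intro AE_I2) (auto simp: indicator_def)
  qed (use m in simp)
qed

lemma hartogs_kernel_in_bergman_space:
  fixes w :: "complex ^ (3 + 'm::finite)"
  assumes w: "w \<in> Omega_hat \<mu>" and \<mu>: "\<mu> > 0"
  shows "(\<lambda>p. hartogs_kernel \<mu> p w) \<in> bergman_space (Omega_hat \<mu>)"
proof -
  let ?U = "Omega_hat \<mu> :: (complex ^ (3 + 'm)) set"
  note hol = hartogs_kernel_holomorphic[OF w \<mu>]
  obtain B where B: "\<And>p. p \<in> ?U \<Longrightarrow> norm (hartogs_kernel \<mu> p w) \<le> B"
    using hartogs_kernel_bounded[OF w \<mu>] by blast
  have "continuous_on ?U (\<lambda>p. (norm (hartogs_kernel \<mu> p w))\<^sup>2)"
    by (intro continuous_intros holomorphic_several_on_imp_continuous_on[OF hol])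
  then have m: "(\<lambda>p. indicator ?U p *\<^sub>R (norm (hartogs_kernel \<mu> p w))\<^sup>2) \<in> borel_measurable borel"
    by (rule borel_measurable_continuous_on_indicator[OF Omega_hat_borel])
  have "integrable lborel (\<lambda>p. indicator ?U p *\<^sub>R B\<^sup>2)"
    using Omega_hat_finite_measure[OF \<mu>, where ?'m = 'm] by auto
  then have "set_integrable lborel ?U (\<lambda>p. (norm (hartogs_kernel \<mu> p w))\<^sup>2)"
    unfolding set_integrable_def
    by (rule Bochner_Integration.integrable_bound) (use m B in \<open>auto simp: indicator_def intro!: power_mono AE_I2\<close>)
  then show ?thesis using hol by (simp add: bergman_space_def)
qed

text \<open>
  The blockwise unitary map \<open>T\<close> takes the point with real entries \<open>norm (vec_left w)\<close> and \<open>norm (vec_right w)\<close> on two axes to \<open>w\<close>.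
  It preserves the domain, Lebesgue measure, and the kernel, which depends on Hermitian products of the blocks only.
\<close>

lemma hartogs_kernel_reproducing:
  fixes f :: "complex ^ (3 + 'm::finite) \<Rightarrow> complex"
  assumes f: "f \<in> bergman_space (Omega_hat \<mu>)" and w: "w \<in> Omega_hat \<mu>" and \<mu>: "\<mu> > 0"
  shows "f w = (LINT p:Omega_hat \<mu>|lborel. f p * cnj (hartogs_kernel \<mu> p w))"
proof -
  define U where "U = (Omega_hat \<mu> :: (complex ^ (3 + 'm)) set)"
  obtain a :: 3 and b :: 'm where True by blast
  obtain H1 :: "complex ^ 3 \<Rightarrow> complex ^ 3" where H1: "\<And>x y. H1 (x + y) = H1 x + H1 y" "\<And>c x. H1 (c *s x) = c *s H1 x"
    "\<And>x y. herm (H1 x) (H1 y) = herm x y" "H1 (axis a (of_real (norm (vec_left w)))) = vec_left w"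
    using unitary_from_axis[of a "vec_left w"] by blast
  obtain H2 :: "complex ^ 'm \<Rightarrow> complex ^ 'm" where H2: "\<And>x y. H2 (x + y) = H2 x + H2 y" "\<And>c x. H2 (c *s x) = c *s H2 x"
    "\<And>x y. herm (H2 x) (H2 y) = herm x y" "H2 (axis b (of_real (norm (vec_right w)))) = vec_right w"
    using unitary_from_axis[of b "vec_right w"] by blast
  define T where "T = (\<lambda>p :: complex ^ (3 + 'm). join_vec (H1 (vec_left p)) (H2 (vec_right p)))"
  have lr: "vec_left (join_vec z Z) = z" "vec_right (join_vec z Z) = Z" for z :: "complex ^ 3" and Z :: "complex ^ 'm"
    by (simp_all add: vec_left_def vec_right_def join_vec_def vec_eq_iff)
  have TT: "vec_left (T p) = H1 (vec_left p)" "vec_right (T p) = H2 (vec_right p)" for p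
    by (simp_all add: T_def lr)
  have T_add: "T (x + y) = T x + T y" for x y
  proof -
    have "vec_left (x + y) = vec_left x + vec_left y" "vec_right (x + y) = vec_right x + vec_right y"
      by (simp_all add: vec_left_def vec_right_def vec_eq_iff)
    then have "T (x + y) = join_vec (H1 (vec_left x) + H1 (vec_left y)) (H2 (vec_right x) + H2 (vec_right y))"
      by (simp only: T_def H1(1) H2(1))
    then show ?thesis by (auto simp: T_def join_vec_def vec_eq_iff split: sum.split)
  qed
  have T_smult: "T (c *s x) = c *s T x" for c x
  proof -
    have "vec_left (c *s x) = c *s vec_left x" "vec_right (c *s x) = c *s vec_right x"
      by (simp_all add: vec_left_def vec_right_def vec_eq_iff)
    then have "T (c *s x) = join_vec (c *s H1 (vec_left x)) (c *s H2 (vec_right x))"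
      by (simp only: T_def H1(2) H2(2))
    then show ?thesis by (auto simp: T_def join_vec_def vec_eq_iff split: sum.split)
  qed
  have linT: "linear T"
  proof (rule linearI[OF T_add])
    fix r x
    have "T (r *\<^sub>R x) = T (of_real r *s x)"
      by (rule arg_cong[where f = T]) (simp add: vec_eq_iff, simp add: scaleR_conv_of_real)
    then show "T (r *\<^sub>R x) = r *\<^sub>R T x" by (simp add: T_smult vec_eq_iff, simp add: scaleR_conv_of_real)
  qed
  have isoH1: "norm (H1 x) = norm x" for x
    using H1(3)[of x x] unfolding herm_self of_real_eq_iff by (simp add: power2_eq_iff_nonneg)
  have isoH2: "norm (H2 x) = norm x" for x
    using H2(3)[of x x] unfolding herm_self of_real_eq_iff by (simp add: power2_eq_iff_nonneg)
  have nsq: "(norm p)\<^sup>2 = (norm (vec_left p))\<^sup>2 + (norm (vec_right p))\<^sup>2" for p :: "complex ^ (3 + 'm)"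
  proof -
    have "(\<Sum>i\<in>UNIV. (norm (p $ i))\<^sup>2) = (\<Sum>l\<in>UNIV. (norm (p $ Inl l))\<^sup>2) + (\<Sum>r\<in>UNIV. (norm (p $ Inr r))\<^sup>2)"
      unfolding UNIV_sum by (subst sum.union_disjoint) (auto simp: sum.reindex)
    then show ?thesis by (simp add: vec_left_def vec_right_def norm_vec_def L2_set_def sum_nonneg)
  qed
  have isoT: "norm (T p) = norm p" for p
    by (rule power2_eq_imp_eq) (simp_all add: nsq TT isoH1 isoH2)
  have TU: "T p \<in> U \<longleftrightarrow> p \<in> U" for p
    by (simp add: U_def Omega_hat_iff_norm TT isoH1 isoH2)
  define w' where "w' = axes_vec a b (of_real (norm (vec_left w))) (of_real (norm (vec_right w)))"
  have w'lr: "vec_left w' = axis a (of_real (norm (vec_left w)))" "vec_right w' = axis b (of_real (norm (vec_right w)))"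
    by (simp_all add: w'_def vec_left_def vec_right_def axis_def vec_eq_iff)
  have Tw': "T w' = w"
    unfolding T_def w'lr H1(4) H2(4)
    by (auto simp: vec_eq_iff join_vec_def vec_left_def vec_right_def split: sum.split)
  have w'U: "w' \<in> U" using w TU[of w'] Tw' by (simp add: U_def)
  have kT: "hartogs_kernel \<mu> (T p) w = kernel_fun \<mu> CARD('m) (p $ Inl a * of_real (norm (vec_left w))) (p $ Inr b * of_real (norm (vec_right w)))" for p
  proof -
    have "hartogs_kernel \<mu> (T p) w = hartogs_kernel \<mu> (T p) (T w')" by (simp add: Tw')
    also have "\<dots> = hartogs_kernel \<mu> p w'" by (simp add: hartogs_kernel_def TT H1(3) H2(3))
    finally show ?thesis by (simp add: hartogs_kernel_def w'lr herm_axis) (simp add: vec_left_def vec_right_def)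
  qed
  have hol: "holomorphic_several_on f U" and int: "set_integrable lborel U f"
    using f bergman_space_integrable[OF f \<mu>] by (auto simp: bergman_space_def U_def)
  have holT: "holomorphic_several_on (\<lambda>p. f (T p)) U"
    unfolding holomorphic_several_on_def
  proof
    fix p assume "p \<in> U"
    then obtain f' where f': "(f has_derivative f') (at (T p))" "\<forall>c v. f' (c *s v) = c * f' v"
      using hol TU unfolding holomorphic_several_on_def by blast
    from diff_chain_at[OF linear_imp_has_derivative[OF linT] f'(1)] f'(2)
    show "\<exists>f'. ((\<lambda>p. f (T p)) has_derivative f') (at p) \<and> (\<forall>c v. f' (c *s v) = c * f' v)"
      by (intro exI[of _ "f' \<circ> T"]) (auto simp: o_def T_smult)
  qed
  have distrT: "distr lborel borel T = lborel" by (rule distr_lborel_isometry[OF linT isoT])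
  have [measurable]: "T \<in> borel_measurable borel"
    by (intro borel_measurable_continuous_onI linear_continuous_on linear_conv_bounded_linear[THEN iffD1] linT)
  have intT: "set_integrable lborel U (\<lambda>p. f (T p))"
  proof -
    have "integrable lborel (\<lambda>p. indicator U (T p) *\<^sub>R f (T p))"
      using integrable_distr[of T lborel borel "\<lambda>p. indicator U p *\<^sub>R f p"] int
      unfolding distrT set_integrable_def by simp
    then show ?thesis unfolding set_integrable_def
      by (rule Bochner_Integration.integrable_cong[THEN iffD1, rotated 2]) (auto simp: indicator_def TU)
  qed
  have "f w = f (T w')" by (simp add: Tw')
  also have "\<dots> = (LINT p:U|lborel. f (T p) * cnj (kernel_fun \<mu> CARD('m) (p $ Inl a * of_real (norm (vec_left w))) (p $ Inr b * of_real (norm (vec_right w)))))"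
    using holT intT w'U unfolding U_def w'_def by (intro reproducing_on_axes[OF _ \<mu>]) auto
  also have "\<dots> = (LINT p:U|lborel. f (T p) * cnj (hartogs_kernel \<mu> (T p) w))"
    by (simp add: kT)
  also have "\<dots> = (\<integral>p. indicator U (T p) *\<^sub>R (f (T p) * cnj (hartogs_kernel \<mu> (T p) w)) \<partial>lborel)"
    unfolding set_lebesgue_integral_def by (intro Bochner_Integration.integral_cong) (auto simp: indicator_def TU)
  also have "\<dots> = (\<integral>p. indicator U p *\<^sub>R (f p * cnj (hartogs_kernel \<mu> p w)) \<partial>distr lborel borel T)"
  proof (rule integral_distr[symmetric])
    have "continuous_on U (\<lambda>p. f p * cnj (hartogs_kernel \<mu> p w))"
      using hartogs_kernel_holomorphic[OF w \<mu>] hol unfolding U_def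
      by (intro continuous_intros holomorphic_several_on_imp_continuous_on)
    then show "(\<lambda>p. indicator U p *\<^sub>R (f p * cnj (hartogs_kernel \<mu> p w))) \<in> borel_measurable borel"
      unfolding U_def by (rule borel_measurable_continuous_on_indicator[OF Omega_hat_borel])
  qed simp
  finally show ?thesis unfolding distrT U_def set_lebesgue_integral_def .
qed

lemma bergman_kernel_Omega_hat:
  fixes z w :: "complex ^ (3 + 'm::finite)"
  assumes "\<mu> > 0" "z \<in> Omega_hat \<mu>" "w \<in> Omega_hat \<mu>"
  shows "bergman_kernel (Omega_hat \<mu>) z w = hartogs_kernel \<mu> z w"
proof (rule bergman_kernel_eqI[OF open_Omega_hat _ assms(2,3)])
  show "is_bergman_kernel (Omega_hat \<mu>) (hartogs_kernel \<mu> :: complex ^ (3 + 'm) \<Rightarrow> _)"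
    unfolding is_bergman_kernel_def
    using hartogs_kernel_in_bergman_space hartogs_kernel_reproducing assms(1) by blast
qed

section \<open>Roots of the cubic\<close>

text \<open>
  The weak Routh--Hurwitz criterion. For a root \<open>x + i y\<close> with \<open>y \<noteq> 0\<close> the imaginary part of the equation determines \<open>y\<^sup>2\<close>; inserted
  into the real part it leaves a sum of terms of one sign, with \<open>a3\<^sup>2 * x ^ 3\<close> strictly positive.
\<close>

lemma cubic_no_root_right_half_plane:
  fixes t :: complex and a0 a1 a2 a3 :: real
  assumes a3: "a3 > 0" and a2: "a2 \<ge> 0" and a1: "a1 \<ge> 0" and a0: "a0 \<ge> 0" and H: "a0 * a3 \<le> a1 * a2"
    and t: "Re t > 0"
  shows "of_real a3 * t ^ 3 + of_real a2 * t\<^sup>2 + of_real a1 * t + of_real a0 \<noteq> 0"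
proof
  assume zero: "of_real a3 * t ^ 3 + of_real a2 * t\<^sup>2 + of_real a1 * t + of_real a0 = 0"
  define x y where "x = Re t" and "y = Im t"
  have x: "x > 0" using t by (simp add: x_def)
  have re: "a3 * (x ^ 3 - 3 * x * y\<^sup>2) + a2 * (x\<^sup>2 - y\<^sup>2) + a1 * x + a0 = 0"
    using arg_cong[OF zero, of Re] by (simp add: x_def y_def power2_eq_square power3_eq_cube algebra_simps)
  have im: "y * (a3 * (3 * x\<^sup>2 - y\<^sup>2) + 2 * a2 * x + a1) = 0"
    using arg_cong[OF zero, of Im] by (simp add: x_def y_def power2_eq_square power3_eq_cube algebra_simps)
  show False
  proof (cases "y = 0")
    case True
    have "a3 * x ^ 3 > 0" "a2 * x\<^sup>2 \<ge> 0" "a1 * x \<ge> 0" using a3 a2 a1 x by auto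
    then show False using re a0 True by simp
  next
    case False
    then have "a3 * (3 * x\<^sup>2 - y\<^sup>2) + 2 * a2 * x + a1 = 0" using im by simp
    then have y: "a3 * y\<^sup>2 = 3 * a3 * x\<^sup>2 + 2 * a2 * x + a1" by (simp add: algebra_simps)
    have "a3 * (a3 * (x ^ 3 - 3 * x * y\<^sup>2) + a2 * (x\<^sup>2 - y\<^sup>2) + a1 * x + a0)
      = a3\<^sup>2 * x ^ 3 + a3 * a2 * x\<^sup>2 + a3 * a1 * x + a3 * a0 - (3 * a3 * x + a2) * (a3 * y\<^sup>2)"
      by (simp add: power2_eq_square algebra_simps)
    also have "\<dots> = - (8 * a3\<^sup>2 * x ^ 3 + 8 * a3 * a2 * x\<^sup>2 + 2 * a3 * a1 * x + 2 * a2\<^sup>2 * x + (a1 * a2 - a0 * a3))"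
      unfolding y by (simp add: power2_eq_square power3_eq_cube algebra_simps)
    finally have "8 * a3\<^sup>2 * x ^ 3 + 8 * a3 * a2 * x\<^sup>2 + 2 * a3 * a1 * x + 2 * a2\<^sup>2 * x + (a1 * a2 - a0 * a3) = 0"
      using re by simp
    moreover have "a3\<^sup>2 * x ^ 3 > 0" "a3 * a2 * x\<^sup>2 \<ge> 0" "a3 * a1 * x \<ge> 0" "a2\<^sup>2 * x \<ge> 0"
      using a3 a2 a1 x by auto
    ultimately show False using H by linarith
  qed
qed

definition shifted_coeff2 :: "real \<Rightarrow> real \<Rightarrow> real" where
  "shifted_coeff2 \<mu> m = (m + 1) * (m + 2) * \<mu>\<^sup>2 * (6 + 3 / 2 * (m - 1) * \<mu>)"

definition shifted_coeff1 :: "real \<Rightarrow> real \<Rightarrow> real" where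
  "shifted_coeff1 \<mu> m = (m + 1) * \<mu> * (11 + 6 * (m - 1) * \<mu> + (3 * m\<^sup>2 - 9 * m - 2) / 4 * \<mu>\<^sup>2)"

text \<open>
  Taylor expansion at \<open>1/2\<close>; the constant term is \<open>q_poly\<close>.
\<close>

lemma kernel_cubic_shifted:
  "kernel_cubic \<mu> m (1 / 2 + t) = of_real ((real m + 1) * (real m + 2) * (real m + 3) * \<mu> ^ 3) * t ^ 3
     + of_real (shifted_coeff2 \<mu> (real m)) * t\<^sup>2 + of_real (shifted_coeff1 \<mu> (real m)) * t + of_real (poly (q_poly m) \<mu>)"
proof -
  define M where "M = (of_nat m :: complex)"
  define u where "u = (of_real \<mu> :: complex)"
  show ?thesis
    unfolding kernel_cubic_def shifted_coeff1_def shifted_coeff2_def q_poly_def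
    by (simp add: M_def[symmetric] u_def[symmetric] power2_eq_square power3_eq_cube field_simps)
qed

lemma q_poly_eq:
  "poly (q_poly m) \<mu> = 6 + 11 * (real m - 1) / 2 * \<mu> + 3 * real m * (real m - 3) / 2 * \<mu>\<^sup>2
     + (real m - 1) * ((real m)\<^sup>2 - 5 * real m - 2) / 8 * \<mu> ^ 3"
  by (simp add: q_poly_def power2_eq_square power3_eq_cube algebra_simps)

text \<open>
  The quadratic coefficient inside \<open>shifted_coeff1\<close> is negative only for \<open>m \<le> 3\<close>; there \<open>q_poly\<close> has a negative term as
  well, and its nonnegativity bounds \<open>\<mu>\<close>.
\<close>

lemma shifted_coeff1_nonneg:
  assumes m: "m \<ge> 1" and \<mu>: "\<mu> > 0" and q: "poly (q_poly m) \<mu> \<ge> 0"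
  shows "shifted_coeff1 \<mu> (real m) \<ge> 0"
proof -
  have "11 + 6 * (real m - 1) * \<mu> + (3 * (real m)\<^sup>2 - 9 * real m - 2) / 4 * \<mu>\<^sup>2 \<ge> 0"
  proof -
    consider "m = 1" | "m = 2" | "m = 3" | "m \<ge> 4" using m by linarith
    then show ?thesis
    proof cases
      case 1
      then show ?thesis using q by (simp add: q_poly_eq power2_eq_square)
    next
      case 2
      have "6 + 11 / 2 * \<mu> - 3 * \<mu>\<^sup>2 - \<mu> ^ 3 \<ge> 0" using q 2 by (simp add: q_poly_eq)
      moreover have "\<mu> ^ 3 > 0" using \<mu> by simp
      ultimately have "3 * \<mu>\<^sup>2 \<le> 6 + 11 / 2 * \<mu>" by linarith
      then show ?thesis using 2 \<mu> by simp
    next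
      case 3
      have "\<mu> \<le> 24"
      proof (rule ccontr)
        assume "\<not> \<mu> \<le> 24"
        then have a: "\<mu> > 24" by simp
        have "\<mu> * \<mu> > 24 * 24" using a by (intro mult_strict_mono) auto
        then have "\<mu> * (\<mu> * \<mu>) > \<mu> * 24" using \<mu> by (intro mult_strict_left_mono) auto
        moreover have "6 + 11 * \<mu> - 2 * (\<mu> * (\<mu> * \<mu>)) \<ge> 0" using q 3 by (simp add: q_poly_eq power3_eq_cube mult.assoc)
        ultimately show False using a by linarith
      qed
      then have "\<mu> * \<mu> \<le> 24 * \<mu>" using \<mu> by (intro mult_right_mono) auto
      then show ?thesis using 3 by (simp add: power2_eq_square)
    next
      case 4
      then have "4 * real m \<le> real m * real m" by (intro mult_right_mono) auto
      then have "3 * (real m)\<^sup>2 - 9 * real m - 2 \<ge> 0" using 4 of_nat_mono[OF 4, where ?'a = real] unfolding power2_eq_square by linarith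
      then show ?thesis using 4 \<mu> by (intro add_nonneg_nonneg mult_nonneg_nonneg) auto
    qed
  qed
  then show ?thesis unfolding shifted_coeff1_def using \<mu> by (intro mult_nonneg_nonneg) auto
qed

text \<open>
  Up to a positive factor the difference of the two sides is the polynomial \<open>E\<close> in \<open>\<mu>\<close>. Its coefficients are nonnegative for
  \<open>m \<ge> 3\<close>; for \<open>m = 1\<close> and \<open>m = 2\<close> the hypothesis on \<open>q_poly\<close> compensates the negative one.
\<close>

lemma hurwitz_condition:
  assumes m: "m \<ge> 1" and \<mu>: "\<mu> > 0" and q: "poly (q_poly m) \<mu> \<ge> 0"
  shows "poly (q_poly m) \<mu> * ((real m + 1) * (real m + 2) * (real m + 3) * \<mu> ^ 3) \<le> shifted_coeff1 \<mu> (real m) * shifted_coeff2 \<mu> (real m)"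
proof -
  define x where "x = real m"
  define E where "E = 60 * x + 48 + (x - 1) * (47 * x + 36) * \<mu> + 6 * (2 * x ^ 3 - 3 * x\<^sup>2 - 2 * x + 1) * \<mu>\<^sup>2
     + (x - 1) * x * (x\<^sup>2 - 2 * x - 2) * \<mu> ^ 3"
  have eq: "shifted_coeff1 \<mu> x * shifted_coeff2 \<mu> x - poly (q_poly m) \<mu> * ((x + 1) * (x + 2) * (x + 3) * \<mu> ^ 3)
     = (x + 1) * (x + 2) * \<mu> ^ 3 * E"
    unfolding shifted_coeff1_def shifted_coeff2_def q_poly_eq x_def[symmetric] E_def
    by (simp add: power2_eq_square power3_eq_cube field_simps)
  have "E \<ge> 0"
  proof -
    consider "m = 1" | "m = 2" | "m \<ge> 3" using m by linarith
    then show ?thesis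
    proof cases
      case 1
      then show ?thesis using q by (simp add: E_def x_def q_poly_eq)
    next
      case 2
      have "6 + 11 / 2 * \<mu> - 3 * \<mu>\<^sup>2 - \<mu> ^ 3 \<ge> 0" using q 2 by (simp add: q_poly_eq)
      moreover have "\<mu>\<^sup>2 \<ge> 0" by simp
      ultimately have "4 * \<mu> ^ 3 \<le> 168 + 130 * \<mu> + 6 * \<mu>\<^sup>2" using \<mu> by linarith
      then show ?thesis using 2 by (simp add: E_def x_def)
    next
      case 3
      then have x: "x \<ge> 3" by (simp add: x_def)
      then have xx: "x * x \<ge> 3 * x" by (intro mult_right_mono) auto
      have "x * x * (2 * x - 3) \<ge> x * x * 3" using x by (intro mult_left_mono) auto
      then have "2 * x ^ 3 - 3 * x\<^sup>2 \<ge> 3 * (x * x)" by (simp add: power2_eq_square power3_eq_cube algebra_simps)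
      then have 1: "2 * x ^ 3 - 3 * x\<^sup>2 - 2 * x + 1 \<ge> 0" using xx x by linarith
      have 2: "x\<^sup>2 - 2 * x - 2 \<ge> 0" unfolding power2_eq_square using xx x by linarith
      have "(x - 1) * (47 * x + 36) * \<mu> \<ge> 0" using x \<mu> by simp
      moreover have "6 * (2 * x ^ 3 - 3 * x\<^sup>2 - 2 * x + 1) * \<mu>\<^sup>2 \<ge> 0" using 1 by (intro mult_nonneg_nonneg) auto
      moreover have "(x - 1) * x * (x\<^sup>2 - 2 * x - 2) * \<mu> ^ 3 \<ge> 0" using x \<mu> 2 by (intro mult_nonneg_nonneg) auto
      ultimately show ?thesis unfolding E_def using x by linarith
    qed
  qed
  then have "(x + 1) * (x + 2) * \<mu> ^ 3 * E \<ge> 0" using \<mu> by (intro mult_nonneg_nonneg) (auto simp: x_def)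
  then show ?thesis using eq by (simp add: x_def)
qed

lemma kernel_cubic_nonzero:
  assumes m: "m \<ge> 1" and \<mu>: "\<mu> > 0" and q: "poly (q_poly m) \<mu> \<ge> 0" and \<eta>: "Re \<eta> > 1 / 2"
  shows "kernel_cubic \<mu> m \<eta> \<noteq> 0"
proof -
  have "kernel_cubic \<mu> m (1 / 2 + (\<eta> - 1 / 2)) \<noteq> 0"
    unfolding kernel_cubic_shifted
  proof (rule cubic_no_root_right_half_plane)
    show "shifted_coeff2 \<mu> (real m) \<ge> 0"
      unfolding shifted_coeff2_def using m \<mu> by (intro mult_nonneg_nonneg add_nonneg_nonneg) auto
    show "Re (\<eta> - 1 / 2) > 0" using \<eta> by simp
  qed (use m \<mu> q shifted_coeff1_nonneg[OF m \<mu> q] hurwitz_condition[OF m \<mu> q] in auto)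
  then show ?thesis by simp
qed

lemma kernel_cubic_zero:
  assumes \<mu>: "\<mu> > 0" and q: "poly (q_poly m) \<mu> < 0"
  obtains x :: real where "x > 1 / 2" "kernel_cubic \<mu> m (of_real x) = 0"
proof -
  define a3 where "a3 = (real m + 1) * (real m + 2) * (real m + 3) * \<mu> ^ 3"
  have a3: "a3 > 0" using \<mu> by (simp add: a3_def)
  define p where "p = [: poly (q_poly m) \<mu>, shifted_coeff1 \<mu> (real m), shifted_coeff2 \<mu> (real m), a3 :]"
  have "lead_coeff p > 0" using a3 by (simp add: p_def)
  then obtain n where n: "\<And>x. x \<ge> n \<Longrightarrow> poly p x \<ge> lead_coeff p" using poly_pinfty_gt_lc by blast
  have "poly p (max n 1) > 0" using n[of "max n 1"] \<open>lead_coeff p > 0\<close> by simp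
  moreover have "poly p 0 < 0" using q by (simp add: p_def)
  ultimately obtain t where t: "t > 0" "poly p t = 0" using poly_IVT_pos[of 0 "max n 1" p] by (auto simp: less_max_iff_disj)
  have "kernel_cubic \<mu> m (1 / 2 + of_real t) = of_real (poly p t)"
    unfolding kernel_cubic_shifted p_def a3_def by (simp add: power2_eq_square power3_eq_cube algebra_simps)
  then have "kernel_cubic \<mu> m (of_real (1 / 2 + t)) = 0" using t by simp
  with t(1) show ?thesis by (intro that[of "1 / 2 + t"]) auto
qed

text \<open>
  For \<open>1 \<le> m \<le> 5\<close> the linear coefficient is nonnegative and the cubic one nonpositive, so \<open>q_poly m \<mu> / \<mu>\<^sup>2\<close> is strictly
  decreasing whatever the sign of the quadratic coefficient.
\<close>

lemma q_poly_root:
  assumes m: "1 \<le> m" "m \<le> 5"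
  obtains r where "r > 0" "poly (q_poly m) r = 0"
    "\<And>\<mu>. \<mu> > 0 \<Longrightarrow> poly (q_poly m) \<mu> \<ge> 0 \<longleftrightarrow> \<mu> \<le> r" "\<And>\<mu>. \<mu> > 0 \<Longrightarrow> poly (q_poly m) \<mu> = 0 \<longleftrightarrow> \<mu> = r"
proof -
  define A where "A = 11 * (real m - 1) / 2"
  define C where "C = (real m - 1) * ((real m)\<^sup>2 - 5 * real m - 2) / 8"
  have cases: "m = 1 \<or> m = 2 \<or> m = 3 \<or> m = 4 \<or> m = 5" using m by linarith
  have AC: "A \<ge> 0" "C \<le> 0" using cases by (auto simp: A_def C_def)
  \<comment> \<open>Comparison of \<open>q_poly m x / x\<^sup>2\<close> with \<open>q_poly m y / y\<^sup>2\<close>, cleared of denominators.\<close>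
  have dec: "poly (q_poly m) y < 0" if xy: "0 < x" "x < y" and qx: "poly (q_poly m) x \<le> 0" for x y
  proof -
    have "y\<^sup>2 * poly (q_poly m) x - x\<^sup>2 * poly (q_poly m) y
      = 6 * (y\<^sup>2 - x\<^sup>2) + A * (x * y * (y - x)) + (- C) * (x\<^sup>2 * y\<^sup>2 * (y - x))"
      unfolding q_poly_eq A_def[symmetric] C_def[symmetric] by (simp add: power2_eq_square power3_eq_cube algebra_simps)
    also have "\<dots> > 0"
    proof (intro add_pos_nonneg)
      show "6 * (y\<^sup>2 - x\<^sup>2) > 0" using xy by (simp add: power_strict_mono)
      show "A * (x * y * (y - x)) \<ge> 0" using AC xy by (intro mult_nonneg_nonneg) auto
      show "(- C) * (x\<^sup>2 * y\<^sup>2 * (y - x)) \<ge> 0" using AC xy by (intro mult_nonneg_nonneg) auto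
    qed
    finally have "y\<^sup>2 * poly (q_poly m) x - x\<^sup>2 * poly (q_poly m) y > 0" .
    moreover have "y\<^sup>2 * poly (q_poly m) x \<le> 0" using qx by (simp add: mult_nonneg_nonpos)
    ultimately have "x\<^sup>2 * poly (q_poly m) y < 0" by linarith
    then show ?thesis using xy by (simp add: mult_less_0_iff)
  qed
  have "poly (q_poly m) 0 > 0" by (simp add: q_poly_eq)
  moreover have "poly (q_poly m) 100 < 0" using cases by (auto simp: q_poly_eq)
  ultimately obtain r where r: "r > 0" "poly (q_poly m) r = 0"
    using poly_IVT_neg[of 0 100 "q_poly m"] by auto
  have less: "poly (q_poly m) \<mu> > 0" if "\<mu> > 0" "\<mu> < r" for \<mu>
    using dec[OF that] r(2) by (metis less_irrefl linorder_not_le)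
  have gr: "poly (q_poly m) \<mu> < 0" if "\<mu> > r" for \<mu>
    using dec[OF r(1) that] r(2) by simp
  show ?thesis
  proof (rule that[OF r])
    fix \<mu> :: real assume "\<mu> > 0"
    then show "poly (q_poly m) \<mu> \<ge> 0 \<longleftrightarrow> \<mu> \<le> r" "poly (q_poly m) \<mu> = 0 \<longleftrightarrow> \<mu> = r"
      using less[of \<mu>] gr[of \<mu>] r(2) by (cases \<mu> r rule: linorder_cases; simp)+
  qed
qed

lemma q_poly_nonneg:
  assumes "m \<ge> 6" "\<mu> > 0"
  shows "poly (q_poly m) \<mu> \<ge> 0"
proof -
  have "6 * real m \<le> real m * real m" using assms(1) by (intro mult_right_mono) auto
  then have "(real m)\<^sup>2 - 5 * real m - 2 \<ge> 0" using assms(1) of_nat_mono[OF assms(1), where ?'a = real] unfolding power2_eq_square by linarith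
  then show ?thesis unfolding q_poly_eq using assms by (intro add_nonneg_nonneg mult_nonneg_nonneg divide_nonneg_nonneg) auto
qed

section \<open>Zeros of the kernel\<close>

lemma connected_Omega_hat:
  assumes "\<mu> > 0"
  shows "connected (Omega_hat \<mu> :: (complex ^ (3 + 'm::finite)) set)" "Omega_hat \<mu> \<noteq> ({} :: (complex ^ (3 + 'm)) set)"
proof -
  have 0: "(0 :: complex ^ (3 + 'm)) \<in> Omega_hat \<mu>" by (simp add: Omega_hat_iff)
  then show "Omega_hat \<mu> \<noteq> ({} :: (complex ^ (3 + 'm)) set)" by blast
  have "starlike (Omega_hat \<mu> :: (complex ^ (3 + 'm)) set)"
    unfolding starlike_def
  proof (intro bexI[of _ 0] ballI subsetI 0)
    fix x y :: "complex ^ (3 + 'm)" assume x: "x \<in> Omega_hat \<mu>" and "y \<in> closed_segment 0 x"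
    then obtain t where t: "0 \<le> t" "t \<le> 1" and y: "y = t *\<^sub>R x" by (auto simp: in_segment)
    show "y \<in> Omega_hat \<mu>"
      by (rule Omega_hat_shrink[OF x _ assms]) (use t in \<open>auto simp: y mult_left_le_one_le\<close>)
  qed
  then show "connected (Omega_hat \<mu> :: (complex ^ (3 + 'm)) set)" by (rule starlike_imp_connected)
qed

text \<open>
  Every \<open>X\<close> in the disc occurs as an argument of the kernel, already for points whose base component is \<open>0\<close>.
\<close>

lemma Lu_Qikeng_Omega_hat_iff:
  assumes \<mu>: "\<mu> > 0"
  shows "Lu_Qikeng_domain (Omega_hat \<mu> :: (complex ^ (3 + 'm::finite)) set) \<longleftrightarrow>
    (\<forall>X. norm X < 1 \<longrightarrow> kernel_cubic \<mu> CARD('m) (1 / (1 - X)) \<noteq> 0)"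
proof -
  let ?U = "Omega_hat \<mu> :: (complex ^ (3 + 'm)) set"
  have gen: "kernel_gen \<mu> CARD('m) X \<noteq> 0 \<longleftrightarrow> kernel_cubic \<mu> CARD('m) (1 / (1 - X)) \<noteq> 0" if "norm X < 1" for X
    using that by (auto simp: kernel_gen_def)
  have "Lu_Qikeng_domain ?U \<longleftrightarrow> (\<forall>z\<in>?U. \<forall>w\<in>?U. hartogs_kernel \<mu> z w \<noteq> 0)"
    using open_Omega_hat[where ?'m = 'm and \<mu> = \<mu>] connected_Omega_hat[OF \<mu>, where ?'m = 'm] by (simp add: Lu_Qikeng_domain_def bergman_kernel_Omega_hat[OF \<mu>])
  also have "\<dots> \<longleftrightarrow> (\<forall>X. norm X < 1 \<longrightarrow> kernel_cubic \<mu> CARD('m) (1 / (1 - X)) \<noteq> 0)"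
  proof (intro iffI allI impI ballI)
    fix X :: complex assume nz: "\<forall>z\<in>?U. \<forall>w\<in>?U. hartogs_kernel \<mu> z w \<noteq> 0" and X: "norm X < 1"
    obtain a :: 3 and b :: 'm where True by blast
    \<comment> \<open>Any radius strictly between \<open>norm X\<close> and \<open>1\<close> splits \<open>X\<close> as \<open>(X / r) * r\<close> with both factors in the disc.\<close>
    define r where "r = (norm X + 1) / 2"
    have r: "norm X < r" "0 < r" "r < 1" using X by (auto simp: r_def add_nonneg_pos)
    define z where "z = axes_vec a b 0 (X / of_real r)"
    define w where "w = axes_vec a b 0 (of_real r)"
    have "z \<in> ?U" "w \<in> ?U" using r by (auto simp: z_def w_def norm_divide abs_square_less_1)
    then have "hartogs_kernel \<mu> z w \<noteq> 0" using nz by blast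
    moreover have "vec_left z = 0" "vec_left w = 0" "vec_right z = axis b (X / of_real r)" "vec_right w = axis b (of_real r)"
      by (simp_all add: z_def w_def vec_left_def vec_right_def vec_eq_iff axis_def)
    ultimately have "kernel_gen \<mu> CARD('m) X \<noteq> 0"
      using r by (simp add: hartogs_kernel_def kernel_fun_def herm_axis) (simp add: herm_def axis_def)
    then show "kernel_cubic \<mu> CARD('m) (1 / (1 - X)) \<noteq> 0" using gen[OF X] by simp
  next
    fix z w :: "complex ^ (3 + 'm)" assume nz: "\<forall>X. norm X < 1 \<longrightarrow> kernel_cubic \<mu> CARD('m) (1 / (1 - X)) \<noteq> 0"
      and z: "z \<in> ?U" and w: "w \<in> ?U"
    obtain x0 where x0: "x0 < 1" and s: "norm (herm (vec_left z) (vec_left w)) < 1"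
      and X: "norm (herm (vec_right z) (vec_right w) * (1 - herm (vec_left z) (vec_left w)) powr (- of_real \<mu>)) \<le> x0"
      using hartogs_kernel_arguments[OF w \<mu>] z by metis
    have "1 - herm (vec_left z) (vec_left w) \<noteq> 0" using s by auto
    moreover have "kernel_gen \<mu> CARD('m) (herm (vec_right z) (vec_right w) * (1 - herm (vec_left z) (vec_left w)) powr (- of_real \<mu>)) \<noteq> 0"
      using gen nz X x0 by fastforce
    ultimately show "hartogs_kernel \<mu> z w \<noteq> 0" by (simp add: hartogs_kernel_def kernel_fun_def)
  qed
  finally show ?thesis .
qed

lemma Lu_Qikeng_Omega_hat_iff_q_poly:
  assumes \<mu>: "\<mu> > 0"
  shows "Lu_Qikeng_domain (Omega_hat \<mu> :: (complex ^ (3 + 'm::finite)) set) \<longleftrightarrow> poly (q_poly CARD('m)) \<mu> \<ge> 0"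
  unfolding Lu_Qikeng_Omega_hat_iff[OF \<mu>]
proof (intro iffI allI impI)
  fix X :: complex assume q: "poly (q_poly CARD('m)) \<mu> \<ge> 0" and X: "norm X < 1"
  have "(norm (1 - X))\<^sup>2 = 1 - 2 * Re X + (norm X)\<^sup>2"
    unfolding cmod_power2 by (simp add: power2_eq_square algebra_simps)
  moreover have "(norm X)\<^sup>2 < 1" using X by (simp add: abs_square_less_1)
  ultimately have less: "(norm (1 - X))\<^sup>2 < 2 * (1 - Re X)" by (simp add: right_diff_distrib)
  have "norm (1 - X) > 0" using X by auto
  then have "1 / 2 < (1 - Re X) / (norm (1 - X))\<^sup>2" using less by (simp add: pos_less_divide_eq)
  also have "\<dots> = Re (1 / (1 - X))" by (simp add: Re_divide cmod_power2)
  finally have "Re (1 / (1 - X)) > 1 / 2" .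
  then show "kernel_cubic \<mu> CARD('m) (1 / (1 - X)) \<noteq> 0" using q \<mu> by (intro kernel_cubic_nonzero) auto
next
  assume nz: "\<forall>X. norm X < 1 \<longrightarrow> kernel_cubic \<mu> CARD('m) (1 / (1 - X)) \<noteq> 0"
  show "poly (q_poly CARD('m)) \<mu> \<ge> 0"
  proof (rule ccontr)
    assume "\<not> poly (q_poly CARD('m)) \<mu> \<ge> 0"
    then obtain x where x: "x > 1 / 2" "kernel_cubic \<mu> CARD('m) (of_real x) = 0"
      using kernel_cubic_zero[OF \<mu>, of "CARD('m)"] by auto
    have "\<bar>1 - 1 / x\<bar> < 1" using x(1) by (auto simp: abs_less_iff field_simps)
    then have "norm (of_real (1 - 1 / x) :: complex) < 1" by (simp only: norm_of_real)
    then have "kernel_cubic \<mu> CARD('m) (1 / (1 - of_real (1 - 1 / x))) \<noteq> 0" using nz by blast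
    moreover have "1 / (1 - of_real (1 - 1 / x)) = (of_real x :: complex)" using x(1) by simp
    ultimately show False using x(2) by simp
  qed
qed

theorem mainTheorem4:
  shows
    "(CARD('m::finite) \<ge> 6 \<longrightarrow>
        (\<forall>\<mu>::real. \<mu> > 0 \<longrightarrow> Lu_Qikeng_domain (Omega_hat \<mu> :: (complex ^ (3 + 'm)) set))) \<and>
     (1 \<le> CARD('m) \<and> CARD('m) \<le> 5 \<longrightarrow>
        (\<exists>!r. r > 0 \<and> poly (q_poly CARD('m)) r = 0) \<and>
        (\<forall>\<mu>::real. \<mu> > 0 \<longrightarrow>
           (Lu_Qikeng_domain (Omega_hat \<mu> :: (complex ^ (3 + 'm)) set) \<longleftrightarrow>
            0 < \<mu> \<and> \<mu> \<le> mu_root CARD('m))))"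
proof (intro conjI impI)
  assume "CARD('m) \<ge> 6"
  then show "\<forall>\<mu>::real. \<mu> > 0 \<longrightarrow> Lu_Qikeng_domain (Omega_hat \<mu> :: (complex ^ (3 + 'm)) set)"
    by (simp add: Lu_Qikeng_Omega_hat_iff_q_poly q_poly_nonneg)
next
  assume "1 \<le> CARD('m) \<and> CARD('m) \<le> 5"
  then obtain r where r: "r > 0" "poly (q_poly CARD('m)) r = 0"
    and sign: "\<And>\<mu>. \<mu> > 0 \<Longrightarrow> poly (q_poly CARD('m)) \<mu> \<ge> 0 \<longleftrightarrow> \<mu> \<le> r"
    and zero: "\<And>\<mu>. \<mu> > 0 \<Longrightarrow> poly (q_poly CARD('m)) \<mu> = 0 \<longleftrightarrow> \<mu> = r"
    using q_poly_root[of "CARD('m)"] by metis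
  show "\<exists>!r. r > 0 \<and> poly (q_poly CARD('m)) r = 0"
    using r zero by blast
  have "mu_root CARD('m) = r"
    unfolding mu_root_def using r zero by (intro the_equality) blast+
  then show "\<forall>\<mu>::real. \<mu> > 0 \<longrightarrow> (Lu_Qikeng_domain (Omega_hat \<mu> :: (complex ^ (3 + 'm)) set) \<longleftrightarrow> 0 < \<mu> \<and> \<mu> \<le> mu_root CARD('m))"
    by (simp add: Lu_Qikeng_Omega_hat_iff_q_poly sign)
qed

end
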